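(* Let $\mathbf{X}\in\mathbb{R}^{n\times p}$ be a fixed matrix of full column rank $p<n$, let $\mathbf{y}\sim N(\mathbf{X}\boldsymbol{\beta}_0,\sigma^2\mathbf{I}_n)$ with $\boldsymbol{\beta}_0\in\mathbb{R}^p$ and $\sigma>0$, let $k\ge p$, and let $\mathbf{S}$ be a $k\times n$ Gaussian sketching matrix independent of $\mathbf{y}$. Then, under the joint randomness of $\mathbf{y}$ and $\mathbf{S}$, the complete sketch estimator satisfies the equality in distribution $$\boldsymbol{\beta}_s\overset{d}{=}\boldsymbol{\beta}_0+\sigma\left(1+\frac{V}{U}\right)^{1/2}(\mathbf{X}^{\mathsf T}\mathbf{X})^{-1/2}\mathbf{Z},$$ where $\mathbf{Z}\sim N(\mathbf{0}_p,\mathbf{I}_p)$, $V\sim\chi^2_{n-p}$ and $U\sim\chi^2_{k-p+1}$ are independent.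
   Context: A Gaussian sketching matrix $\mathbf{S}$ of size $k\times n$ has independent entries $\mathbf{S}_{ij}\sim N(0,1/k)$. The sketched data are $\mathbf{X}_s=\mathbf{S}\mathbf{X}$ and $\mathbf{y}_s=\mathbf{S}\mathbf{y}$, and the complete sketch estimator is $\boldsymbol{\beta}_s=(\mathbf{X}_s^{\mathsf T}\mathbf{X}_s)^{-1}\mathbf{X}_s^{\mathsf T}\mathbf{y}_s$ (defined almost surely). $(\mathbf{X}^{\mathsf T}\mathbf{X})^{-1/2}$ is the symmetric positive definite inverse square root. *)

theory Defs
  imports "HOL-Probability.Probability"
begin

definition pos_def :: "real^'n^'n \<Rightarrow> bool" where
  "pos_def A \<longleftrightarrow> transpose A = A \<and> (\<forall>x. x \<noteq> 0 \<longrightarrow> x \<bullet> (A *v x) > 0)"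

text \<open>The symmetric positive definite inverse square root; it exists and is unique
  whenever the argument is itself symmetric positive definite.\<close>

definition inv_sqrt_matrix :: "real^'n^'n \<Rightarrow> real^'n^'n" where
  "inv_sqrt_matrix A = (THE B. pos_def B \<and> B ** B = matrix_inv A)"

definition mvn_density :: "real^'n \<Rightarrow> real^'n^'n \<Rightarrow> real^'n \<Rightarrow> real" where
  "mvn_density \<mu> \<Sigma> x =
     exp (- ((x - \<mu>) \<bullet> (matrix_inv \<Sigma> *v (x - \<mu>))) / 2) / sqrt ((2 * pi) ^ CARD('n) * det \<Sigma>)"

text \<open>Non-degenerate multivariate normal law with mean \<open>\<mu>\<close> and covariance matrix \<open>\<Sigma>\<close>.\<close>

definition mvn_distributed :: "'a measure \<Rightarrow> ('a \<Rightarrow> real^'n) \<Rightarrow> real^'n \<Rightarrow> real^'n^'n \<Rightarrow> bool" where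
  "mvn_distributed M Y \<mu> \<Sigma> \<longleftrightarrow> pos_def \<Sigma> \<and> distributed M lborel Y (mvn_density \<mu> \<Sigma>)"

definition chi_square_density :: "nat \<Rightarrow> real \<Rightarrow> real" where
  "chi_square_density d x =
     (if x \<le> 0 then 0
      else x powr (real d / 2 - 1) * exp (- x / 2) / (2 powr (real d / 2) * Gamma (real d / 2)))"

definition chi_square_distributed :: "'a measure \<Rightarrow> ('a \<Rightarrow> real) \<Rightarrow> nat \<Rightarrow> bool" where
  "chi_square_distributed M V d \<longleftrightarrow> 0 < d \<and> distributed M lborel V (chi_square_density d)"

text \<open>Independence of random variables is independence of the generated sigma-algebras. The
  library constants \<open>indep_var\<close> and \<open>indep_vars\<close> require all variables to have the
  same codomain type, so the following definitions cover variables with different codomains.\<close>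

definition sigma_of :: "'a measure \<Rightarrow> ('a \<Rightarrow> 'b::topological_space) \<Rightarrow> 'a set set" where
  "sigma_of M X = sets (vimage_algebra (space M) X borel)"

definition indep_rv2 ::
    "'a measure \<Rightarrow> ('a \<Rightarrow> 'b::topological_space) \<Rightarrow> ('a \<Rightarrow> 'c::topological_space) \<Rightarrow> bool" where
  "indep_rv2 M X Y \<longleftrightarrow> prob_space.indep_set M (sigma_of M X) (sigma_of M Y)"

definition indep_rv3 ::
    "'a measure \<Rightarrow> ('a \<Rightarrow> 'b::topological_space) \<Rightarrow> ('a \<Rightarrow> 'c::topological_space)
      \<Rightarrow> ('a \<Rightarrow> 'd::topological_space) \<Rightarrow> bool" where
  "indep_rv3 M X Y Z \<longleftrightarrow>
     prob_space.indep_sets M (\<lambda>i. [sigma_of M X, sigma_of M Y, sigma_of M Z] ! i) {..<3}"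

text \<open>The second parameter of \<open>normal_density\<close> is the standard deviation, so variance
  \<open>1 / k\<close> becomes \<open>1 / sqrt k\<close>.\<close>

definition gaussian_sketch :: "'a measure \<Rightarrow> ('a \<Rightarrow> real^'n^'k) \<Rightarrow> bool" where
  "gaussian_sketch M S \<longleftrightarrow>
     prob_space.indep_vars M (\<lambda>_. borel) (\<lambda>(i, j) \<omega>. S \<omega> $ i $ j) (UNIV :: ('k \<times> 'n) set) \<and>
     (\<forall>i j. distributed M lborel (\<lambda>\<omega>. S \<omega> $ i $ j)
              (normal_density 0 (1 / sqrt (real CARD('k)))))"

text \<open>Where the Gram matrix of the sketched design is singular, \<open>matrix_inv\<close> is a fixed
  unspecified matrix; for a Gaussian sketch with at least as many rows as the full-column-rank
  design has columns, this happens with probability zero.\<close>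

definition complete_sketch_estimator :: "real^'n^'k \<Rightarrow> real^'p^'n \<Rightarrow> real^'n \<Rightarrow> real^'p" where
  "complete_sketch_estimator S X y =
     (let Xs = S ** X; ys = S *v y
      in matrix_inv (transpose Xs ** Xs) *v (transpose Xs *v ys))"

definition eq_in_distribution ::
    "'a measure \<Rightarrow> ('a \<Rightarrow> 'c::topological_space) \<Rightarrow> 'b measure \<Rightarrow> ('b \<Rightarrow> 'c) \<Rightarrow> bool" where
  "eq_in_distribution M X N Y \<longleftrightarrow>
     X \<in> borel_measurable M \<and> Y \<in> borel_measurable N \<and> distr M borel X = distr N borel Y"

end

theory Submission
  imports Defs
begin

text \<open>Write \<open>X = Q R\<close> with \<open>R = (X\<^sup>T X)\<^sup>1\<^sup>/\<^sup>2\<close> and orthonormal columns in \<open>Q\<close>, and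
  \<open>y = X \<beta>\<^sub>0 + \<sigma> \<epsilon>\<close>. After rotating, \<open>Q\<close> selects coordinates: \<open>A = S Q\<close> and the remaining
  columns of \<open>S\<close> are independent, and \<open>\<epsilon> = (z\<^sub>1, z\<^sub>2)\<close>. Then
  \<open>\<beta>\<^sub>s = \<beta>\<^sub>0 + \<sigma> R\<^sup>-\<^sup>1 (z\<^sub>1 + A\<^sup>+ S z\<^sub>2)\<close>, where \<open>A\<^sup>+ = (A\<^sup>T A)\<^sup>-\<^sup>1 A\<^sup>T\<close>, and for fixed \<open>\<epsilon>\<close> the vector \<open>S z\<^sub>2\<close> is distributed as
  \<open>|z\<^sub>2| w\<close> with \<open>w\<close> standard Gaussian independent of \<open>A\<close>. The vector \<open>A\<^sup>+ w\<close> has the law of \<open>z / U\<^sup>1\<^sup>/\<^sup>2\<close>: both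
  densities at \<open>t\<close> are proportional to \<open>(1 + |t|\<^sup>2) powr (-(k + 1) / 2)\<close> by a change of variables
  (a rotation and a rescaling of one column of \<open>A\<close>, respectively a rescaling of \<open>U\<close>), and the
  constants agree because both are probability densities. Finally \<open>V = |z\<^sub>2|\<^sup>2\<close> is chi-square distributed and
  independent of \<open>z\<^sub>1\<close>, and \<open>z\<^sub>1 + (V / U)\<^sup>1\<^sup>/\<^sup>2 z\<close> is a Gaussian vector scaled by \<open>(1 + V / U)\<^sup>1\<^sup>/\<^sup>2\<close>.\<close>

subsection \<open>Standard Gaussian measures and uniqueness of Haar measure\<close>

text \<open>Laws are compared by integrating nonnegative Borel functions, so conditioning on
  \<open>\<epsilon>\<close>, \<open>A\<close> or \<open>U\<close> is just an order of iterated
  integration. The obstacle is the random Gram matrix: given \<open>A\<close>, the vector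
  \<open>pinv A w\<close> is Gaussian with precision \<open>A\<^sup>T A\<close>, and its usual
  density carries a determinant. That normalizing constant is kept as the reciprocal of an integral,
  and uniqueness of Haar measure replaces the Jacobian of a general linear map; only orthogonal maps
  and coordinate scalings are computed explicitly. The degrees of freedom of \<open>U\<close> come
  from matching powers of \<open>r = 1 / sqrt (1 + |t|\<^sup>2)\<close>: rescaling a column of
  \<open>A\<close> gives \<open>r ^ k\<close>, the normalizing constant one more \<open>r\<close>,
  while the substitution in \<open>U\<close> gives \<open>r ^ (d + p)\<close>, whence
  \<open>d = k - p + 1\<close>. That the chi-square densities have mass one is read off from the
  given \<open>V\<close> and \<open>U\<close>, not from the Gamma integral. The inverse square root
  is a definite description, so existence and uniqueness must be established; this is done in the
  operator space, without diagonalization.\<close>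

definition std_gauss_density :: "'a::euclidean_space \<Rightarrow> real" where
  "std_gauss_density x = exp (- (norm x)\<^sup>2 / 2) / sqrt (2 * pi) ^ DIM('a)"

definition std_gauss :: "'a::euclidean_space measure" where
  "std_gauss = density lborel std_gauss_density"

lemma std_gauss_density_pos: "0 < std_gauss_density x"
  by (simp add: std_gauss_density_def)

lemma std_gauss_density_measurable [measurable]: "std_gauss_density \<in> borel_measurable borel"
  unfolding std_gauss_density_def by measurable

lemma sets_std_gauss [simp, measurable_cong]: "sets std_gauss = sets borel"
  by (simp add: std_gauss_def)

lemma space_std_gauss [simp]: "space std_gauss = UNIV"
  by (simp add: std_gauss_def)

lemma norm_sq_Basis: "(norm (x::'a::euclidean_space))\<^sup>2 = (\<Sum>b\<in>Basis. (x \<bullet> b)\<^sup>2)"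
  unfolding power2_norm_eq_inner by (subst euclidean_inner) (simp add: power2_eq_square)

lemma std_gauss_density_prod:
  "std_gauss_density (x::'a::euclidean_space) = (\<Prod>b\<in>Basis. std_normal_density (x \<bullet> b))"
  by (simp add: std_normal_density_def prod.distrib prod_dividef exp_sum[symmetric]
      std_gauss_density_def norm_sq_Basis sum_negf sum_divide_distrib)

text \<open>It suffices to test boxes: the indicator of a box is a product over the coordinates, so
  the integral of the product density factorizes.\<close>

lemma PiM_density_lborel:
  fixes g :: "real \<Rightarrow> ennreal"
  assumes [measurable]: "g \<in> borel_measurable borel" and "finite I"
    and "prob_space (density lborel g)"
  shows "PiM I (\<lambda>_. density lborel g) = density (PiM I (\<lambda>_. lborel)) (\<lambda>x. \<Prod>i\<in>I. g (x i))"
proof -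
  interpret g: prob_space "density lborel g" by fact
  interpret P: product_sigma_finite "\<lambda>_::'a. density lborel g" by standard
  interpret L: product_sigma_finite "\<lambda>_::'a. lborel :: real measure" by standard
  have [measurable]: "(\<lambda>x. \<Prod>i\<in>I. g (x i)) \<in> borel_measurable (PiM I (\<lambda>_. lborel))"
    by (intro borel_measurable_prod_ennreal) measurable
  show ?thesis
  proof (rule P.PiM_eqI[symmetric, OF \<open>finite I\<close>])
    show "sets (density (PiM I (\<lambda>_. lborel)) (\<lambda>x. \<Prod>i\<in>I. g (x i))) =
        sets (PiM I (\<lambda>_. density lborel g))"
      by (simp cong: sets_PiM_cong)
    fix A :: "'a \<Rightarrow> real set" assume A: "\<And>i. i \<in> I \<Longrightarrow> A i \<in> sets (density lborel g)"
    then have A': "\<And>i. i \<in> I \<Longrightarrow> A i \<in> sets borel" by simp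
    have [measurable]: "Pi\<^sub>E I A \<in> sets (PiM I (\<lambda>_. lborel))"
      using A by (intro sets_PiM_I_finite) (auto simp: \<open>finite I\<close>)
    have "emeasure (density (PiM I (\<lambda>_. lborel)) (\<lambda>x. \<Prod>i\<in>I. g (x i))) (Pi\<^sub>E I A)
       = (\<integral>\<^sup>+x. (\<Prod>i\<in>I. g (x i)) * indicator (Pi\<^sub>E I A) x \<partial>PiM I (\<lambda>_. lborel))"
      by (subst emeasure_density) auto
    also have "\<dots> = (\<integral>\<^sup>+x. (\<Prod>i\<in>I. g (x i) * indicator (A i) (x i)) \<partial>PiM I (\<lambda>_. lborel))"
    proof (rule nn_integral_cong)
      fix x assume x: "x \<in> space (PiM I (\<lambda>_. lborel :: real measure))"
      then have "indicator (Pi\<^sub>E I A) x = (\<Prod>i\<in>I. indicator (A i) (x i) :: ennreal)"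
        using \<open>finite I\<close> by (auto simp: indicator_def space_PiM PiE_def Pi_def)
      then show "(\<Prod>i\<in>I. g (x i)) * indicator (Pi\<^sub>E I A) x = (\<Prod>i\<in>I. g (x i) * indicator (A i) (x i))"
        by (simp add: prod.distrib)
    qed
    also have "\<dots> = (\<Prod>i\<in>I. \<integral>\<^sup>+x. g x * indicator (A i) x \<partial>lborel)"
      using A' \<open>finite I\<close> by (intro L.product_nn_integral_prod) auto
    also have "\<dots> = (\<Prod>i\<in>I. emeasure (density lborel g) (A i))"
      using A' by (intro prod.cong) (auto simp: emeasure_density)
    finally show "emeasure (density (PiM I (\<lambda>_. lborel)) (\<lambda>x. \<Prod>i\<in>I. g (x i))) (Pi\<^sub>E I A)
       = (\<Prod>i\<in>I. emeasure (density lborel g) (A i))" .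
  qed
qed

text \<open>The density in terms of the norm makes rotation invariance visible, the product form
  gives marginals and independence of coordinates; this identity connects the two.\<close>

lemma std_gauss_eq_distr_PiM:
  "(std_gauss :: 'a::euclidean_space measure) =
     distr (PiM Basis (\<lambda>_. density lborel std_normal_density)) borel (\<lambda>f. \<Sum>b\<in>Basis. f b *\<^sub>R b)"
proof -
  have "(std_gauss :: 'a measure) =
      density (distr (PiM Basis (\<lambda>_. lborel)) borel (\<lambda>f. \<Sum>b\<in>Basis. f b *\<^sub>R b)) std_gauss_density"
    unfolding std_gauss_def by (subst lborel_eq) simp
  also have "\<dots> = distr (density (PiM Basis (\<lambda>_. lborel))
      (\<lambda>f. std_gauss_density (\<Sum>b\<in>Basis. f b *\<^sub>R b :: 'a))) borel (\<lambda>f. \<Sum>b\<in>Basis. f b *\<^sub>R b)"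
    by (rule density_distr) measurable
  also have "(\<lambda>f. ennreal (std_gauss_density (\<Sum>b\<in>Basis. f b *\<^sub>R b :: 'a))) =
      (\<lambda>f. \<Prod>b\<in>Basis. ennreal (std_normal_density (f b)))"
    by (simp add: std_gauss_density_prod inner_sum_left inner_Basis prod_ennreal if_distrib
        cong: if_cong)
  finally show ?thesis
    by (subst PiM_density_lborel) (auto intro: prob_space_normal_density)
qed

lemma prob_space_std_gauss: "prob_space std_gauss"
  unfolding std_gauss_eq_distr_PiM
  by (intro prob_space.prob_space_distr prob_space_PiM prob_space_normal_density) auto

text \<open>Coordinates outside the image of \<open>f\<close> are integrated out, and the selected
  ones remain independent standard normals.\<close>

lemma distr_std_gauss_reindex:
  fixes f :: "'b::euclidean_space \<Rightarrow> 'a::euclidean_space"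
  assumes "inj_on f Basis" "f ` Basis \<subseteq> Basis"
  shows "distr std_gauss borel (\<lambda>x. \<Sum>b\<in>Basis. (x \<bullet> f b) *\<^sub>R b) = std_gauss"
proof -
  let ?N = "density lborel std_normal_density"
  have f: "f b \<in> Basis" if "b \<in> Basis" for b using assms that by auto
  have "distr (std_gauss :: 'a measure) borel (\<lambda>x. \<Sum>b\<in>Basis. (x \<bullet> f b) *\<^sub>R b :: 'b)
     = distr (PiM Basis (\<lambda>_. ?N)) borel
       ((\<lambda>x. \<Sum>b\<in>Basis. (x \<bullet> f b) *\<^sub>R b) \<circ> (\<lambda>g. \<Sum>b\<in>Basis. g b *\<^sub>R b))"
    unfolding std_gauss_eq_distr_PiM by (subst distr_distr) auto
  also have "\<dots> = distr (PiM Basis (\<lambda>_. ?N)) borel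
      ((\<lambda>g. \<Sum>b\<in>Basis. g b *\<^sub>R b) \<circ> (\<lambda>g. \<lambda>n\<in>Basis. g (f n)))"
    by (intro distr_cong)
      (auto simp: inner_sum_left inner_Basis f if_distrib cong: if_cong intro!: sum.cong)
  also have "\<dots> = distr (distr (PiM Basis (\<lambda>_. ?N)) (PiM Basis (\<lambda>_. ?N)) (\<lambda>g. \<lambda>n\<in>Basis. g (f n)))
      borel (\<lambda>g. \<Sum>b\<in>Basis. g b *\<^sub>R b)"
    by (subst distr_distr) (auto intro!: measurable_restrict measurable_component_singleton simp: f)
  also have "distr (PiM Basis (\<lambda>_. ?N)) (PiM Basis (\<lambda>_. ?N)) (\<lambda>g. \<lambda>n\<in>Basis. g (f n)) = PiM Basis (\<lambda>_. ?N)"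
    using assms by (intro distr_PiM_reindex prob_space_normal_density) auto
  finally show ?thesis by (simp add: std_gauss_eq_distr_PiM[symmetric])
qed

lemma (in prob_space) distr_std_gaussI:
  fixes \<xi> :: "'a \<Rightarrow> 'b::euclidean_space"
  assumes ind: "indep_vars (\<lambda>_. borel) (\<lambda>b \<omega>. \<xi> \<omega> \<bullet> b) Basis"
    and d: "\<And>b. b \<in> Basis \<Longrightarrow> distributed M lborel (\<lambda>\<omega>. \<xi> \<omega> \<bullet> b) std_normal_density"
  shows "distr M borel \<xi> = std_gauss"
proof -
  let ?N = "density lborel std_normal_density"
  have m[measurable]: "b \<in> Basis \<Longrightarrow> (\<lambda>\<omega>. \<xi> \<omega> \<bullet> b) \<in> borel_measurable M" for b
    using d[of b] by (simp add: distributed_def)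
  have n: "distr M borel (\<lambda>\<omega>. \<xi> \<omega> \<bullet> b) = ?N" if "b \<in> Basis" for b
    using distributed_distr_eq_density[OF d[OF that]]
    by (subst distr_cong[OF refl sets_lborel[symmetric] refl]) simp
  have "distr M (PiM Basis (\<lambda>_. borel)) (\<lambda>\<omega>. \<lambda>b\<in>Basis. \<xi> \<omega> \<bullet> b) =
      (PiM Basis (\<lambda>b. distr M borel (\<lambda>\<omega>. \<xi> \<omega> \<bullet> b)))"
    using ind by (subst (asm) indep_vars_iff_distr_eq_PiM') auto
  also have "\<dots> = PiM Basis (\<lambda>_. ?N)"
    by (rule PiM_cong) (auto simp: n)
  finally have *: "distr M (PiM Basis (\<lambda>_. borel)) (\<lambda>\<omega>. \<lambda>b\<in>Basis. \<xi> \<omega> \<bullet> b) = PiM Basis (\<lambda>_. ?N)" .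
  have "std_gauss = distr (distr M (PiM Basis (\<lambda>_. borel)) (\<lambda>\<omega>. \<lambda>b\<in>Basis. \<xi> \<omega> \<bullet> b)) borel
      (\<lambda>f. \<Sum>b\<in>Basis. f b *\<^sub>R b :: 'b)"
    unfolding * by (rule std_gauss_eq_distr_PiM)
  also have "\<dots> = distr M borel ((\<lambda>f. \<Sum>b\<in>Basis. f b *\<^sub>R b) \<circ> (\<lambda>\<omega>. \<lambda>b\<in>Basis. \<xi> \<omega> \<bullet> b))"
    by (subst distr_distr) (auto intro!: measurable_restrict)
  also have "\<dots> = distr M borel \<xi>"
    by (intro distr_cong) (auto simp: euclidean_representation)
  finally show ?thesis ..
qed

lemma std_gauss_pair:
  "(std_gauss :: ('a::euclidean_space \<times> 'b::euclidean_space) measure) = std_gauss \<Otimes>\<^sub>M std_gauss"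
proof -
  interpret b: prob_space "std_gauss :: 'b measure" by (rule prob_space_std_gauss)
  have "sigma_finite_measure (density lborel (\<lambda>x. ennreal (std_gauss_density (x::'b))))"
    using b.sigma_finite_measure_axioms by (simp add: std_gauss_def)
  then have "(std_gauss \<Otimes>\<^sub>M std_gauss :: ('a \<times> 'b) measure)
      = density (lborel \<Otimes>\<^sub>M lborel) (\<lambda>(x, y). std_gauss_density x * std_gauss_density y)"
    unfolding std_gauss_def
    by (subst pair_measure_density)
      (auto simp: lborel.sigma_finite_measure_axioms split_beta' ennreal_mult' std_gauss_density_pos[THEN less_imp_le])
  also have "(\<lambda>(x::'a, y::'b). std_gauss_density x * std_gauss_density y) = std_gauss_density"
    by (auto simp: fun_eq_iff std_gauss_density_def norm_Pair power_add exp_add[symmetric] add_divide_distrib)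
  finally show ?thesis by (simp add: std_gauss_def lborel_prod)
qed

text \<open>Uniqueness of Haar measure, by exchanging the order of integration.\<close>

lemma translation_invariant_measure_proportional:
  fixes \<mu> :: "'a::euclidean_space measure"
  assumes "sigma_finite_measure \<mu>" and [measurable_cong]: "sets \<mu> = sets borel"
    and inv: "\<And>a. distr \<mu> borel (\<lambda>x. x + a) = \<mu>"
    and [measurable]: "f \<in> borel_measurable borel" "g \<in> borel_measurable borel"
  shows "(\<integral>\<^sup>+x. f x \<partial>\<mu>) * (\<integral>\<^sup>+x. g x \<partial>lborel) = (\<integral>\<^sup>+x. g x \<partial>\<mu>) * (\<integral>\<^sup>+x. f x \<partial>lborel)"
proof -
  interpret \<mu>: sigma_finite_measure \<mu> by fact
  interpret pair_sigma_finite \<mu> "lborel :: 'a measure" ..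
  have inv\<mu>: "(\<integral>\<^sup>+x. h (x + a) \<partial>\<mu>) = (\<integral>\<^sup>+x. h x \<partial>\<mu>)"
    if [measurable]: "h \<in> borel_measurable borel" for h a
    by (subst (2) inv[of a, symmetric], subst nn_integral_distr) auto
  have invl: "(\<integral>\<^sup>+y. h (a + y) \<partial>lborel) = (\<integral>\<^sup>+y. h y \<partial>lborel)"
    if [measurable]: "h \<in> borel_measurable borel" for h and a :: 'a
    by (subst (2) lborel_distr_plus[symmetric, of a], subst nn_integral_distr) auto
  have reflect: "(\<integral>\<^sup>+y. h (a - y) \<partial>lborel) = (\<integral>\<^sup>+y. h y \<partial>lborel)"
    if [measurable]: "h \<in> borel_measurable borel" for h and a :: 'a
  proof -
    have *: "lborel = distr lborel borel ((-) a)"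
      using lborel_affine[of "-1" a] by (simp add: density_1)
    show ?thesis
      by (subst (2) *) (simp add: nn_integral_distr)
  qed
  \<comment> \<open>Integrating over \<open>y\<close> first gives the left-hand product, by
    translation invariance of Lebesgue measure. Moving the shift from \<open>g\<close> to
    \<open>f\<close> under \<open>\<mu>\<close> and again integrating over \<open>y\<close> first
    gives the right-hand product, by invariance under reflection.\<close>
  have "(\<integral>\<^sup>+x. f x \<partial>\<mu>) * (\<integral>\<^sup>+x. g x \<partial>lborel) = (\<integral>\<^sup>+x. (\<integral>\<^sup>+y. f x * g (x + y) \<partial>lborel) \<partial>\<mu>)"
    by (simp add: nn_integral_cmult invl nn_integral_multc)
  also have "\<dots> = (\<integral>\<^sup>+y. (\<integral>\<^sup>+x. f x * g (x + y) \<partial>\<mu>) \<partial>lborel)"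
    by (rule Fubini'[symmetric]) measurable
  also have "\<dots> = (\<integral>\<^sup>+y. (\<integral>\<^sup>+x. f (x - y) * g x \<partial>\<mu>) \<partial>lborel)"
  proof (rule nn_integral_cong)
    fix y show "(\<integral>\<^sup>+x. f x * g (x + y) \<partial>\<mu>) = (\<integral>\<^sup>+x. f (x - y) * g x \<partial>\<mu>)"
      using inv\<mu>[of "\<lambda>x. f (x - y) * g x" y] by simp
  qed
  also have "\<dots> = (\<integral>\<^sup>+x. (\<integral>\<^sup>+y. f (x - y) * g x \<partial>lborel) \<partial>\<mu>)"
    by (rule Fubini') measurable
  also have "\<dots> = (\<integral>\<^sup>+x. g x \<partial>\<mu>) * (\<integral>\<^sup>+x. f x \<partial>lborel)"
    by (simp add: nn_integral_multc reflect[of f] nn_integral_cmult mult.commute)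
  finally show ?thesis .
qed

text \<open>The image of Lebesgue measure under \<open>T\<close> is translation invariant because
  \<open>T x + a = T (x + inv T a)\<close>, and sigma-finite because \<open>inv T\<close> carries it
  back to Lebesgue measure. The cross-multiplied form leaves the Jacobian unnamed.\<close>

lemma lborel_linear_proportional:
  fixes T :: "'a::euclidean_space \<Rightarrow> 'a"
  assumes "linear T" "bij T"
    and [measurable]: "f \<in> borel_measurable borel" "g \<in> borel_measurable borel"
  shows "(\<integral>\<^sup>+x. f (T x) \<partial>lborel) * (\<integral>\<^sup>+x. g x \<partial>lborel) =
    (\<integral>\<^sup>+x. g (T x) \<partial>lborel) * (\<integral>\<^sup>+x. f x \<partial>lborel)"
proof -
  have [measurable]: "T \<in> borel_measurable borel"
    using assms by (intro borel_measurable_continuous_onI linear_continuous_on linear_conv_bounded_linear[THEN iffD1])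
  have [measurable]: "inv T \<in> borel_measurable borel"
    using inj_linear_imp_inv_linear[of T] assms
    by (intro borel_measurable_continuous_onI linear_continuous_on linear_conv_bounded_linear[THEN iffD1])
      (auto simp: bij_is_inj)
  let ?\<mu> = "distr lborel borel T"
  have inv: "distr ?\<mu> borel (\<lambda>x. x + a) = ?\<mu>" for a
  proof -
    have "distr ?\<mu> borel (\<lambda>x. x + a) = distr lborel borel ((\<lambda>x. x + a) \<circ> T)"
      by (subst distr_distr) auto
    also have "(\<lambda>x. x + a) \<circ> T = T \<circ> (\<lambda>x. inv T a + x)"
      using assms by (auto simp: fun_eq_iff linear_add bij_is_surj surj_f_inv_f)
    also have "distr lborel borel \<dots> = distr (distr lborel borel ((+) (inv T a))) borel T"
      by (subst distr_distr) (auto simp: o_def)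
    finally show ?thesis by (simp add: lborel_distr_plus)
  qed
  have "inv T \<circ> T = (\<lambda>x. x)"
    using assms by (auto simp: bij_is_inj)
  then have "distr ?\<mu> borel (inv T) = lborel"
    by (subst distr_distr) (auto simp: distr_id2)
  then have "sigma_finite_measure (distr ?\<mu> borel (inv T))"
    by (simp add: lborel.sigma_finite_measure_axioms)
  then have "sigma_finite_measure ?\<mu>"
    by (rule sigma_finite_measure_distr) auto
  from translation_invariant_measure_proportional[OF this _ inv, of f g] show ?thesis
    by (simp add: nn_integral_distr)
qed

text \<open>The proportionality factor is 1: an orthogonal map preserves the unit ball, whose volume
  is finite and nonzero.\<close>

lemma distr_lborel_orthogonal:
  fixes T :: "'a::euclidean_space \<Rightarrow> 'a"
  assumes T: "orthogonal_transformation T"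
  shows "distr lborel borel T = lborel"
proof (rule measure_eqI)
  note lin = orthogonal_transformation_linear[OF T]
  have [measurable]: "T \<in> borel_measurable borel"
    using lin by (intro borel_measurable_continuous_onI linear_continuous_on linear_conv_bounded_linear[THEN iffD1])
  fix A :: "'a set" assume "A \<in> sets (distr lborel borel T)"
  then have [measurable]: "A \<in> sets borel" by simp
  have "(\<integral>\<^sup>+x. indicator A (T x) \<partial>lborel) * (\<integral>\<^sup>+x. indicator (ball 0 1) x \<partial>(lborel :: 'a measure)) =
    (\<integral>\<^sup>+x. indicator (ball 0 1) (T x) \<partial>lborel) * (\<integral>\<^sup>+x. indicator A x \<partial>lborel)"
    by (rule lborel_linear_proportional[OF lin orthogonal_transformation_bij[OF T]])
      (auto intro!: borel_measurable_indicator)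
  also have "(\<lambda>x. indicator (ball 0 1) (T x) :: ennreal) = indicator (ball 0 1)"
    by (auto simp: indicator_def orthogonal_transformation_norm[OF T])
  finally have "emeasure (distr lborel borel T) A * emeasure lborel (ball 0 1 :: 'a set)
      = emeasure lborel A * emeasure lborel (ball 0 1 :: 'a set)"
    by (simp add: nn_integral_distr[of T lborel borel "indicator A", symmetric] mult.commute)
  moreover have "emeasure lborel (ball 0 1 :: 'a set) \<noteq> \<infinity>" "emeasure lborel (ball 0 1 :: 'a set) \<noteq> 0"
    using emeasure_lborel_ball_finite[of "0::'a" 1] content_ball_pos[of 1 "0::'a"]
    by (auto simp: emeasure_eq_ennreal_measure)
  ultimately show "emeasure (distr lborel borel T) A = emeasure lborel A"
    by (metis ennreal_mult_cancel_left infinity_ennreal_def mult.commute)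
qed simp

lemma distr_std_gauss_orthogonal:
  fixes T :: "'a::euclidean_space \<Rightarrow> 'a"
  assumes T: "orthogonal_transformation T"
  shows "distr std_gauss borel T = std_gauss"
proof -
  have [measurable]: "T \<in> borel_measurable borel"
    using orthogonal_transformation_linear[OF T]
    by (intro borel_measurable_continuous_onI linear_continuous_on linear_conv_bounded_linear[THEN iffD1])
  have "std_gauss = density (distr lborel borel T) std_gauss_density"
    by (simp add: distr_lborel_orthogonal[OF T] std_gauss_def)
  also have "\<dots> = distr (density lborel (\<lambda>x. std_gauss_density (T x))) borel T"
    by (subst density_distr) auto
  also have "(\<lambda>x. std_gauss_density (T x)) = std_gauss_density"
    by (auto simp: std_gauss_density_def orthogonal_transformation_norm[OF T])
  finally show ?thesis by (simp add: std_gauss_def)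
qed

subsection \<open>Inverse square roots and orthonormal columns\<close>

lemma inner_matrix_vector_mult: "(x::real^'m) \<bullet> (A *v y) = (transpose A *v x) \<bullet> (y::real^'n)"
  using dot_lmul_matrix[of x A y] by (simp add: transpose_matrix_vector)

lemma pos_def_sym: "pos_def A \<Longrightarrow> x \<bullet> (A *v y) = (A *v x) \<bullet> y"
  by (metis inner_matrix_vector_mult pos_def_def)

lemma symmetric_matrixI:
  fixes A :: "real^'n^'n"
  assumes "\<And>x y. x \<bullet> (A *v y) = (A *v x) \<bullet> y"
  shows "transpose A = A"
proof -
  have "transpose A *v x = A *v x" for x
    by (rule vector_eq_rdot[THEN iffD1]) (metis assms inner_matrix_vector_mult)
  then show ?thesis by (metis matrix_eq)
qed

text \<open>Compactness of the unit sphere gives a positive minimum of the quadratic form, and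
  homogeneity extends it to all vectors.\<close>

lemma pos_def_coercive:
  assumes "pos_def (G :: real^'n^'n)"
  obtains m where "m > 0" "\<And>x. m * (norm x)\<^sup>2 \<le> x \<bullet> (G *v x)"
proof -
  have "\<exists>x\<in>sphere (0::real^'n) 1. \<forall>y\<in>sphere 0 1. x \<bullet> (G *v x) \<le> y \<bullet> (G *v y)"
    by (rule continuous_attains_inf) (auto intro!: continuous_on_inner[OF continuous_on_id linear_continuous_on[OF matrix_vector_mul_bounded_linear]])
  then obtain x0 where x0: "norm x0 = 1" "\<And>y. norm y = 1 \<Longrightarrow> x0 \<bullet> (G *v x0) \<le> y \<bullet> (G *v y)"
    by auto
  have "x0 \<bullet> (G *v x0) * (norm x)\<^sup>2 \<le> x \<bullet> (G *v x)" for x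
  proof (cases "x = 0")
    case False
    have "x0 \<bullet> (G *v x0) \<le> (inverse (norm x) *\<^sub>R x) \<bullet> (G *v (inverse (norm x) *\<^sub>R x))"
      using False by (intro x0) simp
    then show ?thesis
      using False by (simp add: matrix_vector_mult_scaleR field_simps power2_eq_square)
  qed simp
  moreover have "x0 \<bullet> (G *v x0) > 0"
    using assms x0(1) unfolding pos_def_def by (metis norm_zero zero_neq_one)
  ultimately show thesis using that by blast
qed

text \<open>After scaling, \<open>G = I - E\<close> with \<open>E\<close> symmetric and of operator norm less than 1, and
  \<open>I - Y\<close> is a square root of \<open>G\<close> precisely when \<open>Y\<close> is a fixed point of the
  contraction \<open>Y \<mapsto> (E + Y\<^sup>2) / 2\<close>.\<close>

lemma pos_def_sqrt_exists:
  assumes G: "pos_def (G :: real^'n^'n)"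
  shows "\<exists>B. pos_def B \<and> B ** B = G"
proof -
  obtain m where m: "m > 0" "\<And>x. m * (norm x)\<^sup>2 \<le> x \<bullet> (G *v x)"
    using pos_def_coercive[OF G] by blast
  obtain L where L: "L > 0" "\<And>x. norm (G *v x) \<le> L * norm x"
    using linear_bounded_pos[OF matrix_vector_mul_linear[of G]] by blast
  \<comment> \<open>This value minimizes \<open>1 - 2 * c * m + c\<^sup>2 * L\<^sup>2\<close>, the
    bound on the squared operator norm of \<open>I - c G\<close>; the minimum
    \<open>1 - m\<^sup>2 / L\<^sup>2\<close> lies below 1.\<close>
  define c where "c = m / L\<^sup>2"
  have c: "c > 0" using m(1) L(1) by (simp add: c_def)
  have bl: "bounded_linear (\<lambda>x. x - c *\<^sub>R (G *v x))"
    by (intro bounded_linear_sub bounded_linear_scaleR_right[THEN bounded_linear_compose] bounded_linear_ident matrix_vector_mul_bounded_linear)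
  define E where "E = Blinfun (\<lambda>x. x - c *\<^sub>R (G *v x))"
  have E: "blinfun_apply E x = x - c *\<^sub>R (G *v x)" for x
    by (simp add: E_def bounded_linear_Blinfun_apply[OF bl])
  define q where "q = norm E"
  have E2: "(norm (E x))\<^sup>2 \<le> (1 - m\<^sup>2 / L\<^sup>2) * (norm x)\<^sup>2" for x
  proof -
    have "(norm (E x))\<^sup>2 = (norm x)\<^sup>2 - 2 * c * (x \<bullet> (G *v x)) + c\<^sup>2 * (norm (G *v x))\<^sup>2"
      unfolding E power2_norm_eq_inner
      by (simp add: inner_diff inner_commute power2_eq_square algebra_simps)
    also have "\<dots> \<le> (norm x)\<^sup>2 - 2 * c * (m * (norm x)\<^sup>2) + c\<^sup>2 * (L * norm x)\<^sup>2"
      using c m(2)[of x] L(2)[of x] by (intro add_mono diff_mono mult_left_mono power_mono) auto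
    also have "\<dots> = (1 - m\<^sup>2 / L\<^sup>2) * (norm x)\<^sup>2"
      using L(1) by (simp add: c_def field_simps power2_eq_square)
    finally show ?thesis .
  qed
  define r where "r = 1 - m\<^sup>2 / L\<^sup>2"
  have r: "r < 1" using m(1) L(1) by (simp add: r_def)
  have r0: "0 \<le> r"
  proof -
    have "0 \<le> (norm (E (axis undefined 1)))\<^sup>2" by simp
    also have "\<dots> \<le> r" using E2[of "axis undefined 1"] by (simp add: r_def)
    finally show ?thesis .
  qed
  have "q \<le> sqrt r"
    unfolding q_def
  proof (rule norm_blinfun_bound)
    fix x show "norm (E x) \<le> sqrt r * norm x"
      using E2[of x] r0 by - (rule power2_le_imp_le, simp_all add: power_mult_distrib r_def[symmetric])
  qed (use r0 in simp)
  moreover have "sqrt r < 1" using r by simp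
  ultimately have q: "q < 1" "0 \<le> q" unfolding q_def by (linarith, simp)
  \<comment> \<open>A closed, hence complete, set of symmetric operators in the Banach space of
    bounded linear maps. The iteration stays in it because
    \<open>(q + q\<^sup>2) / 2 \<le> q\<close>.\<close>
  define S where "S = {Y :: (real^'n) \<Rightarrow>\<^sub>L (real^'n). norm Y \<le> q \<and> (\<forall>x y. x \<bullet> blinfun_apply Y y = blinfun_apply Y x \<bullet> y)}"
  define f where "f Y = (1/2) *\<^sub>R (E + (Y o\<^sub>L Y))" for Y
  have ES: "E \<in> S"
    by (auto simp: S_def q_def E inner_diff pos_def_sym[OF G])
  have "\<exists>!Y\<in>S. f Y = Y"
  proof (rule Banach_fix[where c = q])
    have "closed S"
      unfolding S_def by (intro closed_Collect_conj closed_Collect_all closed_Collect_le closed_Collect_eq continuous_intros)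
    then show "Topological_Spaces.complete S" by (simp add: complete_eq_closed)
    show "f ` S \<subseteq> S"
    proof
      fix Z assume "Z \<in> f ` S"
      then obtain Y where Y: "Y \<in> S" "Z = f Y" by auto
      have nY: "norm Y \<le> q" and sY: "x \<bullet> Y y = Y x \<bullet> y" for x y using Y by (auto simp: S_def)
      have "norm (Y o\<^sub>L Y) \<le> q * q"
        by (rule order_trans[OF norm_blinfun_compose]) (use nY q in \<open>auto intro: mult_mono\<close>)
      also have "\<dots> \<le> q" using q by (simp add: mult_left_le)
      finally have "norm (E + (Y o\<^sub>L Y)) \<le> q + q"
        by (intro norm_triangle_le) (simp add: q_def)
      then have "norm Z \<le> q" by (simp add: Y f_def)
      moreover have "x \<bullet> Z y = Z x \<bullet> y" for x y
        using ES by (simp add: Y f_def blinfun.add_left blinfun.scaleR_left inner_add sY S_def)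
      ultimately show "Z \<in> S" by (auto simp: S_def)
    qed
    fix Y W assume "Y \<in> S" "W \<in> S"
    then have nY: "norm Y \<le> q" and nW: "norm W \<le> q" by (auto simp: S_def)
    \<comment> \<open>Noncommutative difference of squares:
      \<open>Y\<^sup>2 - W\<^sup>2 = Y (Y - W) + (Y - W) W\<close>. It makes \<open>q\<close> the
      contraction constant.\<close>
    have "f Y - f W = (1/2) *\<^sub>R ((Y o\<^sub>L (Y - W)) + ((Y - W) o\<^sub>L W))"
      by (rule blinfun_eqI) (simp add: f_def blinfun.add_left blinfun.diff_left blinfun.diff_right
          blinfun.scaleR_left scaleR_diff_right scaleR_add_right)
    then have "norm (f Y - f W) = norm ((Y o\<^sub>L (Y - W)) + ((Y - W) o\<^sub>L W)) / 2" by simp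
    also have "\<dots> \<le> (norm Y * norm (Y - W) + norm (Y - W) * norm W) / 2"
      by (intro divide_right_mono norm_triangle_mono norm_blinfun_compose) auto
    also have "\<dots> \<le> (q * norm (Y - W) + norm (Y - W) * q) / 2"
      using nY nW q by (intro divide_right_mono add_mono mult_mono) auto
    finally show "dist (f Y) (f W) \<le> q * dist Y W" by (simp add: dist_norm)
  qed (use q ES in auto)
  then obtain Y where Y: "Y \<in> S" "f Y = Y" by blast
  have sY: "x \<bullet> Y y = Y x \<bullet> y" for x y using Y by (auto simp: S_def)
  have YY: "Y (Y x) = 2 *\<^sub>R Y x - E x" for x
  proof -
    have "2 *\<^sub>R Y x = 2 *\<^sub>R f Y x" by (simp add: Y)
    also have "\<dots> = E x + Y (Y x)"
      by (simp add: f_def blinfun.scaleR_left blinfun.add_left)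
    finally show ?thesis by simp
  qed
  define b where "b x = inverse (sqrt c) *\<^sub>R (x - Y x)" for x
  have lb: "linear b"
    unfolding b_def by (intro bounded_linear.linear bounded_linear_scaleR_right[THEN bounded_linear_compose] bounded_linear_sub bounded_linear_ident blinfun.bounded_linear_right)
  have B: "matrix b *v x = b x" for x
    by (simp add: matrix_works lb)
  have "matrix b ** matrix b = G"
    unfolding matrix_eq
  proof
    fix x
    have "b (b x) = inverse c *\<^sub>R (x - E x)"
      using c by (simp add: b_def blinfun.scaleR_right blinfun.diff_right YY scaleR_2 real_sqrt_mult[symmetric] inverse_mult_distrib[symmetric] scaleR_diff_right[symmetric] del: inverse_mult_distrib)
    then show "matrix b ** matrix b *v x = G *v x"
      using c by (simp add: matrix_vector_mul_assoc[symmetric] B E)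
  qed
  moreover have "pos_def (matrix b)"
    unfolding pos_def_def
  proof (intro conjI allI impI)
    show "transpose (matrix b) = matrix b"
      by (rule symmetric_matrixI) (simp add: B b_def inner_diff sY)
    fix x :: "real^'n" assume "x \<noteq> 0"
    have "x \<bullet> Y x \<le> norm x * norm (Y x)" by (rule norm_cauchy_schwarz)
    also have "\<dots> \<le> norm x * (norm Y * norm x)" by (intro mult_left_mono norm_blinfun) auto
    also have "\<dots> \<le> norm x * (q * norm x)"
      using Y by (intro mult_left_mono mult_right_mono) (auto simp: S_def)
    also have "\<dots> < x \<bullet> x"
      using q \<open>x \<noteq> 0\<close> by (simp add: dot_square_norm power2_eq_square)
    finally show "0 < x \<bullet> (matrix b *v x)"
      using c by (simp add: B b_def inner_diff)
  qed
  ultimately show ?thesis by blast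
qed

text \<open>If \<open>B\<^sup>2 = C\<^sup>2\<close> and \<open>D = B - C\<close>, then \<open>B D + D C = 0\<close>; pairing with \<open>D\<close> gives
  \<open>\<langle>D x, B D x\<rangle> + \<langle>D x, D C x\<rangle> = 0\<close>, whose trace is a sum of nonnegative terms.\<close>

lemma pos_def_sqrt_unique:
  fixes B C :: "real^'n^'n"
  assumes B: "pos_def B" and C: "pos_def C" and eq: "B ** B = C ** C"
  shows "B = C"
proof -
  define D where "D = B - C"
  have D: "D *v x = B *v x - C *v x" for x by (simp add: D_def matrix_vector_mult_diff_rdistrib)
  have sD: "x \<bullet> (D *v y) = (D *v x) \<bullet> y" for x y
    by (simp add: D inner_diff pos_def_sym[OF B] pos_def_sym[OF C])
  have e: "B *v (D *v x) = - (D *v (C *v x))" for x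
    using arg_cong[OF eq, of "\<lambda>A. A *v x"]
    by (simp add: D matrix_vector_mult_diff_distrib matrix_vector_mul_assoc[symmetric])
  let ?n = "\<lambda>i. axis i 1 :: real^'n"
  have nonneg: "x \<bullet> (B *v x) \<ge> 0" "x \<bullet> (C *v x) \<ge> 0" for x
    using B C by (cases "x = 0"; force simp: pos_def_def less_imp_le)+
  \<comment> \<open>Symmetry of \<open>D\<close> and cyclicity of the trace turn
    \<open>tr (D D C)\<close> into \<open>tr (D C D)\<close>, a sum of terms that are nonnegative
    one by one.\<close>
  have tr: "(\<Sum>i\<in>UNIV. (D *v ?n i) \<bullet> (D *v (C *v ?n i))) = (\<Sum>i\<in>UNIV. (D *v ?n i) \<bullet> (C *v (D *v ?n i)))"
  proof -
    have diag: "M $ i $ i = ?n i \<bullet> (M *v ?n i)" for M :: "real^'n^'n" and i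
      by (simp add: matrix_vector_mult_basis inner_axis' column_def)
    have "(\<Sum>i\<in>UNIV. (D *v ?n i) \<bullet> (D *v (C *v ?n i))) = trace (D ** (D ** C))"
      unfolding trace_def diag by (simp add: sD matrix_vector_mul_assoc[symmetric])
    also have "\<dots> = trace (D ** (C ** D))"
      by (metis matrix_mul_assoc trace_mul_sym)
    also have "\<dots> = (\<Sum>i\<in>UNIV. (D *v ?n i) \<bullet> (C *v (D *v ?n i)))"
      unfolding trace_def diag by (simp add: sD matrix_vector_mul_assoc[symmetric])
    finally show ?thesis .
  qed
  have "(\<Sum>i\<in>UNIV. (D *v ?n i) \<bullet> (B *v (D *v ?n i)) + (D *v ?n i) \<bullet> (C *v (D *v ?n i))) = 0"
    by (simp add: e sum.distrib sum_subtractf tr sum_negf)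
  then have z: "(D *v ?n i) \<bullet> (B *v (D *v ?n i)) + (D *v ?n i) \<bullet> (C *v (D *v ?n i)) = 0" for i
    by (subst (asm) sum_nonneg_eq_0_iff) (auto intro!: add_nonneg_nonneg nonneg)
  have "D *v ?n i = 0" for i
  proof (rule ccontr)
    assume "D *v ?n i \<noteq> 0"
    then have "0 < (D *v ?n i) \<bullet> (B *v (D *v ?n i))" using B by (auto simp: pos_def_def)
    with z[of i] nonneg(2)[of "D *v ?n i"] show False by linarith
  qed
  then have "column i D = 0" for i by (simp add: matrix_vector_mult_basis)
  then have "D = 0" by (simp add: vec_eq_iff column_def)
  then show ?thesis by (simp add: D_def)
qed

lemma invertible_matrix_inv:
  assumes "invertible (A :: real^'n^'n)"
  shows matrix_inv_right: "A ** matrix_inv A = mat 1" and matrix_inv_left: "matrix_inv A ** A = mat 1"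
  using someI_ex[OF assms[unfolded invertible_def]] by (auto simp: matrix_inv_def)

lemma pos_def_invertible: "pos_def (A :: real^'n^'n) \<Longrightarrow> invertible A"
  unfolding invertible_left_inverse matrix_left_invertible_ker pos_def_def
  by (metis inner_zero_right order_less_irrefl)

lemma pos_def_matrix_inv:
  assumes A: "pos_def (A :: real^'n^'n)"
  shows "pos_def (matrix_inv A)"
proof -
  have inv: "A *v (matrix_inv A *v x) = x" for x
    by (simp add: matrix_vector_mul_assoc matrix_inv_right[OF pos_def_invertible[OF A]])
  have "x \<bullet> (matrix_inv A *v y) = (matrix_inv A *v x) \<bullet> y" for x y
    using pos_def_sym[OF A, of "matrix_inv A *v x" "matrix_inv A *v y"] by (simp add: inv)
  moreover have "0 < x \<bullet> (matrix_inv A *v x)" if "x \<noteq> 0" for x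
  proof -
    have "matrix_inv A *v x \<noteq> 0" using inv[of x] that by auto
    then have "0 < (matrix_inv A *v x) \<bullet> (A *v (matrix_inv A *v x))"
      using A by (auto simp: pos_def_def)
    then show ?thesis by (simp add: inv inner_commute)
  qed
  ultimately show ?thesis by (auto simp: pos_def_def intro!: symmetric_matrixI)
qed

text \<open>Existence and uniqueness of the positive definite square root of
  \<open>matrix_inv A\<close> make the definite description denote the intended matrix.\<close>

lemma inv_sqrt_matrix:
  assumes A: "pos_def (A :: real^'n^'n)"
  shows "pos_def (inv_sqrt_matrix A)" "inv_sqrt_matrix A ** inv_sqrt_matrix A = matrix_inv A"
proof -
  have "\<exists>!B. pos_def B \<and> B ** B = matrix_inv A"
    using pos_def_sqrt_exists[OF pos_def_matrix_inv[OF A]] pos_def_sqrt_unique by metis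
  from theI'[OF this] show "pos_def (inv_sqrt_matrix A)" "inv_sqrt_matrix A ** inv_sqrt_matrix A = matrix_inv A"
    by (auto simp: inv_sqrt_matrix_def)
qed

lemma pos_def_gram:
  fixes X :: "real^'p^'n"
  assumes "inj ((*v) X)"
  shows "pos_def (transpose X ** X)"
  unfolding pos_def_def
proof (intro conjI allI impI)
  show "transpose (transpose X ** X) = transpose X ** X" by (simp add: matrix_transpose_mul)
  fix x :: "real^'p" assume "x \<noteq> 0"
  then have "X *v x \<noteq> 0" using assms by (metis injD matrix_vector_mult_0_right)
  then show "0 < x \<bullet> (transpose X ** X *v x)"
    using inner_matrix_vector_mult[of x "transpose X" "X *v x"]
    by (simp add: matrix_vector_mul_assoc[symmetric])
qed

text \<open>\<open>B\<close> squared inverts the Gram matrix \<open>G\<close>, so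
  \<open>B (B G) = I\<close>. One-sided inverses of square matrices are two-sided, hence
  \<open>(B G) B = I\<close>, and this is the Gram matrix of \<open>X B\<close>.\<close>

lemma orthonormalize:
  fixes X :: "real^'p^'n"
  assumes inj: "inj ((*v) X)"
  defines "B \<equiv> inv_sqrt_matrix (transpose X ** X)"
  shows "transpose (X ** B) ** (X ** B) = mat 1" "transpose B = B" "invertible B"
proof -
  note pd = pos_def_gram[OF inj]
  note B = inv_sqrt_matrix[OF pd, folded B_def]
  show t: "transpose B = B" "invertible B" using B(1) pos_def_invertible by (auto simp: pos_def_def)
  have "B ** (B ** (transpose X ** X)) = mat 1"
    by (metis matrix_mul_assoc B(2) matrix_inv_left[OF pos_def_invertible[OF pd]])
  then have "(B ** (transpose X ** X)) ** B = mat 1"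
    by (simp add: matrix_left_right_inverse)
  then show "transpose (X ** B) ** (X ** B) = mat 1"
    by (simp add: matrix_transpose_mul t matrix_mul_assoc)
qed

text \<open>The columns of \<open>Q\<close> are completed by an orthonormal basis of their
  orthogonal complement. Since \<open>'p\<close> and \<open>'n\<close> are unrelated index types,
  \<open>e\<close> records where the columns land in \<open>W\<close>.\<close>

lemma orthonormal_columns_extend:
  fixes Q :: "real^'p^'n"
  assumes Q: "transpose Q ** Q = mat 1"
  obtains W :: "real^'n^'n" and e :: "'p \<Rightarrow> 'n"
  where "orthogonal_matrix W" "inj e" "\<And>a. column (e a) W = column a Q"
proof -
  have dot: "column a Q \<bullet> column b Q = (if a = b then 1 else 0)" for a b
    using arg_cong[OF Q, of "\<lambda>A. A $ a $ b"]
    by (simp add: matrix_matrix_mult_def transpose_def mat_def column_def inner_vec_def)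
  let ?C = "range (\<lambda>a. column a Q)"
  have injc: "inj (\<lambda>a. column a Q)"
    by (rule injI) (metis dot zero_neq_one)
  define V where "V = {y. \<forall>x\<in>span ?C. orthogonal x y}"
  have subV: "subspace V"
    by (auto simp: V_def subspace_def orthogonal_def inner_add)
  obtain Bs where Bs: "Bs \<subseteq> V" "pairwise orthogonal Bs" "\<And>x. x \<in> Bs \<Longrightarrow> norm x = 1"
    "independent Bs" "card Bs = dim V" "span Bs = V"
    using orthonormal_basis_subspace[OF subV] by metis
  have finB: "finite Bs" using Bs(4) independent_imp_finite by blast
  have CB: "x \<bullet> y = 0" if "x \<in> ?C" "y \<in> Bs" for x y
    using that Bs(1) span_base[of x ?C] by (auto simp: V_def orthogonal_def)
  have nC: "x \<bullet> x = 1" if "x \<in> ?C" for x using that dot by auto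
  have disj: "?C \<inter> Bs = {}" using CB nC by (metis disjoint_iff zero_neq_one)
  have porthC: "pairwise orthogonal ?C"
    using dot injc by (auto simp: pairwise_def orthogonal_def)
  have "independent ?C"
    by (rule pairwise_orthogonal_independent[OF porthC]) (metis nC inner_zero_left zero_neq_one)
  then have "dim (span ?C) = CARD('p)"
    by (simp add: dim_span dim_eq_card_independent card_image[OF injc])
  moreover have "dim (span ?C) + dim V = CARD('n)"
    using dim_subspace_orthogonal_to_vectors[of "span ?C" "UNIV :: (real^'n) set"]
    by (simp add: V_def subspace_span add.commute)
  ultimately have card: "card (?C \<union> Bs) = CARD('n)"
    by (subst card_Un_disjoint) (auto simp: disj finB Bs(5) card_image[OF injc])
  obtain h where h: "bij_betw h (UNIV :: 'n set) (?C \<union> Bs)"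
    using finite_same_card_bij[of "UNIV :: 'n set" "?C \<union> Bs"] card finB by auto
  define W :: "real^'n^'n" where "W = (\<chi> i j. h j $ i)"
  have colW: "column j W = h j" for j by (simp add: W_def column_def vec_eq_iff)
  define e where "e a = inv_into UNIV h (column a Q)" for a
  have he: "h (e a) = column a Q" for a
    unfolding e_def using h by (intro f_inv_into_f) (auto simp: bij_betw_def)
  have hin: "h j \<in> ?C \<union> Bs" for j using h by (auto simp: bij_betw_def)
  have "h i \<bullet> h i = 1" for i
    using hin[of i] nC Bs(3) by (auto simp: norm_eq_1)
  moreover have "h i \<bullet> h j = 0" if "i \<noteq> j" for i j
  proof -
    have "h i \<noteq> h j" using h that by (auto simp: bij_betw_def inj_on_def)
    then show ?thesis
      using hin[of i] hin[of j] CB[of "h i" "h j"] CB[of "h j" "h i"] porthC Bs(2)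
      by (auto simp: pairwise_def orthogonal_def inner_commute)
  qed
  ultimately have "orthogonal_matrix W"
    unfolding orthogonal_matrix_orthonormal_columns colW
    by (auto simp: norm_eq_1 orthogonal_def)
  moreover have "inj e" by (rule injI) (metis he injc injD)
  ultimately show thesis using that colW he by metis
qed

subsection \<open>The least-squares map and almost sure full rank\<close>

text \<open>The least-squares solution of \<open>A u = w\<close> when \<open>A\<close> has full
  column rank. On rank-deficient \<open>A\<close> it inherits the fixed value of
  \<open>matrix_inv\<close> and so remains linear in \<open>w\<close> and measurable.\<close>

definition pinv :: "real^'p^'k \<Rightarrow> real^'k \<Rightarrow> real^'p" where
  "pinv A w = matrix_inv (transpose A ** A) *v (transpose A *v w)"

lemma complete_sketch_estimator_eq_pinv:
  "complete_sketch_estimator S X y = pinv (S ** X) (S *v y)"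
  by (simp add: complete_sketch_estimator_def pinv_def Let_def)

lemma pinv_add: "pinv A (v + w) = pinv A v + pinv A w"
  by (simp add: pinv_def matrix_vector_right_distrib)

lemma pinv_scaleR: "pinv A (c *\<^sub>R v) = c *\<^sub>R pinv A v"
  by (simp add: pinv_def matrix_vector_mult_scaleR)

text \<open>When the Gram matrix is nonsingular, the normal equations characterize the solution; the
  identities below are verified through them.\<close>

lemma pinv_eqI:
  assumes "det (transpose A ** A) \<noteq> 0" "transpose A *v (A *v u) = transpose A *v w"
  shows "pinv A w = u"
proof -
  have "invertible (transpose A ** A)" using assms by (simp add: invertible_det_nz)
  then show ?thesis
    by (simp add: pinv_def assms(2)[symmetric] matrix_vector_mul_assoc matrix_inv_left
        del: transpose_matrix_vector)
qed

lemma pinv_normal_equation: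
  assumes "det (transpose A ** A) \<noteq> 0"
  shows "transpose A *v (A *v pinv A w) = transpose A *v w"
proof -
  have "invertible (transpose A ** A)" using assms by (simp add: invertible_det_nz)
  then show ?thesis
    by (simp add: pinv_def matrix_vector_mul_assoc matrix_mul_assoc matrix_inv_right
        del: transpose_matrix_vector)
qed

lemma pinv_mult_vector: "det (transpose A ** A) \<noteq> 0 \<Longrightarrow> pinv A (A *v z) = z"
  by (rule pinv_eqI) auto

text \<open>Changing the basis of the column space by \<open>R\<close> changes the coefficients by
  the inverse of \<open>R\<close>. This reduces a general design to orthonormal columns.\<close>

lemma pinv_mult_invertible:
  fixes A :: "real^'p^'k" and R :: "real^'p^'p"
  assumes A: "det (transpose A ** A) \<noteq> 0" and R: "R ** B = mat 1"
  shows "pinv (A ** R) w = B *v pinv A w"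
proof (rule pinv_eqI)
  have "invertible R" using R invertible_right_inverse by blast
  then have "det R \<noteq> 0" by (simp add: invertible_det_nz)
  then show "det (transpose (A ** R) ** (A ** R)) \<noteq> 0"
    using A by (simp add: matrix_transpose_mul det_mul matrix_mul_assoc[symmetric])
      (simp add: matrix_mul_assoc det_mul)
  have "transpose (A ** R) *v (A ** R *v (B *v pinv A w)) =
     transpose R *v (transpose A *v (A *v ((R ** B) *v pinv A w)))"
    by (simp add: matrix_transpose_mul matrix_vector_mul_assoc matrix_mul_assoc del: transpose_matrix_vector)
  also have "\<dots> = transpose R *v (transpose A *v w)"
    by (simp add: R pinv_normal_equation[OF A] del: transpose_matrix_vector)
  finally show "transpose (A ** R) *v (A ** R *v (B *v pinv A w)) = transpose (A ** R) *v w"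
    by (simp add: matrix_transpose_mul matrix_vector_mul_assoc del: transpose_matrix_vector)
qed

section \<open>Borel measurability of matrix operations and of the least-squares map\<close>

lemma borel_measurable_vec_nth [measurable]: "(\<lambda>x::'a::euclidean_space^'n. x $ i) \<in> borel_measurable borel"
  by (intro borel_measurable_continuous_onI continuous_intros)

lemma borel_measurable_vecI:
  fixes f :: "'x \<Rightarrow> 'a::euclidean_space^'n"
  assumes [measurable]: "\<And>i. (\<lambda>x. f x $ i) \<in> borel_measurable M"
  shows "f \<in> borel_measurable M"
proof (subst borel_measurable_euclidean_space, intro ballI)
  fix b :: "'a^'n" assume "b \<in> Basis"
  then obtain i u where "b = axis i u" by (auto simp: Basis_vec_def)
  then show "(\<lambda>x. f x \<bullet> b) \<in> borel_measurable M" by (simp add: inner_axis)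
qed

lemma borel_measurable_vec_lambda [measurable (raw)]:
  fixes f :: "'x \<Rightarrow> 'n::finite \<Rightarrow> 'a::euclidean_space"
  assumes [measurable]: "\<And>i. (\<lambda>x. f x i) \<in> borel_measurable M"
  shows "(\<lambda>x. \<chi> i. f x i) \<in> borel_measurable M"
  by (rule borel_measurable_vecI) simp

lemma borel_measurable_det [measurable (raw)]:
  assumes [measurable]: "A \<in> borel_measurable M"
  shows "(\<lambda>x. det (A x :: real^'n^'n)) \<in> borel_measurable M"
  unfolding det_def by measurable

lemma borel_measurable_matrix_mult [measurable (raw)]:
  assumes [measurable]: "A \<in> borel_measurable M" "B \<in> borel_measurable M"
  shows "(\<lambda>x. (A x :: real^'n^'m) ** (B x :: real^'p^'n)) \<in> borel_measurable M"
  unfolding matrix_matrix_mult_def by measurable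

lemma borel_measurable_matrix_vector_mult [measurable (raw)]:
  assumes [measurable]: "A \<in> borel_measurable M" "v \<in> borel_measurable M"
  shows "(\<lambda>x. (A x :: real^'n^'m) *v v x) \<in> borel_measurable M"
  unfolding matrix_vector_mult_def by measurable

lemma borel_measurable_transpose [measurable (raw)]:
  assumes [measurable]: "A \<in> borel_measurable M"
  shows "(\<lambda>x. transpose (A x :: real^'n^'m)) \<in> borel_measurable M"
  unfolding transpose_def by measurable

text \<open>On singular matrices \<^const>\<open>matrix_inv\<close> is constant, as \<open>SOME\<close> is applied to the empty
  predicate there.\<close>

lemma borel_measurable_pinv [measurable (raw)]:
  assumes [measurable]: "A \<in> borel_measurable M" "w \<in> borel_measurable M"
  shows "(\<lambda>x. pinv (A x :: real^'p^'k) (w x)) \<in> borel_measurable M"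
proof -
  let ?G = "\<lambda>x. transpose (A x) ** A x"
  let ?b = "\<lambda>x. transpose (A x) *v w x"
  \<comment> \<open>Cramer's rule expresses the solution by quotients of determinants, which are
    measurable in the entries.\<close>
  have "pinv (A x) (w x) = (if det (?G x) \<noteq> 0
      then (\<chi> k. det (\<chi> i j. if j = k then ?b x $ i else ?G x $ i $ j) / det (?G x))
      else matrix_inv 0 *v ?b x)" for x
  proof (cases "det (?G x) = 0")
    case True
    have *: "matrix_inv B = (SOME _. False)" if "det B = 0" for B :: "real^'p^'p"
      unfolding matrix_inv_def
      using that by (intro arg_cong[where f=Eps]) (metis invertible_def invertible_det_nz)
    have "det (0::real^'p^'p) = 0" by (simp add: det_def power_0_left)
    then show ?thesis
      using True *[of "?G x"] *[of 0] by (simp add: pinv_def del: transpose_matrix_vector)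
  next
    case False
    then show ?thesis
      using pinv_normal_equation[OF False, of "w x"] cramer[OF False, of "pinv (A x) (w x)" "?b x"]
      by (simp add: matrix_vector_mul_assoc del: transpose_matrix_vector)
  qed
  then show ?thesis by (simp only:) measurable
qed

text \<open>The determinant is a polynomial in \<open>t\<close>. It is not the zero polynomial: at
  \<open>t = L + 1\<close> a kernel vector \<open>x\<close> would satisfy
  \<open>A x = - (L + 1) x\<close>, which the bound \<open>L\<close> on \<open>A\<close> permits
  only for \<open>x = 0\<close>.\<close>

lemma finite_det_add_scaled_identity_zeros:
  fixes A :: "real^'p^'p"
  shows "finite {t. det (A + t *\<^sub>R mat 1) = 0}"
proof -
  define P where "P = det (\<chi> i j. [:A $ i $ j, if i = j then 1 else 0:] :: real poly^'p^'p)"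
  have P: "poly P t = det (A + t *\<^sub>R mat 1)" for t
    by (simp add: P_def det_def poly_sum poly_prod mat_def)
  obtain L where L: "L > 0" "\<And>x. norm (A *v x) \<le> L * norm x"
    using linear_bounded_pos[OF matrix_vector_mul_linear[of A]] by blast
  have "x = 0" if "(A + (L + 1) *\<^sub>R mat 1) *v x = 0" for x
  proof -
    have "A *v x = - ((L + 1) *\<^sub>R x)"
      using that by (simp add: matrix_vector_mult_add_rdistrib scaleR_matrix_vector_assoc[symmetric] eq_neg_iff_add_eq_0)
    then have "norm (A *v x) = (L + 1) * norm x" using L(1) by simp
    with L(2)[of x] show "x = 0" by (simp add: algebra_simps)
  qed
  then have "det (A + (L + 1) *\<^sub>R mat 1) \<noteq> 0"
    using matrix_left_invertible_ker invertible_det_nz invertible_left_inverse by metis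
  then have "P \<noteq> 0" using P[of "L + 1"] by auto
  then have "finite {t. poly P t = 0}" by (rule poly_roots_finite)
  then show ?thesis by (simp add: P)
qed

text \<open>Every line in the direction of the embedded identity meets the rank-deficient matrices in a
  finite set.\<close>

lemma AE_full_column_rank:
  assumes "CARD('p) \<le> CARD('k)"
  shows "AE A in lborel. det (transpose A ** (A :: real^'p^'k)) \<noteq> 0"
proof -
  obtain h :: "'p \<Rightarrow> 'k" where h: "inj h"
    using card_le_inj[of "UNIV :: 'p set" "UNIV :: 'k set"] assms by auto
  \<comment> \<open>A square block of rows of \<open>A\<close> chosen by \<open>h\<close>; if it is
    invertible, then \<open>A\<close> is injective. The block of \<open>E0\<close> below is the
    identity.\<close>
  define sub :: "real^'p^'k \<Rightarrow> real^'p^'p" where "sub A = (\<chi> a b. A $ h a $ b)" for A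
  have [measurable]: "sub \<in> borel_measurable borel" unfolding sub_def by measurable
  define E0 :: "real^'p^'k" where "E0 = (\<chi> i b. if i = h b then 1 else 0)"
  have subE: "sub (A + t *\<^sub>R E0) = sub A + t *\<^sub>R mat 1" for A t
    using h by (auto simp: sub_def E0_def mat_def vec_eq_iff inj_eq)
  have meas: "{x \<in> space (borel \<Otimes>\<^sub>M borel). det (sub (fst x + snd x *\<^sub>R E0)) \<noteq> 0} \<in> sets (borel \<Otimes>\<^sub>M borel)"
    by measurable
  have "AE A in lborel. AE t in lborel. det (sub (A + t *\<^sub>R E0)) \<noteq> 0"
  proof (rule AE_I2)
    fix A
    have "{t. det (sub A + t *\<^sub>R mat 1) = 0} \<in> null_sets lborel"
      using finite_det_add_scaled_identity_zeros[of "sub A"] by (intro finite_imp_null_set_lborel)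
    then show "AE t in lborel. det (sub (A + t *\<^sub>R E0)) \<noteq> 0"
      unfolding subE by (rule AE_not_in[THEN AE_mp]) auto
  qed
  \<comment> \<open>After exchanging the quantifiers, some fixed shift \<open>t\<close> works for
    almost every \<open>A\<close>, and translation invariance of Lebesgue measure removes that
    shift.\<close>
  then have "AE t in lborel. AE A in lborel. det (sub (A + t *\<^sub>R E0)) \<noteq> 0"
    by (subst (asm) lborel_pair.AE_commute) (use meas in \<open>auto simp: space_pair_measure cong: sets_pair_measure_cong\<close>)
  then obtain t where "AE A in lborel. det (sub (A + t *\<^sub>R E0)) \<noteq> 0"
    using ae_filter_eq_bot_iff[of "lborel :: real measure"] eventually_happens[of _ "ae_filter lborel"]
    by (auto simp: trivial_limit_def)
  then have "AE A in distr lborel borel (\<lambda>A. t *\<^sub>R E0 + A). det (sub A) \<noteq> 0"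
    by (subst AE_distr_iff) (auto simp: add.commute)
  then have "AE A in lborel. det (sub A) \<noteq> 0" unfolding lborel_distr_plus .
  then show ?thesis
  proof eventually_elim
    case (elim A)
    have "inj ((*v) A)"
    proof (rule injI)
      fix x y assume *: "A *v x = A *v y"
      have "sub A *v z = (\<chi> a. (A *v z) $ h a)" for z
        by (simp add: sub_def matrix_vector_mult_def)
      then have "sub A *v x = sub A *v y" using * by simp
      then show "x = y" using elim by (metis invertible_det_nz inj_matrix_vector_mult injD)
    qed
    then show ?case
      using pos_def_invertible[OF pos_def_gram] by (simp add: invertible_det_nz)
  qed
qed

subsection \<open>Invariance of Gaussian integrals\<close>

lemma nn_integral_std_gauss_orthogonal:
  fixes T :: "'a::euclidean_space \<Rightarrow> 'a"
  assumes T: "orthogonal_transformation T" and [measurable]: "F \<in> borel_measurable borel"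
  shows "(\<integral>\<^sup>+x. F (T x) \<partial>std_gauss) = (\<integral>\<^sup>+x. F x \<partial>std_gauss)"
proof -
  have [measurable]: "T \<in> borel_measurable borel"
    using orthogonal_transformation_linear[OF T]
    by (intro borel_measurable_continuous_onI linear_continuous_on linear_conv_bounded_linear[THEN iffD1])
  show ?thesis
    by (subst (2) distr_std_gauss_orthogonal[OF T, symmetric]) (simp add: nn_integral_distr)
qed

lemma nn_integral_std_gauss_pair:
  assumes [measurable]: "F \<in> borel_measurable borel"
  shows "(\<integral>\<^sup>+x. F x \<partial>std_gauss) =
    (\<integral>\<^sup>+a. \<integral>\<^sup>+b. F (a :: 'a::euclidean_space, b :: 'b::euclidean_space) \<partial>std_gauss \<partial>std_gauss)"
proof -
  interpret b: prob_space "std_gauss :: 'b measure" by (rule prob_space_std_gauss)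
  have "F \<in> borel_measurable (std_gauss \<Otimes>\<^sub>M std_gauss)"
    unfolding std_gauss_pair[symmetric] by measurable
  then show ?thesis
    unfolding std_gauss_pair by (rule b.nn_integral_fst[symmetric])
qed

text \<open>The coordinate selection \<open>g\<close> is given through its adjoint \<open>f\<close>, which embeds the basis.\<close>

lemma nn_integral_std_gauss_coordinates:
  fixes f :: "'b::euclidean_space \<Rightarrow> 'a::euclidean_space" and g :: "'a \<Rightarrow> 'b"
  assumes "inj_on f Basis" "\<And>b. b \<in> Basis \<Longrightarrow> f b \<in> Basis"
    and adj: "\<And>x b. b \<in> Basis \<Longrightarrow> x \<bullet> f b = g x \<bullet> b"
    and [measurable]: "F \<in> borel_measurable borel"
  shows "(\<integral>\<^sup>+x. F (g x) \<partial>std_gauss) = (\<integral>\<^sup>+y. F y \<partial>std_gauss)"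
proof -
  have g: "(\<Sum>b\<in>Basis. (x \<bullet> f b) *\<^sub>R b) = g x" for x
    by (simp add: adj euclidean_representation cong: sum.cong)
  have "distr std_gauss borel (\<lambda>x. \<Sum>b\<in>Basis. (x \<bullet> f b) *\<^sub>R b) = std_gauss"
    using assms by (intro distr_std_gauss_reindex) auto
  then have d: "distr std_gauss borel g = std_gauss" by (simp only: g)
  have [measurable]: "g \<in> borel_measurable borel"
    unfolding g[symmetric] by measurable
  show ?thesis
    by (subst d[symmetric]) (simp add: nn_integral_distr)
qed

lemma nn_integral_std_gauss_vec_coordinates:
  fixes e :: "'p::finite \<Rightarrow> 'n::finite"
  assumes e: "inj e" and [measurable]: "F \<in> borel_measurable borel"
  shows "(\<integral>\<^sup>+x. F (\<chi> a. x $ e a) \<partial>(std_gauss :: (real^'n) measure)) = (\<integral>\<^sup>+z. F z \<partial>(std_gauss :: (real^'p) measure))"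
proof (rule nn_integral_std_gauss_coordinates)
  define f :: "real^'p \<Rightarrow> real^'n" where "f z = (\<chi> j. if j \<in> range e then z $ inv e j else 0)" for z
  have inv: "inv e (e a) = a" "e a = e b \<longleftrightarrow> a = b" for a b
    using e by (auto dest: injD)
  have "f (axis a 1) $ j = axis (e a) 1 $ j" for a j
    by (cases "j \<in> range e") (auto simp: f_def axis_def inv)
  then have f: "f (axis a 1) = axis (e a) 1" for a by (simp add: vec_eq_iff)
  show "inj_on f Basis"
    using e by (auto simp: inj_on_def Basis_vec_def f axis_eq_axis inv)
  show "f b \<in> Basis" if "b \<in> Basis" for b
    using that by (auto simp: Basis_vec_def f)
  show "x \<bullet> f b = (\<chi> a. x $ e a) \<bullet> b" if "b \<in> Basis" for x b
    using that by (auto simp: Basis_vec_def f inner_axis)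
qed measurable

text \<open>The selected columns and one further column consist of distinct entries, so jointly they
  are standard Gaussian on the product space; this form encodes their independence.\<close>

lemma nn_integral_std_gauss_columns:
  fixes e :: "'p::finite \<Rightarrow> 'n::finite"
  assumes e: "inj e" and j: "j \<notin> range e" and [measurable]: "F \<in> borel_measurable borel"
  shows "(\<integral>\<^sup>+S. F (\<chi> i a. S $ i $ e a, \<chi> i. S $ i $ j) \<partial>(std_gauss :: (real^'n^'k) measure))
    = (\<integral>\<^sup>+x. F x \<partial>(std_gauss :: ((real^'p^'k) \<times> (real^'k)) measure))"
proof (rule nn_integral_std_gauss_coordinates)
  define f :: "(real^'p^'k) \<times> (real^'k) \<Rightarrow> real^'n^'k" where
    "f x = (\<chi> i l. if l \<in> range e then fst x $ i $ inv e l else if l = j then snd x $ i else 0)" for x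
  have inv: "inv e (e a) = a" "e a = e b \<longleftrightarrow> a = b" for a b
    using e by (auto dest: injD)
  have *: "f (axis i (axis a 1), 0) $ i' $ l = axis i (axis (e a) 1) $ i' $ l"
    "f (0, axis i 1) $ i' $ l = axis i (axis j 1) $ i' $ l" for i a i' l
    using j by (cases "l \<in> range e"; auto simp: f_def axis_def inv)+
  have f: "f (axis i (axis a 1), 0) = axis i (axis (e a) 1)" "f (0, axis i 1) = axis i (axis j 1)" for i a
    by (simp_all add: vec_eq_iff *)
  show "inj_on f Basis"
    using e j by (auto simp: inj_on_def Basis_prod_def Basis_vec_def f axis_eq_axis inv)
  show "f b \<in> Basis" if "b \<in> Basis" for b
    using that by (auto simp: Basis_prod_def Basis_vec_def f) blast+
  show "x \<bullet> f b = (\<chi> i a. x $ i $ e a, \<chi> i. x $ i $ j) \<bullet> b" if "b \<in> Basis" for x b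
    using that by (auto simp: Basis_prod_def Basis_vec_def f inner_axis)
qed measurable

lemma orthogonal_transformation_matrix_vector_mult:
  "orthogonal_matrix W \<Longrightarrow> orthogonal_transformation ((*v) (W :: real^'n^'n))"
  by (simp add: orthogonal_transformation_matrix matrix_vector_mul_linear)

text \<open>Right multiplication acts on every row as the transpose of \<open>W\<close>, and the
  inner product of matrices is the sum of the inner products of their rows.\<close>

lemma orthogonal_transformation_mult_right:
  fixes W :: "real^'n^'n"
  assumes "orthogonal_matrix W"
  shows "orthogonal_transformation (\<lambda>S :: real^'n^'k. S ** W)"
proof -
  have ot: "orthogonal_transformation ((*v) (transpose W))"
    using assms by (simp add: orthogonal_transformation_matrix orthogonal_matrix_transpose matrix_vector_mul_linear del: transpose_matrix_vector)
  have row: "(S ** W) $ i = transpose W *v (S $ i)" for S :: "real^'n^'k" and i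
    by (simp add: vec_eq_iff matrix_matrix_mult_def matrix_vector_mult_def transpose_def mult.commute del: transpose_matrix_vector)
  show ?thesis
    unfolding orthogonal_transformation_def
  proof
    show "linear (\<lambda>S :: real^'n^'k. S ** W)"
      by (rule linearI) (simp_all add: vec_eq_iff matrix_matrix_mult_def distrib_right sum.distrib sum_distrib_left mult.assoc)
    show "\<forall>S T :: real^'n^'k. (S ** W) \<bullet> (T ** W) = S \<bullet> T"
      using ot by (simp add: inner_vec_def[where 'a="real^'n"] row orthogonal_transformation_def del: transpose_matrix_vector)
  qed
qed

text \<open>A rotation in the plane spanned by the two independent vectors.\<close>

lemma nn_integral_std_gauss_sum:
  fixes F :: "'a::euclidean_space \<Rightarrow> ennreal"
  assumes [measurable]: "F \<in> borel_measurable borel"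
  shows "(\<integral>\<^sup>+z1. \<integral>\<^sup>+z. F (z1 + c *\<^sub>R z) \<partial>std_gauss \<partial>std_gauss) = (\<integral>\<^sup>+z. F (sqrt (1 + c\<^sup>2) *\<^sub>R z) \<partial>std_gauss)"
proof -
  interpret prob_space "std_gauss :: 'a measure" by (rule prob_space_std_gauss)
  define s where "s = sqrt (1 + c\<^sup>2)"
  have s: "s > 0" "s * s = 1 + c * c"
    by (auto simp: s_def power2_eq_square add_pos_nonneg)
  \<comment> \<open>\<open>s\<close> times the first component of the image is the sum to be
    integrated; the second component completes the map to an isometry.\<close>
  define T :: "'a \<times> 'a \<Rightarrow> 'a \<times> 'a" where
    "T x = inverse s *\<^sub>R (fst x + c *\<^sub>R snd x, snd x - c *\<^sub>R fst x)" for x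
  have "orthogonal_transformation T"
    unfolding orthogonal_transformation_def
  proof (intro conjI allI)
    show "linear T"
      by (rule linearI) (simp_all add: T_def algebra_simps)
    fix v w :: "'a \<times> 'a"
    have "T v \<bullet> T w = inverse (s * s) * ((fst v + c *\<^sub>R snd v) \<bullet> (fst w + c *\<^sub>R snd w) + (snd v - c *\<^sub>R fst v) \<bullet> (snd w - c *\<^sub>R fst w))"
      by (simp add: T_def inner_prod_def algebra_simps)
    also have "\<dots> = inverse (s * s) * ((1 + c * c) * (fst v \<bullet> fst w + snd v \<bullet> snd w))"
      by (simp add: inner_simps algebra_simps)
    also have "\<dots> = v \<bullet> w" unfolding s(2) by (simp add: inner_prod_def add_pos_nonneg add_nonneg_eq_0_iff)
    finally show "T v \<bullet> T w = v \<bullet> w" .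
  qed
  moreover have meas: "(\<lambda>x. F (p *\<^sub>R fst x + q *\<^sub>R snd x)) \<in> borel_measurable (borel :: ('a \<times> 'a) measure)" for p q
    unfolding borel_prod[symmetric] by measurable
  ultimately
  have "(\<integral>\<^sup>+x. F (fst x + c *\<^sub>R snd x) \<partial>std_gauss) = (\<integral>\<^sup>+x. F (s *\<^sub>R fst x) \<partial>(std_gauss :: ('a \<times> 'a) measure))"
    using nn_integral_std_gauss_orthogonal[of T "\<lambda>x. F (s *\<^sub>R fst x)"] meas[of s 0] s(1)
    by (simp add: T_def)
  then show ?thesis
    using meas[of s 0] meas[of 1 c]
    by (simp add: nn_integral_std_gauss_pair s_def[symmetric] emeasure_space_1[simplified])
qed

text \<open>A Householder reflection fixing the selected coordinates turns \<open>S z\<close> into a multiple of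
  a single column of \<open>S\<close> outside the selected ones.\<close>

lemma nn_integral_std_gauss_columns_combination:
  fixes e :: "'p::finite \<Rightarrow> 'n::finite" and z :: "real^'n"
  assumes e: "inj e" and j: "j \<notin> range e" and z: "\<And>a. z $ e a = 0"
    and [measurable]: "F \<in> borel_measurable borel"
  shows "(\<integral>\<^sup>+S. F (\<chi> i a. S $ i $ e a, S *v z) \<partial>(std_gauss :: (real^'n^'k) measure))
    = (\<integral>\<^sup>+A. \<integral>\<^sup>+w. F (A, norm z *\<^sub>R w) \<partial>std_gauss \<partial>(std_gauss :: (real^'p^'k) measure))"
proof -
  \<comment> \<open>The unit vector in the direction of \<open>z\<close>. For \<open>z = 0\<close>
    the axis \<open>j\<close> serves, as it also vanishes on the selected coordinates.\<close>
  define u where "u = (if z = 0 then axis j 1 else z /\<^sub>R norm z)"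
  have zu: "z = norm z *\<^sub>R u" and u1: "u \<bullet> u = 1"
    by (auto simp: u_def dot_square_norm power2_eq_square)
  have ue: "u $ e a = 0" for a
    using j z by (auto simp: u_def axis_def)
  \<comment> \<open>Reflecting in the hyperplane orthogonal to \<open>u - axis j 1\<close> exchanges
    these two unit vectors. If they coincide, division by zero makes \<open>H\<close> the
    identity.\<close>
  define v where "v = u - axis j 1"
  define H where "H x = x - (2 * (v \<bullet> x) / (v \<bullet> v)) *\<^sub>R v" for x
  have lin: "linear H"
    by (rule linearI) (simp_all add: H_def inner_simps algebra_simps add_divide_distrib)
  have H: "orthogonal_transformation H"
    unfolding orthogonal_transformation_def
  proof (intro conjI allI lin)
    fix x y
    show "H x \<bullet> H y = x \<bullet> y"
    proof (cases "v = 0")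
      case False
      then show ?thesis by (simp add: H_def inner_simps inner_commute field_simps)
    qed (simp add: H_def)
  qed
  define W where "W = matrix H"
  have W: "orthogonal_matrix W" using H by (simp add: W_def orthogonal_transformation_matrix)
  have WH: "W *v x = H x" for x by (simp add: W_def matrix_works lin)
  have "v \<bullet> v = 2 - 2 * u $ j"
    by (simp add: v_def inner_diff u1 inner_axis inner_axis' inner_commute)
  moreover have "v \<bullet> axis j 1 = u $ j - 1" by (simp add: v_def inner_diff inner_axis)
  ultimately have "v \<bullet> axis j 1 = - (v \<bullet> v) / 2" by simp
  then have "H (axis j 1) = axis j 1 + v"
    by (cases "v = 0") (auto simp: H_def)
  then have Hj: "W *v axis j 1 = u" by (simp add: WH v_def)
  have "v $ e a = 0" for a
    using j by (auto simp: v_def ue axis_def)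
  then have "v \<bullet> axis (e a) 1 = 0" for a by (simp add: inner_axis)
  then have He: "W *v axis (e a) 1 = axis (e a) 1" for a by (simp add: WH H_def)
  have col: "(S ** W) $ i $ l = (S *v (W *v axis l 1)) $ i" for S :: "real^'n^'k" and i l
    unfolding matrix_vector_mul_assoc by (simp add: matrix_vector_mult_basis column_def)
  have colS: "(S *v axis l 1) $ i = S $ i $ l" for S :: "real^'n^'k" and i l
    by (simp add: matrix_vector_mult_basis column_def)
  have meas: "(\<lambda>x. F (fst x, norm z *\<^sub>R snd x)) \<in> borel_measurable (borel :: ((real^'p^'k) \<times> (real^'k)) measure)"
    using assms(4) unfolding borel_prod[symmetric] by measurable
  have "(\<integral>\<^sup>+S. F (\<chi> i a. S $ i $ e a, S *v z) \<partial>(std_gauss :: (real^'n^'k) measure))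
    = (\<integral>\<^sup>+S. F (\<chi> i a. (S ** W) $ i $ e a, norm z *\<^sub>R (\<chi> i. (S ** W) $ i $ j)) \<partial>(std_gauss :: (real^'n^'k) measure))"
  proof (rule nn_integral_cong)
    fix S :: "real^'n^'k"
    have "S *v z = norm z *\<^sub>R (S *v u)" by (subst zu) (simp add: matrix_vector_mult_scaleR)
    then show "F (\<chi> i a. S $ i $ e a, S *v z) = F (\<chi> i a. (S ** W) $ i $ e a, norm z *\<^sub>R (\<chi> i. (S ** W) $ i $ j))"
      by (simp add: col He Hj colS)
  qed
  also have "\<dots> = (\<integral>\<^sup>+S. F (\<chi> i a. S $ i $ e a, norm z *\<^sub>R (\<chi> i. S $ i $ j)) \<partial>(std_gauss :: (real^'n^'k) measure))"
    by (rule nn_integral_std_gauss_orthogonal[OF orthogonal_transformation_mult_right[OF W],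
          of "\<lambda>S. F (\<chi> i a. S $ i $ e a, norm z *\<^sub>R (\<chi> i. S $ i $ j))"]) measurable
  also have "\<dots> = (\<integral>\<^sup>+x. F (fst x, norm z *\<^sub>R snd x) \<partial>(std_gauss :: ((real^'p^'k) \<times> (real^'k)) measure))"
    using nn_integral_std_gauss_columns[OF e j meas] by simp
  finally show ?thesis using meas by (simp add: nn_integral_std_gauss_pair)
qed

subsection \<open>The Student law of the least-squares map\<close>

text \<open>The centered Gaussian density with precision \<open>A\<^sup>T A\<close>, without its
  determinant factor. The constant makes it the standard Gaussian density at \<open>z\<close> when
  \<open>t = B z\<close> and \<open>A B\<close> has orthonormal columns.\<close>

definition gram_weight :: "real^'p^'k \<Rightarrow> real^'p \<Rightarrow> ennreal" where
  "gram_weight A t = ennreal (exp (- (norm (A *v t))\<^sup>2 / 2) / sqrt (2 * pi) ^ CARD('p))"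

lemma gram_weight_measurable [measurable (raw)]:
  assumes [measurable]: "A \<in> borel_measurable M" "t \<in> borel_measurable M"
  shows "(\<lambda>x. gram_weight (A x) (t x)) \<in> borel_measurable M"
  unfolding gram_weight_def by measurable

text \<open>By uniqueness of Haar measure the normalizing constant of the Gaussian law with
  precision matrix \<open>A\<^sup>T A\<close> is the reciprocal of an integral; no determinant is needed.\<close>

lemma nn_integral_pinv:
  fixes A :: "real^'p^'k" and f :: "real^'p \<Rightarrow> ennreal"
  assumes A: "det (transpose A ** A) \<noteq> 0" and [measurable]: "f \<in> borel_measurable borel"
  shows "(\<integral>\<^sup>+w. f (pinv A w) \<partial>std_gauss) =
    inverse (\<integral>\<^sup>+t. gram_weight A t \<partial>lborel) * (\<integral>\<^sup>+t. f t * gram_weight A t \<partial>lborel)"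
proof -
  have "inj ((*v) A)"
  proof (rule injI)
    fix x y assume "A *v x = A *v y"
    then show "x = y" by (metis pinv_mult_vector[OF A])
  qed
  note on = orthonormalize[OF this]
  define B where "B = inv_sqrt_matrix (transpose A ** A)"
  define Q where "Q = A ** B"
  have Q: "transpose Q ** Q = mat 1" and tB: "transpose B = B" and iB: "invertible B"
    using on by (simp_all add: Q_def B_def)
  obtain W :: "real^'k^'k" and e :: "'p \<Rightarrow> 'k"
    where W: "orthogonal_matrix W" and e: "inj e" and We: "\<And>a. column (e a) W = column a Q"
    using orthonormal_columns_extend[OF Q] by blast
  have "inv_sqrt_matrix (transpose A ** A) ** inv_sqrt_matrix (transpose A ** A) = matrix_inv (transpose A ** A)"
    using inv_sqrt_matrix(2)[OF pos_def_gram[OF \<open>inj ((*v) A)\<close>]] .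
  then have pinv: "pinv A w = B *v (transpose Q *v w)" for w
    by (simp add: pinv_def Q_def matrix_transpose_mul tB B_def[symmetric] matrix_vector_mul_assoc matrix_mul_assoc del: transpose_matrix_vector)
  have QW: "transpose Q *v (W *v v) = (\<chi> a. v $ e a)" for v
  proof -
    have "(transpose Q *v (W *v v)) $ a = v $ e a" for a
    proof -
      have "(transpose Q *v (W *v v)) $ a = column a Q \<bullet> (W *v v)"
        by (simp add: matrix_vector_mult_def transpose_def column_def inner_vec_def del: transpose_matrix_vector)
      also have "\<dots> = (W *v axis (e a) 1) \<bullet> (W *v v)"
        by (simp add: We[symmetric] matrix_vector_mult_basis)
      also have "\<dots> = axis (e a) 1 \<bullet> v"
        using orthogonal_transformation_matrix_vector_mult[OF W] by (simp add: orthogonal_transformation_def)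
      finally show ?thesis by (simp add: inner_axis')
    qed
    then show ?thesis by (simp add: vec_eq_iff)
  qed
  have oW: "orthogonal_transformation ((*v) W)"
    by (rule orthogonal_transformation_matrix_vector_mult[OF W])
  have AB: "norm (A *v (B *v z)) = norm z" for z
  proof -
    have "(norm (A *v (B *v z)))\<^sup>2 = (transpose Q *v (Q *v z)) \<bullet> z"
      using inner_matrix_vector_mult[of "Q *v z" Q z]
      by (simp add: power2_norm_eq_inner Q_def matrix_vector_mul_assoc del: transpose_matrix_vector)
    also have "\<dots> = (norm z)\<^sup>2"
      by (simp add: matrix_vector_mul_assoc Q power2_norm_eq_inner del: transpose_matrix_vector)
    finally show ?thesis by (simp add: power2_eq_iff_nonneg)
  qed
  have wB: "gram_weight A (B *v z) = std_gauss_density z" for z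
    by (simp add: gram_weight_def std_gauss_density_def AB)
  have linB: "linear ((*v) B)" by (rule matrix_vector_mul_linear)
  have bijB: "bij ((*v) B)" using iB by (simp add: invertible_eq_bij)
  have one: "(\<integral>\<^sup>+z. ennreal (std_gauss_density (z::real^'p)) \<partial>lborel) = 1"
    using prob_space.emeasure_space_1[OF prob_space_std_gauss, where 'a1="real^'p"]
    by (simp add: std_gauss_def emeasure_density)
  \<comment> \<open>The columns of \<open>Q\<close> are columns of \<open>W\<close>, so rotating
    \<open>w\<close> by \<open>W\<close> turns \<open>Q\<^sup>T w\<close> into a selection of
    coordinates, which is standard Gaussian.\<close>
  have "(\<integral>\<^sup>+w. f (pinv A w) \<partial>std_gauss) = (\<integral>\<^sup>+v. f (pinv A (W *v v)) \<partial>std_gauss)"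
    using nn_integral_std_gauss_orthogonal[OF oW, of "\<lambda>w. f (pinv A w)"] by simp
  also have "\<dots> = (\<integral>\<^sup>+v. f (B *v (\<chi> a. v $ e a)) \<partial>std_gauss)"
    by (simp add: pinv QW del: transpose_matrix_vector)
  also have "\<dots> = (\<integral>\<^sup>+z. f (B *v z) \<partial>std_gauss)"
    by (rule nn_integral_std_gauss_vec_coordinates[OF e, of "\<lambda>z. f (B *v z)"]) measurable
  also have "\<dots> = (\<integral>\<^sup>+z. f (B *v z) * gram_weight A (B *v z) \<partial>lborel)"
    by (simp add: std_gauss_def nn_integral_density wB mult.commute)
  finally have I: "(\<integral>\<^sup>+w. f (pinv A w) \<partial>std_gauss) = (\<integral>\<^sup>+z. f (B *v z) * gram_weight A (B *v z) \<partial>lborel)" .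
  define J where "J = (\<integral>\<^sup>+t. gram_weight A t \<partial>lborel)"
  have "(\<integral>\<^sup>+z. f (B *v z) * gram_weight A (B *v z) \<partial>lborel) * J
      = (\<integral>\<^sup>+t. gram_weight A (B *v t) \<partial>lborel) * (\<integral>\<^sup>+t. f t * gram_weight A t \<partial>lborel)"
    unfolding J_def by (rule lborel_linear_proportional[OF linB bijB]) auto
  then have 1: "(\<integral>\<^sup>+w. f (pinv A w) \<partial>std_gauss) * J = (\<integral>\<^sup>+t. f t * gram_weight A t \<partial>lborel)"
    by (simp add: I wB one)
  \<comment> \<open>Comparison with the standard Gaussian density, which has mass one, yields a
    product with factor \<open>J\<close> equal to 1. Hence \<open>J\<close> is neither 0 nor
    infinite and can be divided by.\<close>
  have "(\<integral>\<^sup>+t. gram_weight A (B *v t) \<partial>lborel) * (\<integral>\<^sup>+z. ennreal (std_gauss_density (z::real^'p)) \<partial>lborel)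
      = (\<integral>\<^sup>+z. ennreal (std_gauss_density (B *v z)) \<partial>lborel) * J"
    unfolding J_def by (rule lborel_linear_proportional[OF linB bijB]) auto
  then have 2: "1 = (\<integral>\<^sup>+z. ennreal (std_gauss_density (B *v z)) \<partial>lborel) * J" by (simp add: wB one)
  have "J \<noteq> 0" using 2 by auto
  moreover have "J \<noteq> \<top>"
    using 2 by (auto simp: ennreal_mult_top split: if_splits)
  ultimately show ?thesis
    unfolding J_def[symmetric] 1[symmetric]
    by (metis divide_ennreal_def ennreal_mult_divide_eq mult.commute)
qed

text \<open>The Jacobian of a diagonal map: each coordinate in \<open>C\<close> contributes one
  factor \<open>r\<close>.\<close>

lemma nn_integral_lborel_scale_coordinates:
  fixes F :: "'a::euclidean_space \<Rightarrow> ennreal"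
  assumes C: "C \<subseteq> Basis" and r: "r > 0" and [measurable]: "F \<in> borel_measurable borel"
  shows "(\<integral>\<^sup>+x. F x \<partial>lborel) =
    ennreal (r ^ card C) * (\<integral>\<^sup>+x. F (\<Sum>b\<in>Basis. ((if b \<in> C then r else 1) * (x \<bullet> b)) *\<^sub>R b) \<partial>lborel)"
proof -
  let ?T = "\<lambda>x::'a. 0 + (\<Sum>b\<in>Basis. ((if b \<in> C then r else 1) * (x \<bullet> b)) *\<^sub>R b)"
  have "(\<Prod>b\<in>Basis. \<bar>if b \<in> C then r else 1\<bar>) = (\<Prod>b\<in>Basis. if b \<in> C then r else 1)"
    using r by (intro prod.cong) auto
  also have "\<dots> = r ^ card C"
    using C by (simp add: prod.If_cases Int_absorb1)
  finally have "(lborel :: 'a measure) = density (distr lborel borel ?T) (\<lambda>_. ennreal (r ^ card C))"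
    using lborel_affine_euclidean[of "\<lambda>b. if b \<in> C then r else 1" "0 :: 'a"] r by simp
  then have "(\<integral>\<^sup>+x. F x \<partial>lborel) = (\<integral>\<^sup>+x. F x \<partial>density (distr lborel borel ?T) (\<lambda>_. ennreal (r ^ card C)))"
    by simp
  also have "\<dots> = ennreal (r ^ card C) * (\<integral>\<^sup>+x. F (?T x) \<partial>lborel)"
    by (subst nn_integral_density) (auto simp: nn_integral_distr nn_integral_cmult)
  finally show ?thesis by simp
qed

text \<open>The joint density of \<open>A\<close> and \<open>t = pinv A w\<close> for standard Gaussian \<open>A\<close> and \<open>w\<close>.\<close>

definition joint_weight :: "real^'p^'k \<Rightarrow> real^'p \<Rightarrow> ennreal" where
  "joint_weight A t = std_gauss_density A * inverse (\<integral>\<^sup>+s. gram_weight A s \<partial>lborel) * gram_weight A t"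

lemma joint_weight_measurable [measurable (raw)]:
  assumes [measurable]: "A \<in> borel_measurable M" "t \<in> borel_measurable M"
  shows "(\<lambda>x. joint_weight (A x) (t x)) \<in> borel_measurable M"
  unfolding joint_weight_def by measurable

text \<open>For almost every \<open>A\<close> the Gram matrix is invertible and the conditional
  density of \<open>pinv A w\<close> applies. Fubini then moves \<open>t\<close> outside, and the
  inner integral over \<open>A\<close> becomes the marginal density at \<open>t\<close>.\<close>

lemma nn_integral_pinv_joint_weight:
  fixes f :: "real^'p \<Rightarrow> ennreal"
  assumes pk: "CARD('p) \<le> CARD('k)" and [measurable]: "f \<in> borel_measurable borel"
  shows "(\<integral>\<^sup>+A. \<integral>\<^sup>+w. f (pinv A w) \<partial>std_gauss \<partial>(std_gauss :: (real^'p^'k) measure)) =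
    (\<integral>\<^sup>+t. f t * (\<integral>\<^sup>+A. joint_weight (A :: real^'p^'k) t \<partial>lborel) \<partial>lborel)"
proof -
  interpret g: prob_space "std_gauss :: (real^'k) measure" by (rule prob_space_std_gauss)
  have "(\<integral>\<^sup>+A. \<integral>\<^sup>+w. f (pinv A w) \<partial>std_gauss \<partial>(std_gauss :: (real^'p^'k) measure)) =
    (\<integral>\<^sup>+A. std_gauss_density A * (\<integral>\<^sup>+w. f (pinv A w) \<partial>std_gauss) \<partial>(lborel :: (real^'p^'k) measure))"
    unfolding std_gauss_def[where 'a="real^'p^'k"] by (subst nn_integral_density) auto
  also have "\<dots> = (\<integral>\<^sup>+A. \<integral>\<^sup>+t. f t * joint_weight (A :: real^'p^'k) t \<partial>lborel \<partial>lborel)"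
    using AE_full_column_rank[OF pk]
    by (intro nn_integral_cong_AE, eventually_elim)
      (simp add: nn_integral_pinv joint_weight_def nn_integral_cmult[symmetric] mult_ac)
  also have "\<dots> = (\<integral>\<^sup>+t. \<integral>\<^sup>+A. f t * joint_weight (A :: real^'p^'k) t \<partial>lborel \<partial>lborel)"
    by (rule lborel_pair.Fubini'[symmetric]) measurable
  also have "\<dots> = (\<integral>\<^sup>+t. f t * (\<integral>\<^sup>+A. joint_weight (A :: real^'p^'k) t \<partial>lborel) \<partial>lborel)"
    by (simp add: nn_integral_cmult)
  finally show ?thesis .
qed

lemma nn_integral_lborel_orthogonal:
  fixes T :: "'a::euclidean_space \<Rightarrow> 'a"
  assumes T: "orthogonal_transformation T" and [measurable]: "F \<in> borel_measurable borel"
  shows "(\<integral>\<^sup>+x. F (T x) \<partial>lborel) = (\<integral>\<^sup>+x. F x \<partial>lborel)"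
proof -
  have [measurable]: "T \<in> borel_measurable borel"
    using orthogonal_transformation_linear[OF T]
    by (intro borel_measurable_continuous_onI linear_continuous_on linear_conv_bounded_linear[THEN iffD1])
  show ?thesis
    by (subst (2) distr_lborel_orthogonal[OF T, symmetric]) (simp add: nn_integral_distr)
qed

text \<open>Substituting \<open>A ** W\<close> for \<open>A\<close> preserves Lebesgue measure, the
  norm and the normalizing integral, and moves \<open>W\<close> onto \<open>t\<close>. Hence the
  marginal density depends on \<open>t\<close> only through its norm.\<close>

lemma joint_weight_rotate:
  fixes W :: "real^'p^'p"
  assumes W: "orthogonal_matrix W"
  shows "(\<integral>\<^sup>+A. joint_weight (A :: real^'p^'k) (W *v t) \<partial>lborel) = (\<integral>\<^sup>+A. joint_weight (A :: real^'p^'k) t \<partial>lborel)"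
proof -
  have gw: "gram_weight (A ** W) s = gram_weight A (W *v s)" for A :: "real^'p^'k" and s
    by (simp add: gram_weight_def matrix_vector_mul_assoc)
  have "joint_weight (A ** W) t = joint_weight A (W *v t)" for A :: "real^'p^'k"
  proof -
    have "(\<integral>\<^sup>+s. gram_weight (A ** W) s \<partial>lborel) = (\<integral>\<^sup>+s. gram_weight A s \<partial>lborel)"
      unfolding gw using nn_integral_lborel_orthogonal[OF orthogonal_transformation_matrix_vector_mult[OF W], of "gram_weight A"]
      by simp
    moreover have "norm (A ** W) = norm A"
      by (rule orthogonal_transformation_norm[OF orthogonal_transformation_mult_right[OF W]])
    ultimately show ?thesis
      by (simp add: joint_weight_def gw std_gauss_density_def)
  qed
  then show ?thesis
    using nn_integral_lborel_orthogonal[OF orthogonal_transformation_mult_right[OF W], of "\<lambda>A :: real^'p^'k. joint_weight A t"]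
    by simp
qed

text \<open>Rotate \<open>t\<close> onto a coordinate axis, then rescale the corresponding column of \<open>A\<close>.\<close>

lemma joint_weight_scaling:
  fixes t :: "real^'p"
  defines "r \<equiv> inverse (sqrt (1 + (norm t)\<^sup>2))"
  shows "(\<integral>\<^sup>+A. joint_weight (A :: real^'p^'k) t \<partial>lborel) =
    ennreal (r ^ (CARD('k) + 1)) * (\<integral>\<^sup>+A. joint_weight (A :: real^'p^'k) 0 \<partial>lborel)"
proof -
  fix l :: 'p
  define s where "s = norm t *\<^sub>R axis l (1::real)"
  have r: "r > 0" "r\<^sup>2 * (1 + (norm t)\<^sup>2) = 1"
    by (auto simp: r_def power_inverse add_pos_nonneg add_nonneg_eq_0_iff)
  have "norm s = norm t" by (simp add: s_def)
  then obtain f where f: "orthogonal_transformation f" "f s = t"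
    using orthogonal_transformation_exists by metis
  have W: "orthogonal_matrix (matrix f)" and Ws: "matrix f *v s = t"
    using f by (auto simp: orthogonal_transformation_matrix matrix_works)
  define d where "d j = (if j = l then r else 1)" for j :: 'p
  define D where "D = (\<chi> i j. if i = j then d j else 0 :: real^'p^'p)"
  have AD: "(A ** D) $ i $ j = A $ i $ j * d j" for A :: "real^'p^'k" and i j
    by (simp add: matrix_matrix_mult_def D_def if_distrib cong: if_cong)
  have Dt: "(D *v x) $ j = d j * x $ j" for x j
    by (simp add: matrix_vector_mult_def D_def if_distrib if_distribR cong: if_cong)
  have scaleD: "(\<Sum>b\<in>Basis. ((if b \<in> {axis l 1} then r else 1) * (x \<bullet> b)) *\<^sub>R b) = D *v x" for x
  proof (rule euclidean_eqI)
    fix b :: "real^'p" assume b: "b \<in> Basis"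
    then obtain j where j: "b = axis j 1" by (auto simp: Basis_vec_def)
    show "(\<Sum>b\<in>Basis. ((if b \<in> {axis l 1} then r else 1) * (x \<bullet> b)) *\<^sub>R b) \<bullet> b = (D *v x) \<bullet> b"
      using b by (simp add: inner_sum_left inner_Basis if_distrib cong: if_cong)
        (simp add: j inner_axis Dt d_def axis_eq_axis)
  qed
  let ?C = "range (\<lambda>i. axis i (axis l 1)) :: (real^'p^'k) set"
  have cardC: "card ?C = CARD('k)"
    by (intro card_image) (auto simp: inj_on_def axis_eq_axis)
  have CB: "?C \<subseteq> Basis" by (auto simp: Basis_vec_def)
  have scaleAD: "(\<Sum>b\<in>Basis. ((if b \<in> ?C then r else 1) * (A \<bullet> b)) *\<^sub>R b) = A ** D" for A :: "real^'p^'k"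
  proof (rule euclidean_eqI)
    fix b :: "real^'p^'k" assume b: "b \<in> Basis"
    then obtain i j where j: "b = axis i (axis j 1)" by (auto simp: Basis_vec_def)
    show "(\<Sum>b\<in>Basis. ((if b \<in> ?C then r else 1) * (A \<bullet> b)) *\<^sub>R b) \<bullet> b = (A ** D) \<bullet> b"
      using b by (simp add: inner_sum_left inner_Basis if_distrib cong: if_cong)
        (auto simp: j inner_axis AD d_def axis_eq_axis)
  qed
  have ADx: "(A ** D) *v x = A *v (D *v x)" for A :: "real^'p^'k" and x
    by (simp add: matrix_vector_mul_assoc)
  \<comment> \<open>The normalizing integral of \<open>A\<close> arises from that of
    \<open>A ** D\<close> by rescaling one coordinate. This is the factor \<open>r\<close> that
    raises the exponent from \<open>k\<close>, the number of entries of a column, to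
    \<open>k + 1\<close>.\<close>
  have wt: "inverse (\<integral>\<^sup>+x. gram_weight (A ** D) x \<partial>lborel) = ennreal r * inverse (\<integral>\<^sup>+x. gram_weight A x \<partial>lborel)"
    for A :: "real^'p^'k"
  proof -
    let ?J = "\<integral>\<^sup>+x. gram_weight (A ** D) x \<partial>lborel"
    have "(\<integral>\<^sup>+x. gram_weight A x \<partial>lborel) = ennreal r * (\<integral>\<^sup>+x. gram_weight A (D *v x) \<partial>lborel)"
      using nn_integral_lborel_scale_coordinates[of "{axis l 1}" r "gram_weight A"] r
      unfolding scaleD by (auto simp: Basis_vec_def)
    also have "(\<integral>\<^sup>+x. gram_weight A (D *v x) \<partial>lborel) = ?J"
      by (simp add: gram_weight_def ADx)
    finally have "inverse (\<integral>\<^sup>+x. gram_weight A x \<partial>lborel) = inverse (ennreal r) * inverse ?J"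
      using r by (subst ennreal_inverse_mult'[symmetric]) auto
    then have "ennreal r * inverse (\<integral>\<^sup>+x. gram_weight A x \<partial>lborel) = (ennreal r * inverse (ennreal r)) * inverse ?J"
      by (simp add: mult.assoc)
    also have "ennreal r * inverse (ennreal r) = 1"
      using r by (simp add: inverse_ennreal ennreal_mult'[symmetric])
    finally show ?thesis by simp
  qed
  \<comment> \<open>Let \<open>a\<close> be column \<open>l\<close> of \<open>A\<close>. The
    shrunken column keeps \<open>r\<^sup>2 |a|\<^sup>2\<close> and the second term contributes
    \<open>r\<^sup>2 |t|\<^sup>2 |a|\<^sup>2\<close>; by the choice of \<open>r\<close> they sum to
    \<open>|a|\<^sup>2\<close>.\<close>
  have norms: "(norm (A ** D))\<^sup>2 + (norm ((A ** D) *v s))\<^sup>2 = (norm A)\<^sup>2" for A :: "real^'p^'k"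
  proof -
    have sq: "(norm B)\<^sup>2 = (\<Sum>i\<in>UNIV. \<Sum>j\<in>UNIV. (B $ i $ j)\<^sup>2)" for B :: "real^'p^'k"
      unfolding power2_norm_eq_inner inner_vec_def by (simp add: power2_eq_square)
    have d2: "(d j)\<^sup>2 = 1 - (if j = l then 1 - r\<^sup>2 else 0)" for j by (simp add: d_def)
    have n1: "(norm (A ** D))\<^sup>2 = (\<Sum>i\<in>UNIV. (\<Sum>j\<in>UNIV. (A $ i $ j)\<^sup>2) - (A $ i $ l)\<^sup>2 * (1 - r\<^sup>2))"
    proof -
      have "(\<Sum>j\<in>UNIV. (A $ i $ j)\<^sup>2 * (1 - (if j = l then 1 - r\<^sup>2 else 0)))
          = (\<Sum>j\<in>UNIV. (A $ i $ j)\<^sup>2 - (if j = l then (A $ i $ j)\<^sup>2 * (1 - r\<^sup>2) else 0))" for i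
        by (intro sum.cong) (auto simp: right_diff_distrib)
      then show ?thesis
        unfolding sq AD power_mult_distrib d2 by (simp add: sum_subtractf)
    qed
    have "D *v s = (norm t * r) *\<^sub>R axis l 1"
      by (auto simp: vec_eq_iff Dt s_def d_def axis_def)
    then have "(A ** D) *v s = (norm t * r) *\<^sub>R column l A"
      by (simp add: ADx matrix_vector_mult_scaleR matrix_vector_mult_basis)
    then have "(norm ((A ** D) *v s))\<^sup>2 = (norm t * r)\<^sup>2 * (norm (column l A))\<^sup>2"
      by (simp add: power_mult_distrib)
    also have "\<dots> = (\<Sum>i\<in>UNIV. (norm t * r)\<^sup>2 * (A $ i $ l)\<^sup>2)"
      unfolding power2_norm_eq_inner inner_vec_def
      by (simp add: column_def power2_eq_square sum_distrib_left)
    finally have n2: "(norm ((A ** D) *v s))\<^sup>2 = (\<Sum>i\<in>UNIV. (norm t * r)\<^sup>2 * (A $ i $ l)\<^sup>2)" .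
    have n3: "(norm t * r)\<^sup>2 = 1 - r\<^sup>2" using r(2) by (simp add: power_mult_distrib algebra_simps)
    show ?thesis
      unfolding n1 n2 n3 by (simp add: sq sum_subtractf mult.commute)
  qed
  have jw: "joint_weight (A ** D) s = ennreal r * joint_weight A 0" for A :: "real^'p^'k"
  proof -
    have "std_gauss_density (A ** D) * exp (- (norm ((A ** D) *v s))\<^sup>2 / 2) = std_gauss_density A"
      using norms[of A] by (simp add: std_gauss_density_def exp_add[symmetric] field_simps)
    then have "ennreal (std_gauss_density (A ** D)) * gram_weight (A ** D) s =
        ennreal (std_gauss_density A) * gram_weight A 0"
      unfolding gram_weight_def
      by (simp add: ennreal_mult'[symmetric] std_gauss_density_pos[THEN less_imp_le] field_simps)
    then show ?thesis
      unfolding joint_weight_def wt by (metis (no_types, lifting) mult.assoc mult.commute)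
  qed
  have "(\<integral>\<^sup>+A. joint_weight (A :: real^'p^'k) t \<partial>lborel) = (\<integral>\<^sup>+A. joint_weight (A :: real^'p^'k) s \<partial>lborel)"
    using joint_weight_rotate[OF W, of s] by (simp add: Ws)
  also have "\<dots> = ennreal (r ^ CARD('k)) * (\<integral>\<^sup>+A. joint_weight ((A :: real^'p^'k) ** D) s \<partial>lborel)"
    using nn_integral_lborel_scale_coordinates[OF CB r(1), of "\<lambda>A. joint_weight A s"]
    unfolding scaleAD cardC by simp
  also have "\<dots> = ennreal (r ^ CARD('k)) * ennreal r * (\<integral>\<^sup>+A. joint_weight (A :: real^'p^'k) 0 \<partial>lborel)"
    by (simp add: jw nn_integral_cmult mult.assoc)
  also have "ennreal (r ^ CARD('k)) * ennreal r = ennreal (r ^ (CARD('k) + 1))"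
    using r(1) by (simp add: ennreal_mult'[symmetric] mult.commute)
  finally show ?thesis .
qed

section \<open>The law of a Gaussian vector divided by the root of a chi-square variable\<close>

lemma chi_square_density_measurable [measurable]: "chi_square_density d \<in> borel_measurable borel"
  unfolding chi_square_density_def by measurable

lemma nn_integral_std_gauss_unscale:
  fixes f :: "'a::euclidean_space \<Rightarrow> ennreal"
  assumes c: "c > 0" and [measurable]: "f \<in> borel_measurable borel"
  shows "(\<integral>\<^sup>+z. f (inverse c *\<^sub>R z) \<partial>std_gauss) =
    ennreal (c ^ DIM('a)) * (\<integral>\<^sup>+t. f t * std_gauss_density (c *\<^sub>R t) \<partial>lborel)"
proof -
  have l: "(lborel :: 'a measure) = density (distr lborel borel (\<lambda>x. c *\<^sub>R x)) (\<lambda>_. ennreal (c ^ DIM('a)))"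
    using lborel_affine[of c "0 :: 'a"] c by simp
  have "(\<integral>\<^sup>+z. f (inverse c *\<^sub>R z) \<partial>std_gauss) = (\<integral>\<^sup>+z. std_gauss_density z * f (inverse c *\<^sub>R z) \<partial>lborel)"
    unfolding std_gauss_def by (subst nn_integral_density) auto
  also have "\<dots> = (\<integral>\<^sup>+z. std_gauss_density z * f (inverse c *\<^sub>R z)
      \<partial>density (distr lborel borel (\<lambda>x. c *\<^sub>R x)) (\<lambda>_. ennreal (c ^ DIM('a))))"
    by (simp only: l[symmetric])
  also have "\<dots> = ennreal (c ^ DIM('a)) * (\<integral>\<^sup>+t. f t * std_gauss_density (c *\<^sub>R t) \<partial>lborel)"
    using c by (subst nn_integral_density) (auto simp: nn_integral_distr nn_integral_cmult mult.commute)
  finally show ?thesis .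
qed

text \<open>The joint density of \<open>u\<close> and \<open>t = z / sqrt u\<close> for chi-square \<open>u\<close> and standard Gaussian \<open>z\<close>.\<close>

definition t_weight :: "nat \<Rightarrow> real \<Rightarrow> 'a::euclidean_space \<Rightarrow> real" where
  "t_weight d u t = chi_square_density d u * sqrt u ^ DIM('a) * std_gauss_density (sqrt u *\<^sub>R t)"

lemma t_weight_measurable [measurable (raw)]:
  assumes [measurable]: "u \<in> borel_measurable M" "t \<in> borel_measurable M"
  shows "(\<lambda>x. t_weight d (u x) (t x)) \<in> borel_measurable M"
  unfolding t_weight_def by measurable

lemma chi_square_density_nonneg: "0 < d \<Longrightarrow> 0 \<le> chi_square_density d u"
  by (simp add: chi_square_density_def Gamma_real_pos less_imp_le)

lemma nn_integral_t_weight: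
  fixes f :: "'a::euclidean_space \<Rightarrow> ennreal"
  assumes d: "0 < d" and [measurable]: "f \<in> borel_measurable borel"
  shows "(\<integral>\<^sup>+u. \<integral>\<^sup>+z. f (inverse (sqrt u) *\<^sub>R z) \<partial>std_gauss \<partial>density lborel (chi_square_density d)) =
    (\<integral>\<^sup>+t. f t * (\<integral>\<^sup>+u. t_weight d u t \<partial>lborel) \<partial>lborel)"
proof -
  interpret g: prob_space "std_gauss :: 'a measure" by (rule prob_space_std_gauss)
  have "(\<integral>\<^sup>+u. \<integral>\<^sup>+z. f (inverse (sqrt u) *\<^sub>R z) \<partial>std_gauss \<partial>density lborel (chi_square_density d)) =
    (\<integral>\<^sup>+u. chi_square_density d u * (\<integral>\<^sup>+z. f (inverse (sqrt u) *\<^sub>R z) \<partial>std_gauss) \<partial>lborel)"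
    by (subst nn_integral_density) auto
  also have "\<dots> = (\<integral>\<^sup>+u. \<integral>\<^sup>+t. f t * t_weight d u t \<partial>lborel \<partial>lborel)"
  proof (rule nn_integral_cong)
    fix u :: real
    show "chi_square_density d u * (\<integral>\<^sup>+z. f (inverse (sqrt u) *\<^sub>R z) \<partial>std_gauss) = (\<integral>\<^sup>+t. f t * t_weight d u t \<partial>lborel)"
    proof (cases "u > 0")
      case True
      then have "ennreal (t_weight d u t) =
          ennreal (chi_square_density d u) * ennreal (sqrt u ^ DIM('a)) * ennreal (std_gauss_density (sqrt u *\<^sub>R t))"
        for t :: 'a
        using chi_square_density_nonneg[OF d, of u]
        by (simp add: t_weight_def ennreal_mult std_gauss_density_pos[THEN less_imp_le])
      then show ?thesis
        using True by (simp add: nn_integral_std_gauss_unscale nn_integral_cmult[symmetric] mult_ac)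
    qed (simp add: chi_square_density_def t_weight_def)
  qed
  also have "\<dots> = (\<integral>\<^sup>+t. \<integral>\<^sup>+u. f t * t_weight d u t \<partial>lborel \<partial>lborel)"
    by (rule lborel_pair.Fubini'[symmetric]) measurable
  also have "\<dots> = (\<integral>\<^sup>+t. f t * (\<integral>\<^sup>+u. t_weight d u t \<partial>lborel) \<partial>lborel)"
    by (simp add: nn_integral_cmult)
  finally show ?thesis .
qed

text \<open>Substitute \<open>u = r\<^sup>2 v\<close>. The Jacobian \<open>r\<^sup>2\<close> and the
  power of \<open>u\<close> in the chi-square density give \<open>r ^ d\<close>, the factor
  \<open>sqrt u ^ DIM('a)\<close> gives \<open>r ^ DIM('a)\<close>, and the exponentials merge
  because \<open>r\<^sup>2 (1 + |t|\<^sup>2) = 1\<close>.\<close>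

lemma t_weight_scaling:
  fixes t :: "'a::euclidean_space"
  assumes d: "0 < d"
  defines "r \<equiv> inverse (sqrt (1 + (norm t)\<^sup>2))"
  shows "(\<integral>\<^sup>+u. t_weight d u t \<partial>lborel) =
    ennreal (r ^ (d + DIM('a))) * (\<integral>\<^sup>+u. t_weight d u (0::'a) \<partial>lborel)"
proof -
  have r: "r > 0" "r\<^sup>2 * (1 + (norm t)\<^sup>2) = 1"
    by (auto simp: r_def power_inverse add_pos_nonneg add_nonneg_eq_0_iff)
  have w: "r\<^sup>2 * t_weight d (r\<^sup>2 * v) t = r ^ (d + DIM('a)) * t_weight d v (0::'a)" for v
  proof (cases "v > 0")
    case True
    have e: "exp (- (r\<^sup>2 * v) / 2) * exp (- (norm (sqrt (r\<^sup>2 * v) *\<^sub>R t))\<^sup>2 / 2) = exp (- v / 2)"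
    proof -
      have "r\<^sup>2 * v + r\<^sup>2 * v * (norm t)\<^sup>2 = v"
        using arg_cong[OF r(2), of "\<lambda>x. x * v"] by (simp add: algebra_simps)
      moreover have "(norm (sqrt (r\<^sup>2 * v) *\<^sub>R t))\<^sup>2 = r\<^sup>2 * v * (norm t)\<^sup>2"
        using True by (simp add: power_mult_distrib)
      ultimately have "- (r\<^sup>2 * v) / 2 + - (norm (sqrt (r\<^sup>2 * v) *\<^sub>R t))\<^sup>2 / 2 = - v / 2" by linarith
      then show ?thesis by (metis exp_add)
    qed
    have p: "r\<^sup>2 * (r\<^sup>2 * v) powr (real d / 2 - 1) = r ^ d * v powr (real d / 2 - 1)"
    proof -
      have "r\<^sup>2 * (r\<^sup>2) powr (real d / 2 - 1) = (r\<^sup>2) powr (real d / 2)"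
        using r(1) by (simp add: powr_diff)
      also have "\<dots> = (r powr 2) powr (real d / 2)"
        using r(1) by simp
      also have "\<dots> = r ^ d"
        unfolding powr_powr using powr_realpow[OF r(1), of d] by simp
      finally show ?thesis
        using r(1) True by (simp add: powr_mult mult.assoc[symmetric])
    qed
    have q: "sqrt (r\<^sup>2 * v) = r * sqrt v" using r(1) by (simp add: real_sqrt_mult)
    have "r\<^sup>2 * t_weight d (r\<^sup>2 * v) t =
       (r\<^sup>2 * (r\<^sup>2 * v) powr (real d / 2 - 1)) * sqrt (r\<^sup>2 * v) ^ DIM('a)
       * (exp (- (r\<^sup>2 * v) / 2) * exp (- (norm (sqrt (r\<^sup>2 * v) *\<^sub>R t))\<^sup>2 / 2))
       / (2 powr (real d / 2) * Gamma (real d / 2)) / sqrt (2 * pi) ^ DIM('a)"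
      using True r(1) mult_pos_pos[of "r\<^sup>2" v]
      by (simp add: t_weight_def chi_square_density_def std_gauss_density_def mult_ac not_le[symmetric])
    also have "\<dots> = r ^ (d + DIM('a)) * t_weight d v (0::'a)"
      unfolding p e unfolding q using True
      by (simp add: t_weight_def chi_square_density_def std_gauss_density_def power_mult_distrib power_add mult_ac)
    finally show ?thesis .
  next
    case False
    then have "r\<^sup>2 * v \<le> 0" by (simp add: mult_nonneg_nonpos)
    with False show ?thesis by (simp add: t_weight_def chi_square_density_def)
  qed
  have "(\<integral>\<^sup>+u. t_weight d u t \<partial>lborel) = ennreal (r\<^sup>2) * (\<integral>\<^sup>+v. t_weight d (r\<^sup>2 * v) t \<partial>lborel)"
    using nn_integral_real_affine[of "\<lambda>u. ennreal (t_weight d u t)" "r\<^sup>2" 0] r(1) by simp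
  also have "\<dots> = (\<integral>\<^sup>+v. ennreal (r\<^sup>2 * t_weight d (r\<^sup>2 * v) t) \<partial>lborel)"
    by (simp add: nn_integral_cmult ennreal_mult')
  also have "\<dots> = ennreal (r ^ (d + DIM('a))) * (\<integral>\<^sup>+u. t_weight d u (0::'a) \<partial>lborel)"
    unfolding w using r(1) by (simp add: nn_integral_cmult ennreal_mult')
  finally show ?thesis .
qed

text \<open>Both laws have densities proportional to \<open>(1 + |t|\<^sup>2) powr (-(k + 1) / 2)\<close>, a
  multivariate Student density; total mass 1 makes the two constants equal.\<close>

lemma nn_integral_pinv_std_gauss:
  fixes f :: "real^'p \<Rightarrow> ennreal"
  assumes pk: "CARD('p) \<le> CARD('k)" and d: "d = CARD('k) - CARD('p) + 1"
    and prob: "prob_space (density lborel (chi_square_density d))"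
    and [measurable]: "f \<in> borel_measurable borel"
  shows "(\<integral>\<^sup>+A. \<integral>\<^sup>+w. f (pinv A w) \<partial>std_gauss \<partial>(std_gauss :: (real^'p^'k) measure)) =
    (\<integral>\<^sup>+u. \<integral>\<^sup>+z. f (inverse (sqrt u) *\<^sub>R z) \<partial>std_gauss \<partial>density lborel (chi_square_density d))"
proof -
  have d0: "0 < d" and dk: "d + CARD('p) = CARD('k) + 1" using d pk by auto
  interpret c: prob_space "density lborel (chi_square_density d)" by fact
  interpret p: prob_space "std_gauss :: (real^'p) measure" by (rule prob_space_std_gauss)
  interpret k: prob_space "std_gauss :: (real^'k) measure" by (rule prob_space_std_gauss)
  interpret kp: prob_space "std_gauss :: (real^'p^'k) measure" by (rule prob_space_std_gauss)
  define r :: "real^'p \<Rightarrow> ennreal" where "r t = ennreal (inverse (sqrt (1 + (norm t)\<^sup>2)) ^ (CARD('k) + 1))" for t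
  have [measurable]: "r \<in> borel_measurable borel" unfolding r_def by measurable
  define h where "h = (\<integral>\<^sup>+A. joint_weight (A :: real^'p^'k) 0 \<partial>lborel)"
  define g where "g = (\<integral>\<^sup>+u. t_weight d u (0::real^'p) \<partial>lborel)"
  have h: "(\<integral>\<^sup>+A. joint_weight (A :: real^'p^'k) t \<partial>lborel) = r t * h" for t
    unfolding r_def h_def by (rule joint_weight_scaling)
  have g: "(\<integral>\<^sup>+u. t_weight d u t \<partial>lborel) = r t * g" for t
    using t_weight_scaling[OF d0, of t] unfolding r_def g_def by (simp add: dk)
  have H: "(\<integral>\<^sup>+A. \<integral>\<^sup>+w. F (pinv A w) \<partial>std_gauss \<partial>(std_gauss :: (real^'p^'k) measure)) =
      h * (\<integral>\<^sup>+t. F t * r t \<partial>lborel)" if [measurable]: "F \<in> borel_measurable borel" for F :: "real^'p \<Rightarrow> ennreal"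
    unfolding nn_integral_pinv_joint_weight[OF pk that] h
    by (simp add: nn_integral_cmult[symmetric] mult_ac)
  have G: "(\<integral>\<^sup>+u. \<integral>\<^sup>+z. F (inverse (sqrt u) *\<^sub>R z) \<partial>std_gauss \<partial>density lborel (chi_square_density d)) =
      g * (\<integral>\<^sup>+t. F t * r t \<partial>lborel)" if [measurable]: "F \<in> borel_measurable borel" for F :: "real^'p \<Rightarrow> ennreal"
    unfolding nn_integral_t_weight[OF d0 that] g
    by (simp add: nn_integral_cmult[symmetric] mult_ac)
  define K where "K = (\<integral>\<^sup>+t. r t \<partial>lborel)"
  \<comment> \<open>Both identities are tested with the constant function 1. Then \<open>h\<close>
    and \<open>g\<close> are inverses of the same \<open>K\<close>, which forces equality in any
    commutative monoid, in particular in \<open>ennreal\<close>.\<close>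
  have "h * K = 1"
    using H[of "\<lambda>_. 1"] by (simp add: K_def k.emeasure_space_1[simplified] kp.emeasure_space_1[simplified])
  moreover have "g * K = 1"
    using G[of "\<lambda>_. 1"] c.emeasure_space_1 by (simp add: K_def p.emeasure_space_1[simplified])
  ultimately have "h = g"
    by (metis mult.assoc mult.commute mult.right_neutral)
  then show ?thesis by (simp add: H G)
qed

subsection \<open>Splitting off the squared norm of a coordinate block\<close>

text \<open>The density belonging to the distribution function \<open>x powr m\<close>; it turns
  homogeneity of a measure into a formula for its density.\<close>

lemma nn_integral_powr_atMost:
  assumes m: "0 < m" and x: "0 \<le> x"
  shows "(\<integral>\<^sup>+u. ennreal (if 0 < u then m * u powr (m - 1) else 0) * indicator {..x} u \<partial>lborel) = ennreal (x powr m)"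
proof -
  have "((\<lambda>u. m * u powr (m - 1)) has_integral m * (x powr (m - 1 + 1) / (m - 1 + 1))) {0..x}"
    using m x by (intro has_integral_mult_right has_integral_powr_from_0) auto
  then have "(\<integral>\<^sup>+u. ennreal (indicator {0..x} u * (m * u powr (m - 1))) \<partial>lborel) = ennreal (x powr m)"
    using m by (subst nn_integral_has_integral_lebesgue[where I="x powr m"]) auto
  then show ?thesis
    by (subst (asm) nn_integral_cong[where v="\<lambda>u. ennreal (if 0 < u then m * u powr (m - 1) else 0) * indicator {..x} u"])
      (auto simp: indicator_def)
qed

text \<open>Half-lines form an intersection-stable generator. Finiteness is asked on each half-line
  because the measure of interest may have infinite total mass.\<close>

lemma measure_eqI_atMost:
  fixes M N :: "real measure"
  assumes "sets M = sets borel" "sets N = sets borel"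
    and eq: "\<And>x. emeasure M {..x} = emeasure N {..x}" and fin: "\<And>x. emeasure M {..x} \<noteq> \<infinity>"
  shows "M = N"
proof (rule measure_eqI_generator_eq[where E="range atMost" and \<Omega>=UNIV and A="\<lambda>i::nat. {..real i}"])
  show "Int_stable (range (atMost :: real \<Rightarrow> real set))"
    by (auto simp: Int_stable_def)
  show "sets M = sigma_sets UNIV (range atMost)" "sets N = sigma_sets UNIV (range atMost)"
    using assms(1,2) by (simp_all add: borel_eq_atMost)
  show "(\<Union>i. {..real i}) = UNIV" using real_arch_simple by auto
qed (use eq fin in auto)

text \<open>With \<open>B\<close> fixed, the Lebesgue-type measure of \<open>{|z\<^sub>2|\<^sup>2 \<le> x, z\<^sub>1 \<in> B}\<close>, weighted by the
  Gaussian density of \<open>z\<^sub>1\<close> only, is homogeneous of degree \<open>m / 2\<close> in \<open>x\<close>; this determines the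
  law of \<open>|z\<^sub>2|\<^sup>2\<close> and its independence of \<open>z\<^sub>1\<close> without polar coordinates.\<close>

lemma distr_std_gauss_split:
  fixes e :: "'p::finite \<Rightarrow> 'n::finite"
  assumes e: "inj e" and m: "m = CARD('n) - CARD('p)" "0 < m"
    and prob: "prob_space (density lborel (chi_square_density m))"
  shows "distr (std_gauss :: (real^'n) measure) (borel \<Otimes>\<^sub>M borel)
      (\<lambda>x. ((\<chi> a. x $ e a) :: real^'p, \<Sum>j\<in>- range e. (x $ j)\<^sup>2)) =
    std_gauss \<Otimes>\<^sub>M density lborel (chi_square_density m)"
proof (rule pair_measure_eqI[symmetric])
  interpret c: prob_space "density lborel (chi_square_density m)" by fact
  interpret p: prob_space "std_gauss :: (real^'p) measure" by (rule prob_space_std_gauss)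
  interpret n: prob_space "std_gauss :: (real^'n) measure" by (rule prob_space_std_gauss)
  show "sigma_finite_measure (std_gauss :: (real^'p) measure)"
    "sigma_finite_measure (density lborel (chi_square_density m))" by unfold_locales
  define P :: "real^'n \<Rightarrow> real^'p" where "P x = (\<chi> a. x $ e a)" for x
  define R :: "real^'n \<Rightarrow> real" where "R x = (\<Sum>j\<in>- range e. (x $ j)\<^sup>2)" for x
  define w :: "real^'n \<Rightarrow> real" where "w x = exp (- (norm (P x))\<^sup>2 / 2) / sqrt (2 * pi) ^ CARD('n)" for x
  have [measurable]: "P \<in> borel_measurable borel" "R \<in> borel_measurable borel" "w \<in> borel_measurable borel"
    unfolding P_def R_def w_def by measurable
  have norms: "(norm x)\<^sup>2 = (norm (P x))\<^sup>2 + R x" for x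
  proof -
    have "(norm x)\<^sup>2 = (\<Sum>j\<in>UNIV. (x $ j)\<^sup>2)"
      unfolding power2_norm_eq_inner inner_vec_def by (simp add: power2_eq_square)
    also have "\<dots> = (\<Sum>j\<in>range e. (x $ j)\<^sup>2) + R x"
      unfolding R_def Compl_eq_Diff_UNIV by (subst add.commute, rule sum.subset_diff) auto
    also have "(\<Sum>j\<in>range e. (x $ j)\<^sup>2) = (norm (P x))\<^sup>2"
      unfolding power2_norm_eq_inner inner_vec_def
      by (simp add: P_def sum.reindex[OF e] power2_eq_square)
    finally show ?thesis .
  qed
  have sd: "std_gauss_density x = w x * exp (- R x / 2)" for x
    unfolding std_gauss_density_def norms by (simp add: w_def exp_add[symmetric] add_divide_distrib)
  have w0: "0 \<le> w x" for x by (simp add: w_def)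
  have R0: "0 \<le> R x" for x by (simp add: R_def sum_nonneg)
  have card: "card (- range e) = m"
    by (simp add: Compl_eq_Diff_UNIV card_Diff_subset card_image[OF e] m)
  let ?C = "(\<lambda>j. axis j 1) ` (- range e) :: (real^'n) set"
  have C: "?C \<subseteq> Basis" "card ?C = m"
    by (auto simp: Basis_vec_def card[symmetric] inj_on_def axis_eq_axis intro!: card_image)
  have scale: "(\<Sum>b\<in>Basis. ((if b \<in> ?C then s else 1) * (x \<bullet> b)) *\<^sub>R b) $ j
      = (if j \<in> range e then 1 else s) * x $ j" for s and x :: "real^'n" and j
  proof -
    have "(\<Sum>b\<in>Basis. ((if b \<in> ?C then s else 1) * (x \<bullet> b)) *\<^sub>R b) \<bullet> axis j 1 = (if axis j 1 \<in> ?C then s else 1) * (x \<bullet> axis j 1)"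
      by (subst inner_sum_left_Basis) (auto simp: Basis_vec_def)
    moreover have "(axis j 1 \<in> ?C) = (j \<notin> range e)" by (auto simp: axis_eq_axis)
    ultimately show ?thesis by (simp add: inner_axis)
  qed
  have main: "\<exists>a. \<forall>D\<in>sets borel. emeasure std_gauss {x. P x \<in> B \<and> R x \<in> D}
       = a * emeasure (density lborel (chi_square_density m)) D"
    if [measurable]: "B \<in> sets borel" for B
  proof -
    define \<nu> where "\<nu> = distr (density lborel (\<lambda>x. ennreal (w x) * indicator B (P x))) borel R"
    have sets_\<nu> [simp, measurable_cong]: "sets \<nu> = sets borel" by (simp add: \<nu>_def)
    have nu: "(\<integral>\<^sup>+u. g u \<partial>\<nu>) = (\<integral>\<^sup>+x. ennreal (w x) * indicator B (P x) * g (R x) \<partial>lborel)"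
      if [measurable]: "g \<in> borel_measurable borel" for g
      unfolding \<nu>_def by (simp add: nn_integral_distr nn_integral_density)
    have nu_le: "emeasure \<nu> {..x} = (\<integral>\<^sup>+y. ennreal (w y) * indicator B (P y) * indicator {..x} (R y) \<partial>lborel)" for x
      using nu[of "indicator {..x}"] by simp
    \<comment> \<open>Scaling the unselected coordinates by \<open>s\<close> fixes \<open>P\<close>
      and \<open>w\<close>, multiplies \<open>R\<close> by \<open>s\<^sup>2\<close> and has Jacobian
      \<open>s ^ m\<close>.\<close>
    have sc: "emeasure \<nu> {..s\<^sup>2 * x} = ennreal (s ^ m) * emeasure \<nu> {..x}" if "s > 0" for s x
    proof -
      let ?T = "\<lambda>x :: real^'n. \<Sum>b\<in>Basis. ((if b \<in> ?C then s else 1) * (x \<bullet> b)) *\<^sub>R b"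
      have PT: "P (?T y) = P y" for y unfolding P_def scale by simp
      have RT: "R (?T y) = s\<^sup>2 * R y" for y
        unfolding R_def scale by (simp add: power_mult_distrib sum_distrib_left)
      have ind: "indicator {..s\<^sup>2 * x} (s\<^sup>2 * R y) = (indicator {..x} (R y) :: ennreal)" for y
        using that by (simp add: indicator_def)
      have wT: "w (?T y) = w y" for y by (simp add: w_def PT)
      show ?thesis
        unfolding nu_le C(2)[symmetric]
        using nn_integral_lborel_scale_coordinates[OF C(1) that, of "\<lambda>y. ennreal (w y) * indicator B (P y) * indicator {..s\<^sup>2 * x} (R y)"]
        unfolding PT RT ind wT by simp
    qed
    \<comment> \<open>Where \<open>R y \<le> x\<close>, the weight is at most
      \<open>exp (x / 2)\<close> times the full Gaussian density.\<close>
    have fin: "emeasure \<nu> {..x} \<noteq> \<infinity>" for x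
    proof -
      have "emeasure \<nu> {..x} \<le> (\<integral>\<^sup>+y. ennreal (exp (x / 2)) * std_gauss_density (y :: real^'n) \<partial>lborel)"
        unfolding nu_le
      proof (rule nn_integral_mono)
        fix y :: "real^'n"
        show "ennreal (w y) * indicator B (P y) * indicator {..x} (R y) \<le> ennreal (exp (x / 2)) * ennreal (std_gauss_density y)"
        proof (cases "R y \<le> x")
          case True
          then have "w y \<le> exp (x / 2) * (w y * exp (- R y / 2))"
            using w0[of y] by (simp add: mult_left_le_one_le exp_add[symmetric] mult.left_commute mult_le_cancel_left1 not_less)
          then show ?thesis
            by (auto simp: indicator_def sd ennreal_mult'[symmetric] intro!: ennreal_leI)
        qed simp
      qed
      also have "\<dots> = ennreal (exp (x / 2))"
        using n.emeasure_space_1 by (simp add: nn_integral_cmult std_gauss_def emeasure_density)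
      finally show ?thesis by (auto simp: top_unique)
    qed
    define a where "a = emeasure \<nu> {..1}"
    define q where "q u = (if 0 < u then (m / 2) * u powr (m / 2 - 1) else 0)" for u :: real
    have [measurable]: "q \<in> borel_measurable borel" unfolding q_def by measurable
    have pos: "emeasure \<nu> {..x} = a * ennreal (x powr (m / 2))" if "0 < x" for x
    proof -
      have "sqrt x ^ m = x powr (m / 2)"
        using that powr_realpow[of "sqrt x" m] by (simp add: powr_half_sqrt[symmetric] powr_powr)
      then show ?thesis using sc[of "sqrt x" 1] that by (simp add: a_def mult.commute)
    qed
    \<comment> \<open>Homogeneity with \<open>s = 2\<close> gives the same half-line
      \<open>2 ^ m\<close> times its own mass; a finite mass with this property is 0, as
      \<open>m > 0\<close>.\<close>
    have zero: "emeasure \<nu> {..0} = 0"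
    proof (rule ccontr)
      assume "emeasure \<nu> {..0} \<noteq> 0"
      moreover have "emeasure \<nu> {..0} = ennreal (2 ^ m) * emeasure \<nu> {..0}" using sc[of 2 0] by simp
      ultimately have "ennreal (2 ^ m) = 1"
        using fin[of 0] by (metis ennreal_mult_cancel_left infinity_ennreal_def mult.commute mult.right_neutral)
      then show False using one_less_power[of "2::real" m] m(2) by simp
    qed
    have neg: "emeasure \<nu> {..x} = 0" if "x \<le> 0" for x
      using zero emeasure_mono[of "{..x}" "{..0}" \<nu>] that by auto
    have "\<nu> = density lborel (\<lambda>u. a * ennreal (q u))"
    proof (rule measure_eqI_atMost)
      fix x
      show "emeasure \<nu> {..x} = emeasure (density lborel (\<lambda>u. a * ennreal (q u))) {..x}"
      proof (cases "0 < x")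
        case True
        then show ?thesis
          using nn_integral_powr_atMost[of "m / 2" x] m(2)
          by (simp add: pos emeasure_density q_def[symmetric] nn_integral_cmult mult.assoc)
      next
        case False
        then have "(\<integral>\<^sup>+u. a * ennreal (q u) * indicator {..x} u \<partial>lborel) = (\<integral>\<^sup>+u. 0 \<partial>(lborel :: real measure))"
          by (intro nn_integral_cong) (auto simp: q_def indicator_def)
        then show ?thesis using False by (simp add: neg emeasure_density)
      qed
    qed (use fin in auto)
    then have nu': "(\<integral>\<^sup>+u. g u \<partial>\<nu>) = a * (\<integral>\<^sup>+u. ennreal (q u) * g u \<partial>lborel)"
      if [measurable]: "g \<in> borel_measurable borel" for g
      by (simp add: nn_integral_density nn_integral_cmult mult.assoc)
    \<comment> \<open>The factor \<open>m / 2\<close> comes from differentiating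
      \<open>u powr (m / 2)\<close>, the rest is the normalizing constant of the chi-square
      density.\<close>
    define K where "K = m / 2 * (2 powr (m / 2) * Gamma (m / 2))"
    have Gpos: "0 < Gamma (real m / 2)" using m(2) by (intro Gamma_real_pos) simp
    have K: "q u * exp (- u / 2) = K * chi_square_density m u" for u
      using m(2) Gpos[THEN less_imp_neq] by (simp add: q_def K_def chi_square_density_def)
    have K0: "0 \<le> K" using m(2) Gpos by (simp add: K_def less_imp_le)
    have q0: "0 \<le> q u" for u by (simp add: q_def)
    show ?thesis
    proof (intro exI ballI)
      fix D :: "real set" assume [measurable]: "D \<in> sets borel"
      have [measurable]: "{x. P x \<in> B \<and> R x \<in> D} \<in> sets borel" by measurable
      have "emeasure std_gauss {x. P x \<in> B \<and> R x \<in> D}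
        = (\<integral>\<^sup>+x. ennreal (std_gauss_density x) * indicator {x. P x \<in> B \<and> R x \<in> D} x \<partial>lborel)"
        by (simp add: std_gauss_def emeasure_density)
      also have "\<dots> = (\<integral>\<^sup>+x. ennreal (w x) * indicator B (P x) * (ennreal (exp (- R x / 2)) * indicator D (R x)) \<partial>lborel)"
        by (intro nn_integral_cong) (auto simp: sd indicator_def ennreal_mult' w0)
      also have "\<dots> = (\<integral>\<^sup>+u. ennreal (exp (- u / 2)) * indicator D u \<partial>\<nu>)"
        by (rule nu[symmetric]) measurable
      also have "\<dots> = a * (\<integral>\<^sup>+u. ennreal (q u) * (ennreal (exp (- u / 2)) * indicator D u) \<partial>lborel)"
        by (rule nu') measurable
      also have "(\<lambda>u. ennreal (q u) * (ennreal (exp (- u / 2)) * indicator D u))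
          = (\<lambda>u. ennreal K * (ennreal (chi_square_density m u) * indicator D u))"
        unfolding mult.assoc[symmetric] ennreal_mult'[OF q0, symmetric] ennreal_mult'[OF K0, symmetric] K ..
      also have "(\<integral>\<^sup>+u. \<dots> u \<partial>lborel) = ennreal K * emeasure (density lborel (chi_square_density m)) D"
        by (simp add: nn_integral_cmult emeasure_density)
      finally show "emeasure std_gauss {x. P x \<in> B \<and> R x \<in> D}
        = (a * ennreal K) * emeasure (density lborel (chi_square_density m)) D"
        by (simp add: mult.assoc)
    qed
  qed
  fix B :: "(real^'p) set" and D :: "real set"
  assume "B \<in> sets std_gauss" "D \<in> sets (density lborel (chi_square_density m))"
  then have [measurable]: "B \<in> sets borel" "D \<in> sets borel" by auto
  obtain a where a: "\<And>D. D \<in> sets borel \<Longrightarrow> emeasure std_gauss {x. P x \<in> B \<and> R x \<in> D}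
       = a * emeasure (density lborel (chi_square_density m)) D"
    using main[of B] by auto
  \<comment> \<open>The constant is identified by taking \<open>D = UNIV\<close>: the chi-square law
    has mass one, and only the law of \<open>P\<close> remains.\<close>
  have "emeasure std_gauss B = (\<integral>\<^sup>+z. indicator B z \<partial>(std_gauss :: (real^'p) measure))" by simp
  also have "\<dots> = (\<integral>\<^sup>+x. indicator B (P x) \<partial>std_gauss)"
    unfolding P_def by (rule nn_integral_std_gauss_vec_coordinates[OF e, symmetric]) measurable
  also have "\<dots> = (\<integral>\<^sup>+x. indicator {x. P x \<in> B} x \<partial>std_gauss)"
    by (intro nn_integral_cong) (auto simp: indicator_def)
  also have "\<dots> = a"
    using a[of UNIV] c.emeasure_space_1 by simp
  finally have "a = emeasure std_gauss B" ..
  then show "emeasure std_gauss B * emeasure (density lborel (chi_square_density m)) D =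
    emeasure (distr std_gauss (borel \<Otimes>\<^sub>M borel) (\<lambda>x. ((\<chi> a. x $ e a) :: real^'p, \<Sum>j\<in>- range e. (x $ j)\<^sup>2))) (B \<times> D)"
    using a[of D] by (subst emeasure_distr) (auto simp: P_def R_def vimage_def)
qed (simp cong: sets_pair_measure_cong)

subsection \<open>The law of the sketched noise\<close>

lemma AE_chi_square_pos: "AE u in density lborel (chi_square_density d). 0 < u"
  by (subst AE_density) (auto simp: chi_square_density_def intro!: AE_I2)

lemma nn_integral_pinv_coordinates:
  fixes e :: "'p::finite \<Rightarrow> 'n::finite" and F :: "real^'p \<Rightarrow> ennreal"
  assumes e: "inj e" and pn: "CARD('p) < CARD('n)" and pk: "CARD('p) \<le> CARD('k::finite)"
    and m: "m = CARD('n) - CARD('p)" and d: "d = CARD('k) - CARD('p) + 1"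
    and probm: "prob_space (density lborel (chi_square_density m))"
    and probd: "prob_space (density lborel (chi_square_density d))"
    and [measurable]: "F \<in> borel_measurable borel"
  shows "(\<integral>\<^sup>+\<epsilon>. \<integral>\<^sup>+S. F (pinv (\<chi> i a. S $ i $ e a) (S *v \<epsilon>)) \<partial>(std_gauss :: (real^'n^'k) measure) \<partial>std_gauss) =
    (\<integral>\<^sup>+v. \<integral>\<^sup>+u. \<integral>\<^sup>+z. F (sqrt (1 + v / u) *\<^sub>R z) \<partial>std_gauss
      \<partial>density lborel (chi_square_density d) \<partial>density lborel (chi_square_density m))"
proof -
  let ?Cm = "density lborel (chi_square_density m)" and ?Cd = "density lborel (chi_square_density d)"
  interpret cm: prob_space ?Cm by fact
  interpret cd: prob_space ?Cd by fact
  interpret p: prob_space "std_gauss :: (real^'p) measure" by (rule prob_space_std_gauss)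
  interpret k: prob_space "std_gauss :: (real^'k) measure" by (rule prob_space_std_gauss)
  interpret pm: pair_sigma_finite "std_gauss :: (real^'p) measure" ?Cm ..
  interpret pd: pair_sigma_finite "std_gauss :: (real^'p) measure" ?Cd ..
  have m0: "0 < m" using pn m by simp
  have "range e \<noteq> UNIV"
    using card_image[OF e] pn by (metis less_irrefl)
  then obtain j where j: "j \<notin> range e" by auto
  define P :: "real^'n \<Rightarrow> real^'p" where "P x = (\<chi> a. x $ e a)" for x
  define R :: "real^'n \<Rightarrow> real" where "R x = (\<Sum>j\<in>- range e. (x $ j)\<^sup>2)" for x
  \<comment> \<open>For fixed noise the integral over \<open>S\<close> depends only on the selected
    coordinates of the noise and the squared norm of the others, so the joint law of this pair
    suffices.\<close>
  define G where "G z1 v = (\<integral>\<^sup>+u. \<integral>\<^sup>+z. F (z1 + (sqrt v * inverse (sqrt u)) *\<^sub>R z) \<partial>std_gauss \<partial>?Cd)" for z1 v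
  have Gm [measurable]: "case_prod G \<in> borel_measurable (borel \<Otimes>\<^sub>M borel)"
    unfolding G_def by measurable
  have inner: "(\<integral>\<^sup>+S. F (pinv (\<chi> i a. S $ i $ e a) (S *v \<epsilon>)) \<partial>(std_gauss :: (real^'n^'k) measure)) = G (P \<epsilon>) (R \<epsilon>)" for \<epsilon>
  proof -
    define y :: "real^'n" where "y = (\<chi> j. if j \<in> range e then 0 else \<epsilon> $ j)"
    have nz: "norm y = sqrt (R \<epsilon>)"
    proof -
      have "(norm y)\<^sup>2 = (\<Sum>j\<in>UNIV. if j \<in> - range e then (\<epsilon> $ j)\<^sup>2 else 0)"
        unfolding power2_norm_eq_inner inner_vec_def
        by (intro sum.cong) (auto simp: y_def power2_eq_square)
      also have "\<dots> = R \<epsilon>" unfolding R_def by (simp add: sum.If_cases Compl_eq)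
      finally show ?thesis by (metis norm_ge_zero real_sqrt_unique)
    qed
    have dec: "S *v \<epsilon> = (\<chi> i a. S $ i $ e a) *v P \<epsilon> + S *v y" for S :: "real^'n^'k"
    proof -
      have "(S *v \<epsilon>) $ i = ((\<chi> i a. S $ i $ e a) *v P \<epsilon> + S *v y) $ i" for i
      proof -
        have "(S *v \<epsilon>) $ i = (\<Sum>j\<in>UNIV. (if j \<in> range e then S $ i $ j * \<epsilon> $ j else 0) + S $ i $ j * y $ j)"
          unfolding matrix_vector_mult_def vec_lambda_beta
          by (intro sum.cong) (auto simp: y_def)
        also have "\<dots> = (\<Sum>j\<in>range e. S $ i $ j * \<epsilon> $ j) + (S *v y) $ i"
          by (simp add: sum.distrib sum.If_cases matrix_vector_mult_def)
        also have "(\<Sum>j\<in>range e. S $ i $ j * \<epsilon> $ j) = ((\<chi> i a. S $ i $ e a) *v P \<epsilon>) $ i"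
          by (simp add: sum.reindex[OF e] matrix_vector_mult_def P_def)
        finally show ?thesis by simp
      qed
      then show ?thesis by (simp add: vec_eq_iff)
    qed
    have "(\<integral>\<^sup>+S. F (pinv (\<chi> i a. S $ i $ e a) (S *v \<epsilon>)) \<partial>(std_gauss :: (real^'n^'k) measure))
      = (\<integral>\<^sup>+A. \<integral>\<^sup>+w. F (pinv A (A *v P \<epsilon> + norm y *\<^sub>R w)) \<partial>std_gauss \<partial>(std_gauss :: (real^'p^'k) measure))"
      unfolding dec
      using nn_integral_std_gauss_columns_combination[OF e j, of y "\<lambda>(A :: real^'p^'k, w). F (pinv A (A *v P \<epsilon> + w))"]
      by (simp add: y_def borel_prod[symmetric])
    also have "\<dots> = (\<integral>\<^sup>+A. \<integral>\<^sup>+w. F (P \<epsilon> + norm y *\<^sub>R pinv A w) \<partial>std_gauss \<partial>(std_gauss :: (real^'p^'k) measure))"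
    proof (rule nn_integral_cong_AE)
      have "AE A in std_gauss. det (transpose A ** (A :: real^'p^'k)) \<noteq> 0"
        unfolding std_gauss_def using AE_full_column_rank[OF pk] by (subst AE_density) auto
      then show "AE A in std_gauss. (\<integral>\<^sup>+w. F (pinv A (A *v P \<epsilon> + norm y *\<^sub>R w)) \<partial>std_gauss)
          = (\<integral>\<^sup>+w. F (P \<epsilon> + norm y *\<^sub>R pinv (A :: real^'p^'k) w) \<partial>std_gauss)"
        by eventually_elim (simp add: pinv_add pinv_scaleR pinv_mult_vector)
    qed
    also have "\<dots> = G (P \<epsilon>) (R \<epsilon>)"
      using nn_integral_pinv_std_gauss[OF pk d probd, of "\<lambda>t. F (P \<epsilon> + norm y *\<^sub>R t)"]
      by (simp add: G_def nz)
    finally show ?thesis .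
  qed
  have "(\<integral>\<^sup>+\<epsilon>. \<integral>\<^sup>+S. F (pinv (\<chi> i a. S $ i $ e a) (S *v \<epsilon>)) \<partial>(std_gauss :: (real^'n^'k) measure) \<partial>std_gauss)
     = (\<integral>\<^sup>+\<epsilon>. case_prod G (P \<epsilon>, R \<epsilon>) \<partial>std_gauss)"
    by (simp add: inner)
  also have "\<dots> = (\<integral>\<^sup>+x. case_prod G x \<partial>distr std_gauss (borel \<Otimes>\<^sub>M borel) (\<lambda>\<epsilon>. (P \<epsilon>, R \<epsilon>)))"
    unfolding P_def R_def by (subst nn_integral_distr) auto
  also have "distr std_gauss (borel \<Otimes>\<^sub>M borel) (\<lambda>\<epsilon>. (P \<epsilon>, R \<epsilon>)) = std_gauss \<Otimes>\<^sub>M ?Cm"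
    unfolding P_def R_def by (rule distr_std_gauss_split[OF e m m0 probm])
  also have "(\<integral>\<^sup>+x. case_prod G x \<partial>(std_gauss \<Otimes>\<^sub>M ?Cm)) = (\<integral>\<^sup>+v. \<integral>\<^sup>+z1. G z1 v \<partial>std_gauss \<partial>?Cm)"
    by (subst pm.nn_integral_snd[symmetric]) auto
  \<comment> \<open>With \<open>u\<close> and \<open>v\<close> held fixed outside, \<open>z1\<close>
    and \<open>z\<close> are independent Gaussian vectors and can be merged into one.\<close>
  also have "\<dots> = (\<integral>\<^sup>+v. \<integral>\<^sup>+u. \<integral>\<^sup>+z1. \<integral>\<^sup>+z. F (z1 + (sqrt v * inverse (sqrt u)) *\<^sub>R z) \<partial>std_gauss \<partial>std_gauss \<partial>?Cd \<partial>?Cm)"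
    unfolding G_def by (intro nn_integral_cong pd.Fubini'[symmetric]) measurable
  also have "\<dots> = (\<integral>\<^sup>+v. \<integral>\<^sup>+u. \<integral>\<^sup>+z. F (sqrt (1 + (sqrt v * inverse (sqrt u))\<^sup>2) *\<^sub>R z) \<partial>std_gauss \<partial>?Cd \<partial>?Cm)"
    by (simp add: nn_integral_std_gauss_sum)
  \<comment> \<open>The squared ratio of roots is simplified for positive arguments, that is, almost
    surely under the chi-square laws.\<close>
  also have "\<dots> = (\<integral>\<^sup>+v. \<integral>\<^sup>+u. \<integral>\<^sup>+z. F (sqrt (1 + v / u) *\<^sub>R z) \<partial>std_gauss \<partial>?Cd \<partial>?Cm)"
  proof (rule nn_integral_cong_AE, use AE_chi_square_pos[of m] in eventually_elim)
    fix v :: real assume "0 < v"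
    then show "(\<integral>\<^sup>+u. \<integral>\<^sup>+z. F (sqrt (1 + (sqrt v * inverse (sqrt u))\<^sup>2) *\<^sub>R z) \<partial>std_gauss \<partial>?Cd)
      = (\<integral>\<^sup>+u. \<integral>\<^sup>+z. F (sqrt (1 + v / u) *\<^sub>R z) \<partial>std_gauss \<partial>?Cd)"
      by (intro nn_integral_cong_AE, use AE_chi_square_pos[of d] in eventually_elim)
        (simp add: power_mult_distrib power_inverse divide_inverse)
  qed
  finally show ?thesis .
qed

section \<open>Passing from orthonormal columns to coordinate columns\<close>

lemma nn_integral_std_gauss_rotated:
  fixes Q :: "real^'p^'n" and W :: "real^'n^'n" and e :: "'p \<Rightarrow> 'n"
  assumes W: "orthogonal_matrix W" and We: "\<And>a. column (e a) W = column a Q"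
    and [measurable]: "case_prod H \<in> borel_measurable (borel \<Otimes>\<^sub>M borel)"
  shows "(\<integral>\<^sup>+S. H (S ** Q) (S *v \<epsilon>) \<partial>(std_gauss :: (real^'n^'k) measure)) =
    (\<integral>\<^sup>+S. H (\<chi> i a. S $ i $ e a) (S *v (transpose W *v \<epsilon>)) \<partial>(std_gauss :: (real^'n^'k) measure))"
proof -
  have "W $ j $ e a = Q $ j $ a" for j a
    using arg_cong[OF We[of a], of "\<lambda>v. v $ j"] by (simp add: column_def)
  then have SQ: "S ** Q = (\<chi> i a. (S ** W) $ i $ e a)" for S :: "real^'n^'k"
    by (simp add: matrix_matrix_mult_def)
  have SW: "S *v \<epsilon> = (S ** W) *v (transpose W *v \<epsilon>)" for S :: "real^'n^'k"
    using W by (simp add: matrix_vector_mul_assoc matrix_mul_assoc[symmetric] orthogonal_matrix_def del: transpose_matrix_vector)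
  show ?thesis
    unfolding SQ SW
    by (rule nn_integral_std_gauss_orthogonal[OF orthogonal_transformation_mult_right[OF W],
          of "\<lambda>S. H (\<chi> i a. S $ i $ e a) (S *v (transpose W *v \<epsilon>))"]) measurable
qed

text \<open>Rotating \<open>S\<close> turns \<open>S ** Q\<close> into selected columns and
  \<open>\<epsilon>\<close> into \<open>W\<^sup>T \<epsilon>\<close>; rotation invariance of the
  noise then removes \<open>W\<close>.\<close>

lemma nn_integral_pinv_orthonormal:
  fixes Q :: "real^'p^'n" and F :: "real^'p \<Rightarrow> ennreal"
  assumes Q: "transpose Q ** Q = mat 1" and pn: "CARD('p) < CARD('n)" and pk: "CARD('p) \<le> CARD('k::finite)"
    and m: "m = CARD('n) - CARD('p)" and d: "d = CARD('k) - CARD('p) + 1"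
    and probm: "prob_space (density lborel (chi_square_density m))"
    and probd: "prob_space (density lborel (chi_square_density d))"
    and [measurable]: "F \<in> borel_measurable borel"
  shows "(\<integral>\<^sup>+\<epsilon>. \<integral>\<^sup>+S. F (pinv (S ** Q) (S *v \<epsilon>)) \<partial>(std_gauss :: (real^'n^'k) measure) \<partial>std_gauss) =
    (\<integral>\<^sup>+v. \<integral>\<^sup>+u. \<integral>\<^sup>+z. F (sqrt (1 + v / u) *\<^sub>R z) \<partial>std_gauss
      \<partial>density lborel (chi_square_density d) \<partial>density lborel (chi_square_density m))"
proof -
  interpret kn: prob_space "std_gauss :: (real^'n^'k) measure" by (rule prob_space_std_gauss)
  obtain W :: "real^'n^'n" and e :: "'p \<Rightarrow> 'n"
    where W: "orthogonal_matrix W" and e: "inj e" and We: "\<And>a. column (e a) W = column a Q"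
    using orthonormal_columns_extend[OF Q] by blast
  have oW: "orthogonal_transformation ((*v) (transpose W))"
    using W by (intro orthogonal_transformation_matrix_vector_mult) (simp add: orthogonal_matrix_transpose)
  have "(\<integral>\<^sup>+\<epsilon>. \<integral>\<^sup>+S. F (pinv (S ** Q) (S *v \<epsilon>)) \<partial>(std_gauss :: (real^'n^'k) measure) \<partial>std_gauss)
    = (\<integral>\<^sup>+\<epsilon>. \<integral>\<^sup>+S. F (pinv (\<chi> i a. S $ i $ e a) (S *v (transpose W *v \<epsilon>))) \<partial>(std_gauss :: (real^'n^'k) measure) \<partial>std_gauss)"
    by (intro nn_integral_cong nn_integral_std_gauss_rotated[OF W We, of "\<lambda>A w. F (pinv A w)"]) measurable
  also have "\<dots> = (\<integral>\<^sup>+\<epsilon>. \<integral>\<^sup>+S. F (pinv (\<chi> i a. S $ i $ e a) (S *v \<epsilon>)) \<partial>(std_gauss :: (real^'n^'k) measure) \<partial>std_gauss)"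
    by (rule nn_integral_std_gauss_orthogonal[OF oW, of "\<lambda>\<epsilon>. \<integral>\<^sup>+S. F (pinv (\<chi> i a. S $ i $ e a) (S *v \<epsilon>)) \<partial>(std_gauss :: (real^'n^'k) measure)"]) measurable
  finally show ?thesis
    using nn_integral_pinv_coordinates[OF e pn pk m d probm probd] by simp
qed

text \<open>Singularity is expressed by the integral of an indicator, so that rotation and column
  selection apply. The selected columns form a \<open>k\<close> by \<open>p\<close> Gaussian matrix,
  whose law has a Lebesgue density.\<close>

lemma AE_std_gauss_full_column_rank:
  fixes Q :: "real^'p^'n"
  assumes Q: "transpose Q ** Q = mat 1" and pn: "CARD('p) < CARD('n)" and pk: "CARD('p) \<le> CARD('k)"
  shows "AE S in std_gauss. det (transpose (S ** Q) ** ((S :: real^'n^'k) ** Q)) \<noteq> 0"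
proof -
  obtain W :: "real^'n^'n" and e :: "'p \<Rightarrow> 'n"
    where W: "orthogonal_matrix W" and e: "inj e" and We: "\<And>a. column (e a) W = column a Q"
    using orthonormal_columns_extend[OF Q] by blast
  have "range e \<noteq> UNIV"
    using card_image[OF e] pn by (metis less_irrefl)
  then obtain j where j: "j \<notin> range e" by auto
  interpret k: prob_space "std_gauss :: (real^'k) measure" by (rule prob_space_std_gauss)
  define F :: "real^'p^'k \<Rightarrow> ennreal" where "F A = (if det (transpose A ** A) = 0 then 1 else 0)" for A
  have [measurable]: "F \<in> borel_measurable borel" unfolding F_def by measurable
  have "(\<integral>\<^sup>+S. F (S ** Q) \<partial>(std_gauss :: (real^'n^'k) measure)) =
      (\<integral>\<^sup>+S. F (\<chi> i a. S $ i $ e a) \<partial>(std_gauss :: (real^'n^'k) measure))"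
    by (rule nn_integral_std_gauss_rotated[OF W We, of "\<lambda>A w. F A"]) measurable
  also have "\<dots> = (\<integral>\<^sup>+A. \<integral>\<^sup>+w. F A \<partial>(std_gauss :: (real^'k) measure) \<partial>(std_gauss :: (real^'p^'k) measure))"
    using nn_integral_std_gauss_columns[OF e j, of "\<lambda>x :: (real^'p^'k) \<times> (real^'k). F (fst x)"]
      nn_integral_std_gauss_pair[of "\<lambda>x :: (real^'p^'k) \<times> (real^'k). F (fst x)"]
    by (simp add: borel_prod[symmetric])
  also have "\<dots> = (\<integral>\<^sup>+A. F A \<partial>(std_gauss :: (real^'p^'k) measure))"
    by (simp add: k.emeasure_space_1[simplified])
  also have "\<dots> = 0"
  proof (subst nn_integral_0_iff_AE)
    show "AE A in (std_gauss :: (real^'p^'k) measure). F A = 0"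
      unfolding std_gauss_def using AE_full_column_rank[OF pk] by (subst AE_density) (auto simp: F_def)
  qed measurable
  finally show ?thesis
    by (subst (asm) nn_integral_0_iff_AE) (auto simp: F_def split: if_splits)
qed

subsection \<open>Distributions of the given random variables\<close>

text \<open>Transports independence of matrix entries indexed by pairs to coordinates indexed by
  basis vectors.\<close>

lemma (in prob_space) indep_vars_reindex:
  assumes inj: "inj_on f I" and ind: "indep_vars M' X (f ` I)"
  shows "indep_vars (\<lambda>i. M' (f i)) (\<lambda>i. X (f i)) I"
  unfolding indep_vars_def2 indep_sets_def
proof (intro conjI ballI allI impI)
  note ind' = ind[unfolded indep_vars_def2]
  show "random_variable (M' (f i)) (X (f i))" if "i \<in> I" for i using ind' that by auto
  then show "{X (f i) -` A \<inter> space M |A. A \<in> sets (M' (f i))} \<subseteq> events" if "i \<in> I" for i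
    using that by auto
  fix J A assume J: "J \<subseteq> I" "J \<noteq> {}" "finite J"
    and A: "A \<in> (\<Pi> j\<in>J. {X (f j) -` A \<inter> space M |A. A \<in> sets (M' (f j))})"
  have injJ: "inj_on f J" using inj J(1) by (rule inj_on_subset)
  let ?g = "the_inv_into J f"
  have "prob (\<Inter>j\<in>f ` J. A (?g j)) = (\<Prod>j\<in>f ` J. prob (A (?g j)))"
  proof (rule indep_setsD[OF conjunct2[OF ind']])
    show "\<forall>j\<in>f ` J. A (?g j) \<in> {X j -` A \<inter> space M |A. A \<in> sets (M' j)}"
      using A by (auto simp: the_inv_into_f_f[OF injJ] Pi_iff)
  qed (use J in auto)
  then show "prob (\<Inter> (A ` J)) = (\<Prod>j\<in>J. prob (A j))"
    by (simp add: prod.reindex[OF injJ] the_inv_into_f_f[OF injJ] image_image cong: INF_cong_simp)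
qed

lemma (in prob_space) distr_gaussian_sketch:
  fixes S :: "'a \<Rightarrow> real^'n^'k"
  assumes S: "gaussian_sketch M S"
  shows "S \<in> borel_measurable M" "distr M borel (\<lambda>\<omega>. sqrt (real CARD('k)) *\<^sub>R S \<omega>) = std_gauss"
proof -
  have ind: "indep_vars (\<lambda>_. borel) (\<lambda>(i, j) \<omega>. S \<omega> $ i $ j) (UNIV :: ('k \<times> 'n) set)"
    and nd: "distributed M lborel (\<lambda>\<omega>. S \<omega> $ i $ j) (normal_density 0 (1 / sqrt (real CARD('k))))" for i j
    using S by (auto simp: gaussian_sketch_def)
  have "(\<lambda>\<omega>. S \<omega> $ i $ j) \<in> borel_measurable M" for i j
    using nd[of i j] by (simp add: distributed_def)
  then show "S \<in> borel_measurable M" by (intro borel_measurable_vecI)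
  define c where "c = sqrt (real CARD('k))"
  have c: "c > 0" by (simp add: c_def)
  define g :: "'k \<times> 'n \<Rightarrow> real^'n^'k" where "g = (\<lambda>(i, j). axis i (axis j 1))"
  have g: "bij_betw g UNIV Basis"
    by (auto simp: bij_betw_def inj_on_def g_def axis_eq_axis Basis_vec_def)
  let ?f = "inv_into UNIV g"
  have f: "inj_on ?f Basis" "?f ` Basis = UNIV"
    using bij_betw_inv_into[OF g] by (auto simp: bij_betw_def)
  have "indep_vars (\<lambda>_. borel) (\<lambda>ij \<omega>. c * (case ij of (i, j) \<Rightarrow> \<lambda>\<omega>. S \<omega> $ i $ j) \<omega>) (UNIV :: ('k \<times> 'n) set)"
    by (rule indep_vars_compose2[OF ind]) auto
  then have "indep_vars (\<lambda>_. borel) (\<lambda>b \<omega>. c * (case ?f b of (i, j) \<Rightarrow> \<lambda>\<omega>. S \<omega> $ i $ j) \<omega>) Basis"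
    using indep_vars_reindex[OF f(1), of "\<lambda>_. borel"] by (simp add: f(2))
  moreover have "(\<lambda>\<omega>. c * (case ?f b of (i, j) \<Rightarrow> \<lambda>\<omega>. S \<omega> $ i $ j) \<omega>) = (\<lambda>\<omega>. (c *\<^sub>R S \<omega>) \<bullet> b)" if "b \<in> Basis" for b
  proof -
    obtain i j where ij: "?f b = (i, j)" by (cases "?f b")
    have "g (?f b) = b" using g that by (intro f_inv_into_f) (auto simp: bij_betw_def)
    then have "b = g (i, j)" by (simp only: ij)
    then have "b = axis i (axis j 1)" by (simp add: g_def)
    then show ?thesis unfolding ij by (simp add: inner_axis)
  qed
  ultimately have "indep_vars (\<lambda>_. borel) (\<lambda>b \<omega>. (c *\<^sub>R S \<omega>) \<bullet> b) Basis"
    by (subst (asm) indep_vars_cong[OF refl _ refl]) auto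
  moreover have "distributed M lborel (\<lambda>\<omega>. (c *\<^sub>R S \<omega>) \<bullet> b) std_normal_density" if b: "b \<in> Basis" for b
  proof -
    obtain i j where "b = axis i (axis j 1)" using b by (auto simp: Basis_vec_def)
    then show ?thesis
      using normal_density_affine[OF nd, of c 0 i j] c by (simp add: inner_axis c_def)
  qed
  ultimately show "distr M borel (\<lambda>\<omega>. sqrt (real CARD('k)) *\<^sub>R S \<omega>) = std_gauss"
    unfolding c_def[symmetric] by (rule distr_std_gaussI)
qed

lemma distr_standardized_mvn:
  fixes y :: "'a \<Rightarrow> real^'n"
  assumes \<sigma>: "\<sigma> > 0" and y: "mvn_distributed M y \<mu> (\<sigma>\<^sup>2 *\<^sub>R mat 1)"
  shows "y \<in> borel_measurable M" "distr M borel (\<lambda>\<omega>. inverse \<sigma> *\<^sub>R (y \<omega> - \<mu>)) = std_gauss"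
proof -
  let ?\<Sigma> = "\<sigma>\<^sup>2 *\<^sub>R mat 1 :: real^'n^'n"
  have d: "distributed M lborel y (mvn_density \<mu> ?\<Sigma>)" using y by (simp add: mvn_distributed_def)
  then show [measurable]: "y \<in> borel_measurable M" by (simp add: distributed_def)
  have inv: "?\<Sigma> *v (inverse (\<sigma>\<^sup>2) *\<^sub>R x) = x" for x
    using \<sigma> by (simp add: scaleR_matrix_vector_assoc[symmetric])
  have "invertible ?\<Sigma>" using y pos_def_invertible by (auto simp: mvn_distributed_def)
  then have minv: "matrix_inv ?\<Sigma> *v x = inverse (\<sigma>\<^sup>2) *\<^sub>R x" for x
    by (metis inv matrix_inv_left matrix_vector_mul_assoc matrix_vector_mul_lid)
  have "det ?\<Sigma> = (\<Prod>i\<in>UNIV. ?\<Sigma> $ i $ i)" by (rule det_diagonal) (simp add: mat_def)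
  then have det: "det ?\<Sigma> = \<sigma>\<^sup>2 ^ CARD('n)" by (simp add: mat_def)
  \<comment> \<open>The Jacobian \<open>\<sigma> ^ n\<close> of the affine substitution cancels the
    square root of the determinant of the covariance.\<close>
  have dens: "\<sigma> ^ CARD('n) * mvn_density \<mu> ?\<Sigma> (\<mu> + \<sigma> *\<^sub>R x) = std_gauss_density x" for x
  proof -
    have "sqrt ((2 * pi) ^ CARD('n) * \<sigma>\<^sup>2 ^ CARD('n)) = sqrt (2 * pi) ^ CARD('n) * \<sigma> ^ CARD('n)"
      using \<sigma> by (simp add: real_sqrt_mult real_sqrt_power power_mult_distrib)
    then show ?thesis
      using \<sigma> by (simp add: mvn_density_def std_gauss_density_def minv det power2_norm_eq_inner)
        (simp add: power2_eq_square field_simps)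
  qed
  have [measurable]: "(\<lambda>x. ennreal (mvn_density \<mu> ?\<Sigma> x)) \<in> borel_measurable borel"
    using d by (simp add: distributed_def)
  have l: "(lborel :: (real^'n) measure) = density (distr lborel borel (\<lambda>x. \<mu> + \<sigma> *\<^sub>R x)) (\<lambda>_. ennreal (\<sigma> ^ CARD('n)))"
    using lborel_affine[of \<sigma> \<mu>] \<sigma> by simp
  show "distr M borel (\<lambda>\<omega>. inverse \<sigma> *\<^sub>R (y \<omega> - \<mu>)) = std_gauss"
  proof (rule measure_eqI)
    fix D :: "(real^'n) set" assume "D \<in> sets (distr M borel (\<lambda>\<omega>. inverse \<sigma> *\<^sub>R (y \<omega> - \<mu>)))"
    then have [measurable]: "D \<in> sets borel" by simp
    have "emeasure (distr M borel (\<lambda>\<omega>. inverse \<sigma> *\<^sub>R (y \<omega> - \<mu>))) D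
      = (\<integral>\<^sup>+\<omega>. indicator D (inverse \<sigma> *\<^sub>R (y \<omega> - \<mu>)) \<partial>M)"
      using nn_integral_distr[of "\<lambda>\<omega>. inverse \<sigma> *\<^sub>R (y \<omega> - \<mu>)" M borel "indicator D"] by simp
    also have "\<dots> = (\<integral>\<^sup>+x. ennreal (mvn_density \<mu> ?\<Sigma> x) * indicator D (inverse \<sigma> *\<^sub>R (x - \<mu>)) \<partial>lborel)"
      by (rule distributed_nn_integral[OF d, symmetric]) measurable
    also have "\<dots> = (\<integral>\<^sup>+x. ennreal (mvn_density \<mu> ?\<Sigma> x) * indicator D (inverse \<sigma> *\<^sub>R (x - \<mu>))
        \<partial>density (distr lborel borel (\<lambda>x. \<mu> + \<sigma> *\<^sub>R x)) (\<lambda>_. ennreal (\<sigma> ^ CARD('n))))"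
      by (simp only: l[symmetric])
    also have "\<dots> = (\<integral>\<^sup>+x. ennreal (\<sigma> ^ CARD('n)) * (ennreal (mvn_density \<mu> ?\<Sigma> (\<mu> + \<sigma> *\<^sub>R x)) * indicator D x) \<partial>lborel)"
      using \<sigma> by (subst nn_integral_density) (auto simp: nn_integral_distr)
    also have "\<dots> = (\<integral>\<^sup>+x. ennreal (std_gauss_density x) * indicator D x \<partial>lborel)"
      using \<sigma> by (simp add: dens[symmetric] ennreal_mult' mult.assoc)
    also have "\<dots> = emeasure std_gauss D" by (simp add: std_gauss_def emeasure_density)
    finally show "emeasure (distr M borel (\<lambda>\<omega>. inverse \<sigma> *\<^sub>R (y \<omega> - \<mu>))) D = emeasure std_gauss D" .
  qed simp
qed

section \<open>Joint laws of independent variables as product measures\<close>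

lemma vimage_in_sigma_of: "A \<in> sets borel \<Longrightarrow> X -` A \<inter> space M \<in> sigma_of M X"
  unfolding sigma_of_def by (rule in_vimage_algebra)

lemma (in prob_space) distr_indep_rv2:
  fixes X :: "'a \<Rightarrow> 'b::second_countable_topology" and Y :: "'a \<Rightarrow> 'c::second_countable_topology"
  assumes [measurable]: "X \<in> borel_measurable M" "Y \<in> borel_measurable M" and ind: "indep_rv2 M X Y"
  shows "distr M borel X \<Otimes>\<^sub>M distr M borel Y = distr M (borel \<Otimes>\<^sub>M borel) (\<lambda>\<omega>. (X \<omega>, Y \<omega>))"
proof (rule pair_measure_eqI)
  interpret X: prob_space "distr M borel X" by (rule prob_space_distr) simp
  interpret Y: prob_space "distr M borel Y" by (rule prob_space_distr) simp
  show "sigma_finite_measure (distr M borel X)" "sigma_finite_measure (distr M borel Y)"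
    by unfold_locales
  fix A B assume "A \<in> sets (distr M borel X)" "B \<in> sets (distr M borel Y)"
  then have [measurable]: "A \<in> sets borel" "B \<in> sets borel" by auto
  have "prob ((X -` A \<inter> space M) \<inter> (Y -` B \<inter> space M)) = prob (X -` A \<inter> space M) * prob (Y -` B \<inter> space M)"
    using ind by (intro indep_setD) (auto simp: indep_rv2_def intro!: vimage_in_sigma_of)
  moreover have "(\<lambda>\<omega>. (X \<omega>, Y \<omega>)) -` (A \<times> B) \<inter> space M = (X -` A \<inter> space M) \<inter> (Y -` B \<inter> space M)" by auto
  ultimately show "emeasure (distr M borel X) A * emeasure (distr M borel Y) B =
      emeasure (distr M (borel \<Otimes>\<^sub>M borel) (\<lambda>\<omega>. (X \<omega>, Y \<omega>))) (A \<times> B)"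
    by (simp add: emeasure_distr emeasure_eq_measure ennreal_mult)
qed (simp cong: sets_pair_measure_cong)

text \<open>The nesting and order fit an iterated integral over \<open>V\<close>, \<open>U\<close>,
  \<open>Z\<close>. Independence gives the product formula on boxes; to reach
  \<open>B \<times> W\<close> for every \<open>W\<close> in the product sigma-algebra, the pair is
  treated under \<open>M\<close> restricted to the event that \<open>Y\<close> lies in
  \<open>B\<close>.\<close>

lemma (in prob_space) distr_indep_rv3:
  fixes X :: "'a \<Rightarrow> 'b::second_countable_topology" and Y :: "'a \<Rightarrow> 'c::second_countable_topology"
    and Z :: "'a \<Rightarrow> 'd::second_countable_topology"
  assumes [measurable]: "X \<in> borel_measurable M" "Y \<in> borel_measurable M" "Z \<in> borel_measurable M"
    and ind: "indep_rv3 M X Y Z"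
  shows "distr M borel Y \<Otimes>\<^sub>M (distr M borel Z \<Otimes>\<^sub>M distr M borel X) =
    distr M (borel \<Otimes>\<^sub>M (borel \<Otimes>\<^sub>M borel)) (\<lambda>\<omega>. (Y \<omega>, Z \<omega>, X \<omega>))"
proof (rule pair_measure_eqI)
  interpret X: prob_space "distr M borel X" by (rule prob_space_distr) simp
  interpret Y: prob_space "distr M borel Y" by (rule prob_space_distr) simp
  interpret Z: prob_space "distr M borel Z" by (rule prob_space_distr) simp
  interpret ZX: pair_prob_space "distr M borel Z" "distr M borel X" ..
  show "sigma_finite_measure (distr M borel Y)" "sigma_finite_measure (distr M borel Z \<Otimes>\<^sub>M distr M borel X)"
    by unfold_locales
  fix B W assume "B \<in> sets (distr M borel Y)" and "W \<in> sets (distr M borel Z \<Otimes>\<^sub>M distr M borel X)"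
  then have [measurable]: "B \<in> sets borel" and W [measurable]: "W \<in> sets (borel \<Otimes>\<^sub>M borel)"
    by (auto cong: sets_pair_measure_cong)
  let ?B = "Y -` B \<inter> space M"
  have [measurable]: "?B \<in> sets M" by measurable
  have prod: "prob ((X -` A \<inter> space M) \<inter> ?B \<inter> (Z -` C \<inter> space M)) =
      prob (X -` A \<inter> space M) * prob ?B * prob (Z -` C \<inter> space M)"
    if "A \<in> sets borel" "C \<in> sets borel" for A C
  proof -
    let ?F = "\<lambda>i::nat. [X -` A \<inter> space M, ?B, Z -` C \<inter> space M] ! i"
    have "prob (\<Inter>j\<in>{..<3}. ?F j) = (\<Prod>j\<in>{..<3}. prob (?F j))"
      using that by (intro indep_setsD[OF ind[unfolded indep_rv3_def]])
        (auto simp: numeral_3_eq_3 less_Suc_eq intro!: vimage_in_sigma_of)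
    moreover have "{..<3::nat} = {0, 1, 2}" by auto
    ultimately show ?thesis by (simp add: Int_ac mult_ac)
  qed
  have "density (distr M borel Z) (\<lambda>_. ennreal (prob ?B)) \<Otimes>\<^sub>M distr M borel X
      = distr (density M (indicator ?B)) (borel \<Otimes>\<^sub>M borel) (\<lambda>\<omega>. (Z \<omega>, X \<omega>))"
  proof (rule pair_measure_eqI)
    show "sigma_finite_measure (density (distr M borel Z) (\<lambda>_. ennreal (prob ?B)))"
      by (subst Z.sigma_finite_iff_density_finite) auto
    show "sigma_finite_measure (distr M borel X)" by unfold_locales
    fix C A assume "C \<in> sets (density (distr M borel Z) (\<lambda>_. ennreal (prob ?B)))" "A \<in> sets (distr M borel X)"
    then have [measurable]: "C \<in> sets borel" "A \<in> sets borel" by auto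
    let ?S = "(\<lambda>\<omega>. (Z \<omega>, X \<omega>)) -` (C \<times> A) \<inter> space M"
    have "emeasure (distr (density M (indicator ?B)) (borel \<Otimes>\<^sub>M borel) (\<lambda>\<omega>. (Z \<omega>, X \<omega>))) (C \<times> A)
        = emeasure M (?B \<inter> ?S)"
      by (subst emeasure_distr) (auto simp: emeasure_density indicator_inter_arith[symmetric])
    also have "?B \<inter> ?S = (X -` A \<inter> space M) \<inter> ?B \<inter> (Z -` C \<inter> space M)" by auto
    also have "emeasure M \<dots> = ennreal (prob (X -` A \<inter> space M) * prob ?B * prob (Z -` C \<inter> space M))"
      by (simp add: emeasure_eq_measure prod)
    also have "\<dots> = (ennreal (prob ?B) * emeasure (distr M borel Z) C) * emeasure (distr M borel X) A"
      by (simp add: emeasure_distr emeasure_eq_measure ennreal_mult mult_ac)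
    also have "ennreal (prob ?B) * emeasure (distr M borel Z) C = emeasure (density (distr M borel Z) (\<lambda>_. ennreal (prob ?B))) C"
      by (subst emeasure_density) (auto simp: nn_integral_cmult)
    finally show "emeasure (density (distr M borel Z) (\<lambda>_. ennreal (prob ?B))) C * emeasure (distr M borel X) A =
        emeasure (distr (density M (indicator ?B)) (borel \<Otimes>\<^sub>M borel) (\<lambda>\<omega>. (Z \<omega>, X \<omega>))) (C \<times> A)" ..
  qed (simp cong: sets_pair_measure_cong)
  then have "emeasure (density (distr M borel Z) (\<lambda>_. ennreal (prob ?B)) \<Otimes>\<^sub>M distr M borel X) W
      = emeasure (distr (density M (indicator ?B)) (borel \<Otimes>\<^sub>M borel) (\<lambda>\<omega>. (Z \<omega>, X \<omega>))) W" by simp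
  moreover have "emeasure (density (distr M borel Z) (\<lambda>_. ennreal (prob ?B)) \<Otimes>\<^sub>M distr M borel X) W
      = ennreal (prob ?B) * emeasure (distr M borel Z \<Otimes>\<^sub>M distr M borel X) W"
    by (simp add: X.emeasure_pair_measure nn_integral_density nn_integral_cmult cong: sets_pair_measure_cong)
  moreover have "emeasure (distr (density M (indicator ?B)) (borel \<Otimes>\<^sub>M borel) (\<lambda>\<omega>. (Z \<omega>, X \<omega>))) W
      = emeasure (distr M (borel \<Otimes>\<^sub>M (borel \<Otimes>\<^sub>M borel)) (\<lambda>\<omega>. (Y \<omega>, Z \<omega>, X \<omega>))) (B \<times> W)"
  proof -
    let ?S = "(\<lambda>\<omega>. (Z \<omega>, X \<omega>)) -` W \<inter> space M"
    have "emeasure (distr (density M (indicator ?B)) (borel \<Otimes>\<^sub>M borel) (\<lambda>\<omega>. (Z \<omega>, X \<omega>))) W = emeasure M (?B \<inter> ?S)"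
      by (subst emeasure_distr) (auto simp: emeasure_density indicator_inter_arith[symmetric])
    also have "?B \<inter> ?S = (\<lambda>\<omega>. (Y \<omega>, Z \<omega>, X \<omega>)) -` (B \<times> W) \<inter> space M" by auto
    finally show ?thesis by (simp add: emeasure_distr)
  qed
  ultimately show "emeasure (distr M borel Y) B * emeasure (distr M borel Z \<Otimes>\<^sub>M distr M borel X) W =
      emeasure (distr M (borel \<Otimes>\<^sub>M (borel \<Otimes>\<^sub>M borel)) (\<lambda>\<omega>. (Y \<omega>, Z \<omega>, X \<omega>))) (B \<times> W)"
    by (simp add: emeasure_distr[of Y] emeasure_eq_measure)
qed (simp cong: sets_pair_measure_cong)

text \<open>Scaling the sketch cancels: with \<open>A = c S Q\<close> one has
  \<open>S X = A (R / c)\<close>, and \<open>S y\<close> carries the same factor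
  \<open>1 / c\<close>. The mean part \<open>X \<beta>\<close> is reproduced exactly because
  \<open>pinv A\<close> is a left inverse of \<open>A\<close>, which leaves only the noise.\<close>

lemma complete_sketch_estimator_decomposition:
  fixes S :: "real^'n^'k" and X Q :: "real^'p^'n" and B R :: "real^'p^'p"
  assumes X: "X = Q ** R" and RB: "R ** B = mat 1" and c: "c \<noteq> 0" and \<sigma>: "\<sigma> \<noteq> 0"
    and det: "det (transpose ((c *\<^sub>R S) ** Q) ** ((c *\<^sub>R S) ** Q)) \<noteq> 0"
  shows "complete_sketch_estimator S X y =
    \<beta> + \<sigma> *\<^sub>R (B *v pinv ((c *\<^sub>R S) ** Q) ((c *\<^sub>R S) *v (inverse \<sigma> *\<^sub>R (y - X *v \<beta>))))"
proof -
  define A where "A = (c *\<^sub>R S) ** Q"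
  define \<epsilon> where "\<epsilon> = inverse \<sigma> *\<^sub>R (y - X *v \<beta>)"
  have sl: "(r *\<^sub>R G) ** H = r *\<^sub>R (G ** H)" "G ** (r *\<^sub>R H) = r *\<^sub>R (G ** H)"
    for r and G :: "real^'b^'a" and H :: "real^'c^'b"
    by (simp_all add: vec_eq_iff matrix_matrix_mult_def sum_distrib_left mult_ac)
  have SX: "S ** X = A ** (inverse c *\<^sub>R R)"
    using c by (simp add: A_def X sl matrix_mul_assoc)
  have inv: "(inverse c *\<^sub>R R) ** (c *\<^sub>R B) = mat 1"
    using c by (simp add: sl RB)
  have y: "y = X *v \<beta> + \<sigma> *\<^sub>R \<epsilon>" using \<sigma> by (simp add: \<epsilon>_def)
  have "(c *\<^sub>R S) *v y = A *v (R *v \<beta>) + \<sigma> *\<^sub>R ((c *\<^sub>R S) *v \<epsilon>)"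
    by (simp add: y A_def X matrix_vector_right_distrib matrix_vector_mult_scaleR matrix_vector_mul_assoc matrix_mul_assoc)
  then have Sy: "S *v y = inverse c *\<^sub>R (A *v (R *v \<beta>) + \<sigma> *\<^sub>R ((c *\<^sub>R S) *v \<epsilon>))"
    using c by (metis scaleR_matrix_vector_assoc scaleR_left_imp_eq scaleR_scaleR right_inverse scaleR_one)
  have BR: "B *v (R *v \<beta>) = \<beta>"
    using RB by (metis matrix_left_right_inverse matrix_vector_mul_assoc matrix_vector_mul_lid)
  have "complete_sketch_estimator S X y = (c *\<^sub>R B) *v pinv A (S *v y)"
    unfolding complete_sketch_estimator_eq_pinv SX
    by (rule pinv_mult_invertible[OF det[folded A_def] inv])
  also have "\<dots> = B *v pinv A (A *v (R *v \<beta>) + \<sigma> *\<^sub>R ((c *\<^sub>R S) *v \<epsilon>))"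
    using c by (simp add: Sy pinv_scaleR scaleR_matrix_vector_assoc[symmetric] matrix_vector_mult_scaleR)
  also have "\<dots> = \<beta> + \<sigma> *\<^sub>R (B *v pinv A ((c *\<^sub>R S) *v \<epsilon>))"
    by (simp add: pinv_add pinv_scaleR pinv_mult_vector[OF det[folded A_def]] matrix_vector_right_distrib
        matrix_vector_mult_scaleR BR)
  finally show ?thesis by (simp add: A_def \<epsilon>_def)
qed

text \<open>The law of an actual random variable has mass one, which gives the normalization of the
  density.\<close>

lemma (in prob_space) chi_square_distributedD:
  assumes "chi_square_distributed M V d"
  shows "V \<in> borel_measurable M" "distr M borel V = density lborel (chi_square_density d)"
    "prob_space (density lborel (chi_square_density d))"
proof -
  have D: "distributed M lborel V (chi_square_density d)" using assms by (simp add: chi_square_distributed_def)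
  then show V: "V \<in> borel_measurable M" by (simp add: distributed_def)
  show d: "distr M borel V = density lborel (chi_square_density d)"
    unfolding distributed_distr_eq_density[OF D, symmetric] by (rule distr_cong) auto
  show "prob_space (density lborel (chi_square_density d))"
    unfolding d[symmetric] using V by (rule prob_space_distr)
qed

theorem mainTheorem4:
  fixes M :: "'a measure" and N :: "'b measure"
    and X :: "real^'p^'n" and \<beta>\<^sub>0 :: "real^'p" and \<sigma> :: real
    and y :: "'a \<Rightarrow> real^'n" and S :: "'a \<Rightarrow> real^'n^'k"
    and Z :: "'b \<Rightarrow> real^'p" and V U :: "'b \<Rightarrow> real"
  assumes "prob_space M"
    and "CARD('p) < CARD('n)" and "rank X = CARD('p)"
    and "\<sigma> > 0"
    and "mvn_distributed M y (X *v \<beta>\<^sub>0) (\<sigma>\<^sup>2 *\<^sub>R mat 1)"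
    and "CARD('k) \<ge> CARD('p)"
    and "gaussian_sketch M S"
    and "indep_rv2 M S y"
    and "prob_space N"
    and "mvn_distributed N Z 0 (mat 1)"
    and "chi_square_distributed N V (CARD('n) - CARD('p))"
    and "chi_square_distributed N U (CARD('k) - CARD('p) + 1)"
    and "indep_rv3 N Z V U"
  shows "eq_in_distribution
           M (\<lambda>\<omega>. complete_sketch_estimator (S \<omega>) X (y \<omega>))
           N (\<lambda>\<omega>. \<beta>\<^sub>0 + (\<sigma> * sqrt (1 + V \<omega> / U \<omega>)) *\<^sub>R
                          (inv_sqrt_matrix (transpose X ** X) *v Z \<omega>))"
proof -
  interpret M: prob_space M by fact
  interpret N: prob_space N by fact
  interpret kn: prob_space "std_gauss :: (real^'n^'k) measure" by (rule prob_space_std_gauss)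
  interpret n: prob_space "std_gauss :: (real^'n) measure" by (rule prob_space_std_gauss)
  interpret p: prob_space "std_gauss :: (real^'p) measure" by (rule prob_space_std_gauss)
  have "inj ((*v) X)" using assms(3) by (simp add: full_rank_injective)
  define B where "B = inv_sqrt_matrix (transpose X ** X)"
  define Q where "Q = X ** B"
  define R where "R = matrix_inv B"
  have Q: "transpose Q ** Q = mat 1" and iB: "invertible B"
    using orthonormalize[OF \<open>inj ((*v) X)\<close>] by (simp_all add: Q_def B_def)
  have RB: "R ** B = mat 1" and X: "X = Q ** R"
    using matrix_inv_left[OF iB] matrix_inv_right[OF iB]
    by (simp_all add: R_def Q_def matrix_mul_assoc[symmetric])
  define c where "c = sqrt (real CARD('k))"
  have c: "c \<noteq> 0" by (simp add: c_def)
  note S = M.distr_gaussian_sketch[OF assms(7), folded c_def]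
  note y = distr_standardized_mvn[OF assms(4,5)]
  have "mvn_distributed N Z 0 (1\<^sup>2 *\<^sub>R mat 1)" using assms(10) by simp
  from distr_standardized_mvn[OF zero_less_one this]
  have Z: "Z \<in> borel_measurable N" "distr N borel Z = std_gauss" by simp_all
  note V = N.chi_square_distributedD[OF assms(11)]
  note U = N.chi_square_distributedD[OF assms(12)]
  let ?Cv = "density lborel (chi_square_density (CARD('n) - CARD('p)))"
  let ?Cu = "density lborel (chi_square_density (CARD('k) - CARD('p) + 1))"
  interpret Cv: prob_space ?Cv by (rule V)
  interpret Cu: prob_space ?Cu by (rule U)
  interpret Cup: pair_prob_space ?Cu "std_gauss :: (real^'p) measure" ..
  interpret knn: pair_sigma_finite "std_gauss :: (real^'n^'k) measure" "std_gauss :: (real^'n) measure" ..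
  interpret dy: prob_space "distr M borel y" using y(1) by (rule M.prob_space_distr)
  have [measurable]: "S \<in> borel_measurable M" "y \<in> borel_measurable M" "Z \<in> borel_measurable N"
    "V \<in> borel_measurable N" "U \<in> borel_measurable N"
    using S y Z V U by auto
  have estm [measurable]: "(\<lambda>\<omega>. complete_sketch_estimator (S \<omega>) X (y \<omega>)) \<in> borel_measurable M"
    unfolding complete_sketch_estimator_eq_pinv by measurable
  have rhsm [measurable]: "(\<lambda>\<omega>. \<beta>\<^sub>0 + (\<sigma> * sqrt (1 + V \<omega> / U \<omega>)) *\<^sub>R (B *v Z \<omega>)) \<in> borel_measurable N"
    by measurable
  have "distr M borel (\<lambda>\<omega>. complete_sketch_estimator (S \<omega>) X (y \<omega>)) =
    distr N borel (\<lambda>\<omega>. \<beta>\<^sub>0 + (\<sigma> * sqrt (1 + V \<omega> / U \<omega>)) *\<^sub>R (B *v Z \<omega>))"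
  proof (rule measure_eqI)
    fix D :: "(real^'p) set"
    assume "D \<in> sets (distr M borel (\<lambda>\<omega>. complete_sketch_estimator (S \<omega>) X (y \<omega>)))"
    then have [measurable]: "D \<in> sets borel" by simp
    \<comment> \<open>Pulling \<open>D\<close> back along this affine map leaves only the
      standardized vector \<open>pinv (c S Q) (c S \<epsilon>)\<close> to be compared.\<close>
    define F :: "real^'p \<Rightarrow> ennreal" where "F t = indicator D (\<beta>\<^sub>0 + \<sigma> *\<^sub>R (B *v t))" for t
    have [measurable]: "F \<in> borel_measurable borel" unfolding F_def by measurable
    define H where "H s e = F (pinv (s ** Q) (s *v e))" for s :: "real^'n^'k" and e
    have [measurable]: "case_prod H \<in> borel_measurable (borel \<Otimes>\<^sub>M borel)" unfolding H_def by measurable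
    let ?\<epsilon> = "\<lambda>y. inverse \<sigma> *\<^sub>R (y - X *v \<beta>\<^sub>0)"
    have "AE s in distr M borel (\<lambda>\<omega>. c *\<^sub>R S \<omega>). det (transpose (s ** Q) ** (s ** Q)) \<noteq> 0"
      unfolding S(2) by (rule AE_std_gauss_full_column_rank[OF Q assms(2,6)])
    then have ae: "AE \<omega> in M. det (transpose ((c *\<^sub>R S \<omega>) ** Q) ** ((c *\<^sub>R S \<omega>) ** Q)) \<noteq> 0"
      by (subst (asm) AE_distr_iff) auto
    have "emeasure (distr M borel (\<lambda>\<omega>. complete_sketch_estimator (S \<omega>) X (y \<omega>))) D
      = (\<integral>\<^sup>+\<omega>. indicator D (complete_sketch_estimator (S \<omega>) X (y \<omega>)) \<partial>M)"
      using nn_integral_distr[OF estm, of "indicator D"] by simp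
    also have "\<dots> = (\<integral>\<^sup>+\<omega>. H (c *\<^sub>R S \<omega>) (?\<epsilon> (y \<omega>)) \<partial>M)"
    proof (rule nn_integral_cong_AE, use ae in eventually_elim)
      fix \<omega> assume det: "det (transpose ((c *\<^sub>R S \<omega>) ** Q) ** ((c *\<^sub>R S \<omega>) ** Q)) \<noteq> 0"
      show "indicator D (complete_sketch_estimator (S \<omega>) X (y \<omega>)) = H (c *\<^sub>R S \<omega>) (?\<epsilon> (y \<omega>))"
        unfolding H_def F_def
        using complete_sketch_estimator_decomposition[OF X RB c _ det, of \<sigma> "y \<omega>" \<beta>\<^sub>0] assms(4)
        by simp
    qed
    also have "\<dots> = (\<integral>\<^sup>+x. H (c *\<^sub>R fst x) (?\<epsilon> (snd x)) \<partial>distr M (borel \<Otimes>\<^sub>M borel) (\<lambda>\<omega>. (S \<omega>, y \<omega>)))"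
      by (subst nn_integral_distr) auto
    also have "\<dots> = (\<integral>\<^sup>+x. H (c *\<^sub>R fst x) (?\<epsilon> (snd x)) \<partial>(distr M borel S \<Otimes>\<^sub>M distr M borel y))"
      by (subst M.distr_indep_rv2) (use assms(8) in auto)
    also have "\<dots> = (\<integral>\<^sup>+\<omega>. \<integral>\<^sup>+\<omega>'. H (c *\<^sub>R S \<omega>) (?\<epsilon> (y \<omega>')) \<partial>M \<partial>M)"
      by (subst dy.nn_integral_fst[symmetric]) (auto simp: nn_integral_distr)
    also have "\<dots> = (\<integral>\<^sup>+\<omega>. \<integral>\<^sup>+e. H (c *\<^sub>R S \<omega>) e \<partial>std_gauss \<partial>M)"
      unfolding y(2)[symmetric] by (simp add: nn_integral_distr)
    also have "\<dots> = (\<integral>\<^sup>+s. \<integral>\<^sup>+e. H s e \<partial>std_gauss \<partial>std_gauss)"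
      unfolding S(2)[symmetric] by (subst nn_integral_distr) auto
    \<comment> \<open>The noise becomes the outer variable, so that \<open>S\<close> is integrated
      while the noise is held fixed.\<close>
    also have "\<dots> = (\<integral>\<^sup>+e. \<integral>\<^sup>+s. H s e \<partial>std_gauss \<partial>std_gauss)"
      by (rule knn.Fubini'[symmetric]) measurable
    also have "\<dots> = (\<integral>\<^sup>+v. \<integral>\<^sup>+u. \<integral>\<^sup>+z. F (sqrt (1 + v / u) *\<^sub>R z) \<partial>std_gauss \<partial>?Cu \<partial>?Cv)"
      unfolding H_def by (rule nn_integral_pinv_orthonormal[OF Q assms(2,6) refl refl V(3) U(3)]) measurable
    also have "\<dots> = (\<integral>\<^sup>+x. (case x of (v, u, z) \<Rightarrow> F (sqrt (1 + v / u) *\<^sub>R z)) \<partial>(?Cv \<Otimes>\<^sub>M (?Cu \<Otimes>\<^sub>M std_gauss)))"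
      by (subst Cup.nn_integral_fst[symmetric], measurable, subst p.nn_integral_fst[symmetric], auto)
    also have "?Cv \<Otimes>\<^sub>M (?Cu \<Otimes>\<^sub>M std_gauss) = distr N (borel \<Otimes>\<^sub>M (borel \<Otimes>\<^sub>M borel)) (\<lambda>\<omega>. (V \<omega>, U \<omega>, Z \<omega>))"
      unfolding V(2)[symmetric] U(2)[symmetric] Z(2)[symmetric]
      by (rule N.distr_indep_rv3) (use assms(13) in auto)
    also have "(\<integral>\<^sup>+x. (case x of (v, u, z) \<Rightarrow> F (sqrt (1 + v / u) *\<^sub>R z)) \<partial>\<dots>)
      = (\<integral>\<^sup>+\<omega>. indicator D (\<beta>\<^sub>0 + (\<sigma> * sqrt (1 + V \<omega> / U \<omega>)) *\<^sub>R (B *v Z \<omega>)) \<partial>N)"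
      by (subst nn_integral_distr) (auto simp: F_def matrix_vector_mult_scaleR)
    also have "\<dots> = emeasure (distr N borel (\<lambda>\<omega>. \<beta>\<^sub>0 + (\<sigma> * sqrt (1 + V \<omega> / U \<omega>)) *\<^sub>R (B *v Z \<omega>))) D"
      using nn_integral_distr[OF rhsm, of "indicator D"] by simp
    finally show "emeasure (distr M borel (\<lambda>\<omega>. complete_sketch_estimator (S \<omega>) X (y \<omega>))) D =
      emeasure (distr N borel (\<lambda>\<omega>. \<beta>\<^sub>0 + (\<sigma> * sqrt (1 + V \<omega> / U \<omega>)) *\<^sub>R (B *v Z \<omega>))) D" .
  qed simp
  then show ?thesis
    using estm rhsm by (simp add: eq_in_distribution_def B_def)
qed

end
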